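(* Fix the model parameters $b,p>0$ and $\kappa\in\mathbb{N}$, where $p\le 1$ is assumed for $\mathrm D=\mathrm G$. Then for both $\mathrm D\in\{\mathrm L,\mathrm G\}$, the triple $\frac1N(A_N,S_N,R_N)$ satisfies, as $N\to\infty$, a large-deviation principle under $\mathbb{P}^{(N)}_{\mathrm{D,IB}}$ with rate function $I_{\mathrm{D,IB}}$, i.e., for any open, respectively closed, set $G,F\subset[0,b]\times[0,b]\times[0,1]$, $$\limsup_{N\to\infty}\frac1N\log\mathbb{P}^{(N)}_{\mathrm{D,IB}}\Big(\tfrac1N(A_N,S_N,R_N)\in F\Big)\le-\inf_F I_{\mathrm{D,IB}},$$ $$\liminf_{N\to\infty}\frac1N\log\mathbb{P}^{(N)}_{\mathrm{D,IB}}\Big(\tfrac1N(A_N,S_N,R_N)\in G\Big)\ge-\inf_G I_{\mathrm{D,IB}}.$$ Here $$I_{\mathrm{L,IB}}(a,s,r)=\inf\Big\{H(\mu|\mathrm{Poi}_{bp})\colon \mu\in\mathcal M_1(\mathbb{N}_0),\ \sum_{k\in\mathbb{N}_0}f(k)\mu_k=(a,s,r)\Big\},$$ where $f(k)=(k,\;k\mathbf 1\{k\le\kappa\},\;\mathbf 1\{k\le\kappa\})$, while $$I_{\mathrm{G,IB}}(a,s,r)=I_{\mathrm{L,IB}}(a,s,r)+(b-a)\log\frac{1-\frac ab}{1-p}+a-bp .$$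
   Context: Model. For $N\in\mathbb{N}$ (large) there are $bN$ participants (integer-part brackets are omitted) and $N$ time slots. Attempts to send messages are made according to one of two access rules. Rule (L) (local; $p\in(0,\infty)$): in each time slot each participant makes a transmission attempt with probability $p/N$, independently over all participants and all slots. Rule (G) (global; $p\in(0,1]$): each participant independently decides with probability $p$ to make exactly one attempt (otherwise none), and then all attempts are distributed randomly, uniformly and independently over the $N$ slots. Success rule (IB) (interference-based, with threshold $\kappa\in\mathbb{N}$): in any given slot all attempts are successful if their number in that slot does not exceed $\kappa$; otherwise all attempts in that slot are unsuccessful. $A_N$ is the total number of attempts in all $N$ slots, $S_N$ the total number of successful attempts, and $R_N$ the number of successful slots, i.e., slots in which the number of attempts is at most $\kappa$ (slots without attempts included). $\mathbb{P}^{(N)}_{\mathrm{D,IB}}$ is the probability measure for access Rule (D), $\mathrm D\in\{\mathrm L,\mathrm G\}$, with success rule (IB). Notation. $\mathbb{N}_0=\{0,1,2,\dots\}$; $\mathcal M_1(\mathbb{N}_0)$ is the set of probability measures on $\mathbb{N}_0$; $\mathrm{Poi}_\alpha(k)=e^{-\alpha}\alpha^k/k!$ is the Poisson distribution with parameter $\alpha$; $H(\mu|\nu)=\sum_{k}\mu_k\log\frac{\mu_k}{\nu_k}$ is the relative entropy. *)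

theory Defs
  imports "HOL-Probability.Probability"
begin

section \<open>Large-deviation principles\<close>

text \<open>The real \<open>ln\<close> satisfies \<open>ln 0 = 0\<close>; probabilities may vanish, so their logarithm must be able
  to take the value \<open>-\<infinity>\<close>.\<close>

definition ln_prob :: "real \<Rightarrow> ereal" where
  "ln_prob x = (if x = 0 then - \<infinity> else ereal (ln x))"

definition rate_function_on :: "'a::topological_space set \<Rightarrow> ('a \<Rightarrow> ereal) \<Rightarrow> bool" where
  "rate_function_on X I \<longleftrightarrow>
     (\<forall>x\<in>X. 0 \<le> I x) \<and>
     (\<forall>c::real. closedin (top_of_set X) {x \<in> X. I x \<le> ereal c})"

text \<open>Speed \<open>N\<close>, state space \<open>X\<close> with its subspace topology. The variables \<open>Z N\<close> are not required to
  take values in \<open>X\<close>; the two bounds concern only events \<open>Z N \<in> F\<close>, \<open>Z N \<in> G\<close> with \<open>F, G \<subseteq> X\<close>.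
  The infimum over the empty set is \<open>\<infinity>\<close>.\<close>

definition large_deviation_principle ::
  "'a::topological_space set \<Rightarrow> (nat \<Rightarrow> 'w measure) \<Rightarrow> (nat \<Rightarrow> 'w \<Rightarrow> 'a) \<Rightarrow> ('a \<Rightarrow> ereal) \<Rightarrow> bool" where
  "large_deviation_principle X P Z I \<longleftrightarrow>
     rate_function_on X I \<and>
     (\<forall>F. closedin (top_of_set X) F \<longrightarrow>
        limsup (\<lambda>N. ereal (1 / real N) * ln_prob (measure (P N) {\<omega> \<in> space (P N). Z N \<omega> \<in> F}))
          \<le> - (INF x\<in>F. I x)) \<and>
     (\<forall>G. openin (top_of_set X) G \<longrightarrow>
        liminf (\<lambda>N. ereal (1 / real N) * ln_prob (measure (P N) {\<omega> \<in> space (P N). Z N \<omega> \<in> G}))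
          \<ge> - (INF x\<in>G. I x))"


section \<open>Relative entropy\<close>

text \<open>Conventions \<open>0 log (0/y) = 0\<close> and \<open>x log (x/0) = \<infinity>\<close> for \<open>x > 0\<close>. Since
  \<open>x log (x/y) \<ge> x - y\<close>, the negative parts of the terms are summable, so the partial sums always
  converge in \<open>(-\<infinity>, \<infinity>]\<close>.\<close>

definition rel_entropy :: "nat pmf \<Rightarrow> nat pmf \<Rightarrow> ereal" where
  "rel_entropy \<mu> \<nu> =
     (\<Sum>k. if pmf \<mu> k = 0 then 0
          else if pmf \<nu> k = 0 then \<infinity>
          else ereal (pmf \<mu> k * ln (pmf \<mu> k / pmf \<nu> k)))"


section \<open>The access model\<close>

datatype access_rule = Local | Global

definition participants :: "real \<Rightarrow> nat \<Rightarrow> nat set" where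
  "participants b N = {..<nat \<lfloor>b * real N\<rfloor>}"

text \<open>An outcome is the set of all attempts, where \<open>(i, t)\<close> is an attempt of participant \<open>i\<close> in
  slot \<open>t < N\<close>.\<close>

type_synonym attempts = "(nat \<times> nat) set"

text \<open>\<open>bernoulli_pmf\<close> truncates its parameter to \<open>[0, 1]\<close>, which matters only for the finitely many
  \<open>N < p\<close>.\<close>

definition local_attempts :: "real \<Rightarrow> real \<Rightarrow> nat \<Rightarrow> attempts pmf" where
  "local_attempts b p N =
     map_pmf (\<lambda>X. {it \<in> participants b N \<times> {..<N}. X it})
       (Pi_pmf (participants b N \<times> {..<N}) False (\<lambda>_. bernoulli_pmf (p / real N)))"

text \<open>First the participants that make an attempt are chosen, then the slots of these attempts.\<close>

definition global_attempts :: "real \<Rightarrow> real \<Rightarrow> nat \<Rightarrow> attempts pmf" where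
  "global_attempts b p N =
     bind_pmf (Pi_pmf (participants b N) False (\<lambda>_. bernoulli_pmf p)) (\<lambda>d.
       map_pmf (\<lambda>\<sigma>. {(i, \<sigma> i) | i. i \<in> participants b N \<and> d i})
         (Pi_pmf {i \<in> participants b N. d i} 0 (\<lambda>_. pmf_of_set {..<N})))"

fun access_pmf :: "access_rule \<Rightarrow> real \<Rightarrow> real \<Rightarrow> nat \<Rightarrow> attempts pmf" where
  "access_pmf Local b p N = local_attempts b p N"
| "access_pmf Global b p N = global_attempts b p N"

definition attempts_in_slot :: "attempts \<Rightarrow> nat \<Rightarrow> nat" where
  "attempts_in_slot \<omega> t = card {i. (i, t) \<in> \<omega>}"

definition num_attempts :: "attempts \<Rightarrow> nat" where
  "num_attempts \<omega> = card \<omega>"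

definition num_successful_attempts :: "nat \<Rightarrow> attempts \<Rightarrow> nat" where
  "num_successful_attempts \<kappa> \<omega> = card {(i, t) \<in> \<omega>. attempts_in_slot \<omega> t \<le> \<kappa>}"

definition num_successful_slots :: "nat \<Rightarrow> nat \<Rightarrow> attempts \<Rightarrow> nat" where
  "num_successful_slots \<kappa> N \<omega> = card {t \<in> {..<N}. attempts_in_slot \<omega> t \<le> \<kappa>}"

definition scaled_triple :: "nat \<Rightarrow> nat \<Rightarrow> attempts \<Rightarrow> real \<times> real \<times> real" where
  "scaled_triple \<kappa> N \<omega> =
     (1 / real N) *\<^sub>R (real (num_attempts \<omega>), real (num_successful_attempts \<kappa> \<omega>),
                       real (num_successful_slots \<kappa> N \<omega>))"


section \<open>The rate functions\<close>

definition slot_statistic :: "nat \<Rightarrow> nat \<Rightarrow> real \<times> real \<times> real" where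
  "slot_statistic \<kappa> k =
     (real k, real k * indicator {..\<kappa>} k, indicator {..\<kappa>} k)"

definition rate_L :: "real \<Rightarrow> real \<Rightarrow> nat \<Rightarrow> real \<times> real \<times> real \<Rightarrow> ereal" where
  "rate_L b p \<kappa> x =
     (INF \<mu> \<in> {\<mu>. (\<lambda>k. pmf \<mu> k *\<^sub>R slot_statistic \<kappa> k) sums x}.
        rel_entropy \<mu> (poisson_pmf (b * p)))"

text \<open>The term \<open>(b - a) log ((1 - a/b) / (1 - p))\<close> for \<open>a \<le> b\<close>, with \<open>0 log 0 = 0\<close>,
  \<open>0 log (0/0) = 0\<close> and \<open>x log (y/0) = \<infinity>\<close> for \<open>x, y > 0\<close>; the last two occur for \<open>p = 1\<close>.\<close>

definition silent_cost :: "real \<Rightarrow> real \<Rightarrow> real \<Rightarrow> ereal" where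
  "silent_cost b p a =
     (if a = b then 0
      else if p = 1 then \<infinity>
      else ereal ((b - a) * ln ((1 - a / b) / (1 - p))))"

definition rate_G :: "real \<Rightarrow> real \<Rightarrow> nat \<Rightarrow> real \<times> real \<times> real \<Rightarrow> ereal" where
  "rate_G b p \<kappa> = (\<lambda>(a, s, r).
     rate_L b p \<kappa> (a, s, r) + silent_cost b p a + ereal (a - b * p))"

fun rate_IB :: "access_rule \<Rightarrow> real \<Rightarrow> real \<Rightarrow> nat \<Rightarrow> real \<times> real \<times> real \<Rightarrow> ereal" where
  "rate_IB Local b p \<kappa> = rate_L b p \<kappa>"
| "rate_IB Global b p \<kappa> = rate_G b p \<kappa>"

end

theory Submission
  imports Defs "HOL-Real_Asymp.Real_Asymp"
begin

text \<open>The number of attempts in each of the \<open>N\<close> slots determines the triple: it is \<open>N\<close> times the mean of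
  \<open>slot_statistic \<kappa>\<close> under the empirical distribution of these \<open>N\<close> numbers. The proof is therefore the method
  of types, carried out for the multiset of slot counts (the \<^emph>\<open>profile\<close> of an outcome).

  Under either access rule all possible outcomes with the same slot counts have the same probability, and
  their number is a product of binomial coefficients (L) or a multinomial coefficient (G). Hence the
  probability of a profile \<open>m\<close> is known exactly
  (\<open>pmf_profile_local\<close>, \<open>pmf_profile_global\<close>), and it is the probability of \<open>m\<close> for \<open>N\<close> independent
  Poisson slots with parameter \<open>b p\<close>, times a correction. For rule (L) the correction is bounded if
  there are at most \<open>b N\<close> attempts, and not exponentially small if moreover the slot counts are bounded.
  For rule (G) it depends only on the number of attempts \<open>a N\<close> and is \<open>exp (- N (global_cost b p a))\<close> up to
  subexponential factors; this is the exchange of a Poisson for a binomial total, and it is the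
  difference of the two rate functions. The Poisson probability of a profile is in turn \<open>exp (- N H)\<close>
  up to polynomial factors (from below, for profiles with bounded slot counts), with \<open>H\<close> the relative entropy of the empirical distribution of \<open>m\<close> with
  respect to the Poisson law (\<open>type_class_upper\<close>, \<open>type_class_lower_limit\<close>).

  For the upper bound, \<open>H\<close> is at least the rate at the triple of \<open>m\<close>, by definition of the rate as
  an infimum. So each profile with triple in \<open>F\<close> has probability at most \<open>exp (- N inf I)\<close> up to polynomial
  factors, and the events \<open>F\<close> only contain profiles of at most \<open>b N\<close> attempts. Such profiles are partitions of
  integers up to \<open>b N\<close>, so their number is subexponential (\<open>card_profiles_le\<close>) and a union bound suffices.
  Only the case \<open>p = 1\<close> of rule (G) needs more: there the number of attempts is the rounded value
  of \<open>b N\<close>, the rate is infinite off \<open>a = b\<close>, and a compactness argument moves the bound from \<open>a = b\<close> to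
  nearby \<open>a\<close>.

  For the lower bound, a near-optimal law \<open>\<mu>\<close> is first replaced by one with finite support and the
  same mean (\<open>finite_support_approximation\<close>) and then rounded to profiles with exactly \<open>\<lfloor>a N\<rfloor>\<close> attempts
  (\<open>integer_rounding\<close>); a single profile per \<open>N\<close> already has the required probability. Keeping the number of
  attempts exact is what makes the argument work on the boundary \<open>a = b\<close>, also for \<open>p = 1\<close>.

  Sublevel sets of the rate are closed because sublevel sets of the relative entropy to a law with all
  exponential moments are compact in a sense strong enough to preserve means (\<open>entropy_limit_moment\<close>).
  Nonnegativity of the rate comes for free from the lower bound, as probabilities are at most 1.\<close>

section \<open>Relative entropy as a series of nonnegative terms\<close>

text \<open>The summand of the relative entropy, corrected by \<open>y - x\<close>: the corrections sum to zero for two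
  probability laws, and they make every term nonnegative.\<close>

definition entropy_term :: "real \<Rightarrow> real \<Rightarrow> real" where
  "entropy_term x y = x * ln (x / y) - x + y"

lemma continuous_on_x_ln_x: "continuous_on {0..} (\<lambda>x::real. x * ln x)"
proof -
  have "((\<lambda>x::real. x * ln x) \<longlongrightarrow> 0) (at_right 0)"
    by real_asymp
  then have "continuous (at 0 within {0..}) (\<lambda>x::real. x * ln x)"
    by (simp add: continuous_within at_within_Ici_at_right)
  moreover have "continuous (at x within {0..}) (\<lambda>x::real. x * ln x)" if "x > 0" for x
    using that by (intro continuous_intros) auto
  ultimately show ?thesis
    unfolding continuous_on_eq_continuous_within by (metis atLeast_iff order_le_less)
qed

lemma tendsto_x_ln_x:
  fixes f :: "'a \<Rightarrow> real"
  assumes "(f \<longlongrightarrow> l) F" "\<And>x. f x \<ge> 0" "l \<ge> 0"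
  shows "((\<lambda>x. f x * ln (f x)) \<longlongrightarrow> l * ln l) F"
  using continuous_on_tendsto_compose[OF continuous_on_x_ln_x assms(1)] assms(2,3) by simp

lemma tendsto_x_ln_x_div:
  fixes f :: "'a \<Rightarrow> real"
  assumes "(f \<longlongrightarrow> l) F" "\<And>x. f x \<ge> 0" "l \<ge> 0" "y > 0"
  shows "((\<lambda>x. f x * ln (f x / y)) \<longlongrightarrow> l * ln (l / y)) F"
proof -
  have *: "z * ln (z / y) = z * ln z - z * ln y" if "z \<ge> 0" for z
    using that assms(4) by (cases "z = 0") (auto simp: ln_div algebra_simps)
  have "((\<lambda>x. f x * ln (f x) - f x * ln y) \<longlongrightarrow> l * ln l - l * ln y) F"
    by (intro tendsto_intros tendsto_x_ln_x assms(1) assms(2) assms(3))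
  then show ?thesis using assms by (simp add: *)
qed

lemma tendsto_entropy_term:
  assumes "(f \<longlongrightarrow> l) F" "\<And>x. f x \<ge> 0" "l \<ge> 0" "y > 0"
  shows "((\<lambda>x. entropy_term (f x) y) \<longlongrightarrow> entropy_term l y) F"
  unfolding entropy_term_def using assms by (intro tendsto_intros tendsto_x_ln_x_div)

text \<open>The function \<open>x \<mapsto> entropy_term x y\<close> is the convex conjugate of \<open>t \<mapsto> y (exp t - 1)\<close>. Equality holds at
  \<open>t = ln (x / y)\<close>. This inequality yields nonnegativity, convexity and the uniform tail estimate.\<close>

lemma entropy_term_Young:
  assumes "x \<ge> 0" "y > 0"
  shows "x * t \<le> entropy_term x y + y * (exp t - 1)"
proof (cases "x = 0")
  case True
  then show ?thesis using assms by (simp add: entropy_term_def algebra_simps)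
next
  case False
  then have x: "x > 0" using assms by simp
  have "1 + (t - ln (x / y)) \<le> exp (t - ln (x / y))" by (rule exp_ge_add_one_self)
  then have "x * (1 + (t - ln (x / y))) \<le> x * exp (t - ln (x / y))"
    using x by (intro mult_left_mono) auto
  also have "\<dots> = y * exp t" using x assms by (simp add: exp_diff)
  finally show ?thesis by (simp add: entropy_term_def algebra_simps)
qed

lemma entropy_term_nonneg: "x \<ge> 0 \<Longrightarrow> y > 0 \<Longrightarrow> entropy_term x y \<ge> 0"
  using entropy_term_Young[of x y 0] by simp

text \<open>As a supremum of the affine functions \<open>x \<mapsto> x t - y (exp t - 1)\<close>, the term is convex in \<open>x\<close>.\<close>

lemma entropy_term_convex:
  assumes "x \<ge> 0" "z \<ge> 0" "y > 0" "0 < t" "t < 1"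
  shows "entropy_term ((1 - t) * x + t * z) y \<le> (1 - t) * entropy_term x y + t * entropy_term z y"
proof (cases "(1 - t) * x + t * z = 0")
  case True
  then have "x = 0" "z = 0"
    using assms by (auto simp: add_nonneg_eq_0_iff)
  then show ?thesis by (simp add: algebra_simps entropy_term_def)
next
  case False
  define w where "w = (1 - t) * x + t * z"
  have w: "w > 0" using False assms unfolding w_def by (simp add: less_le)
  define u where "u = ln (w / y)"
  have "entropy_term w y = w * u - y * (exp u - 1)"
    using w assms by (simp add: u_def entropy_term_def algebra_simps)
  also have "\<dots> = (1 - t) * (x * u - y * (exp u - 1)) + t * (z * u - y * (exp u - 1))"
    by (simp add: w_def algebra_simps)
  also have "\<dots> \<le> (1 - t) * entropy_term x y + t * entropy_term z y"
    using assms entropy_term_Young[of x y u] entropy_term_Young[of z y u]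
    by (intro add_mono mult_left_mono) (auto simp: algebra_simps)
  finally show ?thesis by (simp add: w_def)
qed

lemma pmf_sums_1: "pmf (\<mu> :: nat pmf) sums 1"
proof -
  have "integrable (count_space UNIV) (pmf \<mu>)"
    by (simp add: integrable_pmf)
  from sums_integral_count_space_nat[OF this] show ?thesis
    by (simp add: integral_pmf)
qed

text \<open>The defining series has terms of both signs; its partial sums differ from those of the nonnegative
  terms by partial sums of \<open>\<mu> - \<nu>\<close>, which vanish in the limit.\<close>

lemma rel_entropy_eq_suminf:
  assumes pos: "\<And>k. pmf \<nu> k > 0"
  shows "rel_entropy \<mu> \<nu> = (\<Sum>k. ereal (entropy_term (pmf \<mu> k) (pmf \<nu> k)))"
proof -
  let ?h = "\<lambda>k. entropy_term (pmf \<mu> k) (pmf \<nu> k)"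
  have nn: "?h k \<ge> 0" for k using pos by (simp add: entropy_term_nonneg)
  have "(\<lambda>k. ereal (?h k)) sums (\<Sum>k. ereal (?h k))"
    using nn by (intro summable_sums summable_ereal_pos) auto
  then have 1: "(\<lambda>n. \<Sum>k<n. ereal (?h k)) \<longlonglongrightarrow> (\<Sum>k. ereal (?h k))"
    by (simp add: sums_def)
  have "(\<lambda>k. pmf \<mu> k - pmf \<nu> k) sums (1 - 1)"
    by (intro sums_diff pmf_sums_1)
  then have 2: "(\<lambda>n. ereal (\<Sum>k<n. pmf \<mu> k - pmf \<nu> k)) \<longlonglongrightarrow> ereal 0"
    by (simp add: sums_def)
  have "(\<lambda>n. (\<Sum>k<n. ereal (?h k)) + ereal (\<Sum>k<n. pmf \<mu> k - pmf \<nu> k))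
      \<longlonglongrightarrow> (\<Sum>k. ereal (?h k)) + ereal 0"
    using 1 2 by (intro tendsto_add_ereal_general) auto
  also have "(\<lambda>n. (\<Sum>k<n. ereal (?h k)) + ereal (\<Sum>k<n. pmf \<mu> k - pmf \<nu> k)) =
      (\<lambda>n. \<Sum>k<n. if pmf \<mu> k = 0 then 0
          else if pmf \<nu> k = 0 then \<infinity>
          else ereal (pmf \<mu> k * ln (pmf \<mu> k / pmf \<nu> k)))" (is "?A = ?B")
  proof
    fix n
    have "?B n = (\<Sum>k<n. ereal (pmf \<mu> k * ln (pmf \<mu> k / pmf \<nu> k)))"
      using pos by (intro sum.cong refl) (auto simp: less_imp_neq[THEN not_sym])
    also have "\<dots> = ereal (\<Sum>k<n. ?h k + (pmf \<mu> k - pmf \<nu> k))"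
      by (simp add: entropy_term_def)
    also have "\<dots> = ?A n" by (simp add: sum.distrib)
    finally show "?A n = ?B n" by simp
  qed
  finally show ?thesis
    unfolding rel_entropy_def by (intro sums_unique[symmetric]) (simp add: sums_def)
qed

lemma rel_entropy_le_iff:
  assumes pos: "\<And>k. pmf \<nu> k > 0"
  shows "rel_entropy \<mu> \<nu> \<le> ereal c \<longleftrightarrow>
    (\<forall>n. (\<Sum>k<n. entropy_term (pmf \<mu> k) (pmf \<nu> k)) \<le> c)"
  unfolding rel_entropy_eq_suminf[OF pos]
  by (subst suminf_ereal_eq_SUP) (auto simp: SUP_le_iff entropy_term_nonneg pos)

lemma rel_entropy_less_ereal:
  assumes pos: "\<And>k. pmf \<nu> k > 0" and "rel_entropy \<mu> \<nu> < ereal c"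
  shows "summable (\<lambda>k. entropy_term (pmf \<mu> k) (pmf \<nu> k))"
    and "(\<Sum>k. entropy_term (pmf \<mu> k) (pmf \<nu> k)) < c"
proof -
  let ?h = "\<lambda>k. entropy_term (pmf \<mu> k) (pmf \<nu> k)"
  have nn: "?h k \<ge> 0" for k using pos by (simp add: entropy_term_nonneg)
  obtain c' where c': "rel_entropy \<mu> \<nu> \<le> ereal c'" "c' < c"
    using assms(2) by (metis ereal_dense2 ereal_less(2) less_ereal.simps(1) less_imp_le)
  have le: "(\<Sum>k<n. ?h k) \<le> c'" for n
    using rel_entropy_le_iff[OF pos] c'(1) by blast
  show s: "summable ?h"
    using nn le by (intro bounded_imp_summable[of _ c']) (auto simp: lessThan_Suc_atMost[symmetric] simp del: sum.lessThan_Suc)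
  have "(\<Sum>k. ?h k) \<le> c'" by (rule suminf_le_const[OF s le])
  with c' show "(\<Sum>k. ?h k) < c" by simp
qed

section \<open>Limits of laws with bounded relative entropy\<close>

text \<open>Laws of bounded entropy have uniformly small first-moment tails: by Young's inequality with \<open>t = l k\<close>,
  \<open>l\<close> times the tail is at most the entropy plus an exponential tail of \<open>\<nu>\<close>. A large \<open>l\<close> beats the entropy
  bound, and then the exponential tail is small far out.\<close>

lemma entropy_uniform_tail:
  assumes pos: "\<And>k. pmf \<nu> k > 0"
    and mom: "\<And>l::real. summable (\<lambda>k. pmf \<nu> k * exp (l * real k))"
    and \<epsilon>: "\<epsilon> > 0"
  obtains K where "\<And>\<mu> m n. m \<ge> K \<Longrightarrow> rel_entropy \<mu> \<nu> \<le> ereal c \<Longrightarrow>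
      (\<Sum>k\<in>{m..<n}. real k * pmf \<mu> k) \<le> \<epsilon>"
proof -
  \<comment> \<open>\<open>c\<close> from the entropy and 1 from the exponential tail of \<open>\<nu>\<close> together amount to at most \<open>l \<epsilon>\<close>\<close>
  define l where "l = (\<bar>c\<bar> + 1) / \<epsilon>"
  have l: "l > 0" using \<epsilon> by (simp add: l_def add_nonneg_pos)
  obtain K where K: "\<And>m n. m \<ge> K \<Longrightarrow> norm (\<Sum>k\<in>{m..<n}. pmf \<nu> k * exp (l * real k)) < 1"
    using mom[of l] unfolding summable_Cauchy by (meson zero_less_one)
  show ?thesis
  proof (rule that[of K])
    fix \<mu> :: "nat pmf" and m n assume m: "m \<ge> K" and H: "rel_entropy \<mu> \<nu> \<le> ereal c"
    have "l * (\<Sum>k\<in>{m..<n}. real k * pmf \<mu> k) = (\<Sum>k\<in>{m..<n}. pmf \<mu> k * (l * real k))"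
      by (simp add: sum_distrib_left mult_ac)
    also have "\<dots> \<le> (\<Sum>k\<in>{m..<n}. entropy_term (pmf \<mu> k) (pmf \<nu> k) + pmf \<nu> k * exp (l * real k))"
    proof (rule sum_mono)
      fix k
      show "pmf \<mu> k * (l * real k) \<le> entropy_term (pmf \<mu> k) (pmf \<nu> k) + pmf \<nu> k * exp (l * real k)"
        using entropy_term_Young[of "pmf \<mu> k" "pmf \<nu> k" "l * real k"] pos[of k]
        by (simp add: algebra_simps)
    qed
    also have "\<dots> = (\<Sum>k\<in>{m..<n}. entropy_term (pmf \<mu> k) (pmf \<nu> k)) + (\<Sum>k\<in>{m..<n}. pmf \<nu> k * exp (l * real k))"
      by (simp add: sum.distrib)
    also have "(\<Sum>k\<in>{m..<n}. entropy_term (pmf \<mu> k) (pmf \<nu> k)) \<le> (\<Sum>k<n. entropy_term (pmf \<mu> k) (pmf \<nu> k))"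
      by (rule sum_mono2) (auto simp: entropy_term_nonneg pos)
    also have "\<dots> \<le> c" using rel_entropy_le_iff[OF pos] H by blast
    also have "(\<Sum>k\<in>{m..<n}. pmf \<nu> k * exp (l * real k)) \<le> 1"
      using K[OF m, of n] by simp
    finally have "l * (\<Sum>k\<in>{m..<n}. real k * pmf \<mu> k) \<le> c + 1" by simp
    also have "\<dots> \<le> l * \<epsilon>" using \<epsilon> by (simp add: l_def)
    finally show "(\<Sum>k\<in>{m..<n}. real k * pmf \<mu> k) \<le> \<epsilon>"
      using l by (simp add: mult_le_cancel_left_pos)
  qed
qed

text \<open>The cube \<open>[0, 1]\<close> to the power \<open>\<nat>\<close> is compact by Tychonoff, and metrizable.\<close>

lemma pointwise_convergent_subseq:
  fixes u :: "nat \<Rightarrow> nat \<Rightarrow> real"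
  assumes "\<And>n k. u n k \<in> {0..1}"
  obtains r v where "strict_mono r" "\<And>k. (\<lambda>n. u (r n) k) \<longlonglongrightarrow> v k"
proof -
  have "compactin (product_topology (\<lambda>_. euclidean) (UNIV :: nat set)) (PiE UNIV (\<lambda>_. {0..1::real}))"
    by (simp add: compactin_PiE)
  then have "compact (PiE (UNIV :: nat set) (\<lambda>_. {0..1::real}))"
    by (simp add: euclidean_product_topology)
  then have "seq_compact (PiE (UNIV :: nat set) (\<lambda>_. {0..1::real}))"
    by (rule compact_imp_seq_compact)
  moreover have "\<forall>n. u n \<in> PiE UNIV (\<lambda>_. {0..1::real})" using assms by auto
  ultimately obtain v r where r: "strict_mono r" "(u \<circ> r) \<longlonglongrightarrow> v"
    unfolding seq_compact_def by metis
  have "(\<lambda>n. u (r n) k) \<longlonglongrightarrow> v k" for k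
  proof -
    have "continuous_on UNIV (\<lambda>x::nat \<Rightarrow> real. x k)"
      by (rule continuous_on_product_then_coordinatewise[OF continuous_on_id, simplified])
    from continuous_on_tendsto_compose[OF this r(2)] show ?thesis by (simp add: comp_def)
  qed
  with r(1) show ?thesis by (rule that)
qed

text \<open>Under an entropy bound, pointwise convergence of laws carries over to the means of statistics of at most
  linear growth, since the tails of all these means are uniformly small. Without the bound mass or
  mean could escape to infinity.\<close>

lemma entropy_limit_moment:
  fixes g :: "nat \<Rightarrow> 'a::real_normed_vector"
  assumes pos: "\<And>k. pmf \<nu> k > 0"
    and mom: "\<And>l::real. summable (\<lambda>k. pmf \<nu> k * exp (l * real k))"
    and H: "\<And>n. rel_entropy (\<mu> n) \<nu> \<le> ereal c"
    and v: "\<And>k. (\<lambda>n. pmf (\<mu> n) k) \<longlonglongrightarrow> v k"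
    and g: "\<And>k. k \<ge> 1 \<Longrightarrow> norm (g k) \<le> C * real k"
    and x: "\<And>n. (\<lambda>k. pmf (\<mu> n) k *\<^sub>R g k) sums x n" "x \<longlonglongrightarrow> y"
  shows "(\<lambda>k. v k *\<^sub>R g k) sums y"
  unfolding sums_def
proof (rule LIMSEQ_I)
  fix r :: real assume r: "r > 0"
  have C: "C \<ge> 0" using g[of 1] norm_ge_zero[of "g 1"] by (simp del: norm_ge_zero)
  define \<epsilon> where "\<epsilon> = r / (2 * (C + 1))"
  have \<epsilon>: "\<epsilon> > 0" using r C by (simp add: \<epsilon>_def)
  obtain K where K: "\<And>\<mu> m n. m \<ge> K \<Longrightarrow> rel_entropy \<mu> \<nu> \<le> ereal c \<Longrightarrow>
      (\<Sum>k\<in>{m..<n}. real k * pmf \<mu> k) \<le> \<epsilon>"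
    using entropy_uniform_tail[OF pos mom \<epsilon>] by metis
  show "\<exists>no. \<forall>J\<ge>no. norm ((\<Sum>k<J. v k *\<^sub>R g k) - y) < r"
  proof (intro exI allI impI)
    fix J assume J: "J \<ge> max K 1"
    have "norm ((\<Sum>k<J. pmf (\<mu> n) k *\<^sub>R g k) - x n) \<le> C * \<epsilon>" for n
    proof (rule LIMSEQ_le_const2)
      have "(\<lambda>m. \<Sum>k<m. pmf (\<mu> n) k *\<^sub>R g k) \<longlonglongrightarrow> x n"
        using x(1)[of n] by (simp add: sums_def)
      then show "(\<lambda>m. norm ((\<Sum>k<J. pmf (\<mu> n) k *\<^sub>R g k) - (\<Sum>k<m. pmf (\<mu> n) k *\<^sub>R g k)))
        \<longlonglongrightarrow> norm ((\<Sum>k<J. pmf (\<mu> n) k *\<^sub>R g k) - x n)"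
        by (intro tendsto_intros)
      show "\<exists>N. \<forall>m\<ge>N. norm ((\<Sum>k<J. pmf (\<mu> n) k *\<^sub>R g k) - (\<Sum>k<m. pmf (\<mu> n) k *\<^sub>R g k)) \<le> C * \<epsilon>"
      proof (intro exI allI impI)
        fix m assume m: "m \<ge> J"
        have "norm ((\<Sum>k<J. pmf (\<mu> n) k *\<^sub>R g k) - (\<Sum>k<m. pmf (\<mu> n) k *\<^sub>R g k))
            = norm (\<Sum>k\<in>{J..<m}. pmf (\<mu> n) k *\<^sub>R g k)"
          using sum_diff_nat_ivl[of 0 J m "\<lambda>k. pmf (\<mu> n) k *\<^sub>R g k"] m
          by (subst norm_minus_commute) (simp add: atLeast0LessThan)
        also have "\<dots> \<le> (\<Sum>k\<in>{J..<m}. pmf (\<mu> n) k * (C * real k))"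
          using J g by (intro sum_norm_le) (auto intro!: mult_left_mono)
        also have "\<dots> = C * (\<Sum>k\<in>{J..<m}. real k * pmf (\<mu> n) k)"
          by (simp add: sum_distrib_left mult_ac)
        also have "\<dots> \<le> C * \<epsilon>"
          using K[OF _ H, of J] J C by (intro mult_left_mono) auto
        finally show "norm ((\<Sum>k<J. pmf (\<mu> n) k *\<^sub>R g k) - (\<Sum>k<m. pmf (\<mu> n) k *\<^sub>R g k)) \<le> C * \<epsilon>" .
      qed
    qed
    moreover have "(\<lambda>n. norm ((\<Sum>k<J. pmf (\<mu> n) k *\<^sub>R g k) - x n)) \<longlonglongrightarrow> norm ((\<Sum>k<J. v k *\<^sub>R g k) - y)"
      by (intro tendsto_intros v x)
    ultimately have "norm ((\<Sum>k<J. v k *\<^sub>R g k) - y) \<le> C * \<epsilon>"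
      by (intro LIMSEQ_le_const2) auto
    also have "C * \<epsilon> < (C + 1) * \<epsilon>" using \<epsilon> by simp
    also have "\<dots> < r" using r C by (simp add: \<epsilon>_def divide_simps)
    finally show "norm ((\<Sum>k<J. v k *\<^sub>R g k) - y) < r" .
  qed
qed

lemma norm_slot_statistic_le: "k \<ge> 1 \<Longrightarrow> norm (slot_statistic \<kappa> k) \<le> 3 * real k"
proof -
  assume k: "k \<ge> 1"
  have "norm (slot_statistic \<kappa> k) \<le> norm (real k) + norm (real k * indicator {..\<kappa>} k, indicator {..\<kappa>} k :: real)"
    unfolding slot_statistic_def by (rule norm_Pair_le)
  also have "norm (real k * indicator {..\<kappa>} k, indicator {..\<kappa>} k :: real) \<le>
      norm (real k * indicator {..\<kappa>} k) + norm (indicator {..\<kappa>} k :: real)"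
    by (rule norm_Pair_le)
  also have "norm (real k * indicator {..\<kappa>} k) \<le> real k" by (simp add: indicator_def)
  also have "norm (indicator {..\<kappa>} k :: real) \<le> real k" using k by (simp add: indicator_def)
  finally show ?thesis by simp
qed

lemma summable_poisson_exp:
  assumes "\<beta> > 0"
  shows "summable (\<lambda>k. pmf (poisson_pmf \<beta>) k * exp (l * real k))"
proof -
  have "summable (\<lambda>k. exp (-\<beta>) * (inverse (fact k) * (\<beta> * exp l) ^ k))"
    by (intro summable_mult summable_exp)
  also have "(\<lambda>k. exp (-\<beta>) * (inverse (fact k) * (\<beta> * exp l) ^ k)) =
      (\<lambda>k. pmf (poisson_pmf \<beta>) k * exp (l * real k))"
    using assms by (auto simp: fun_eq_iff field_simps power_mult_distrib exp_of_nat_mult[symmetric])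
  finally show ?thesis .
qed

text \<open>Near-minimizers at a convergent sequence of points have a pointwise convergent subsequence. The limit
  is again a probability law with the right means, and its entropy is controlled by Fatou's lemma.\<close>

lemma rate_L_sublevel_closed:
  assumes bp: "b * p > 0"
  shows "closed {x. rate_L b p \<kappa> x \<le> ereal c}"
  unfolding closed_sequential_limits
proof (intro allI impI, elim conjE)
  define \<nu> where "\<nu> = poisson_pmf (b * p)"
  have pos: "pmf \<nu> k > 0" for k using bp by (simp add: \<nu>_def)
  have mom: "summable (\<lambda>k. pmf \<nu> k * exp (l * real k))" for l :: real
    unfolding \<nu>_def by (rule summable_poisson_exp[OF bp])
  fix x and y :: "real \<times> real \<times> real"
  assume "\<forall>n. x n \<in> {x. rate_L b p \<kappa> x \<le> ereal c}" and lim: "x \<longlonglongrightarrow> y"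
  then have xn: "rate_L b p \<kappa> (x n) < ereal (c + 1 / real (Suc n))" for n
    by (simp add: le_less_trans[of _ "ereal c"])
  have "\<exists>\<mu>. (\<lambda>k. pmf \<mu> k *\<^sub>R slot_statistic \<kappa> k) sums x n \<and>
      rel_entropy \<mu> \<nu> < ereal (c + 1 / real (Suc n))" for n
    using xn[of n] unfolding rate_L_def INF_less_iff \<nu>_def by blast
  then obtain \<mu> where \<mu>: "\<And>n. (\<lambda>k. pmf (\<mu> n) k *\<^sub>R slot_statistic \<kappa> k) sums x n"
    "\<And>n. rel_entropy (\<mu> n) \<nu> < ereal (c + 1 / real (Suc n))" by metis
  obtain r v where r: "strict_mono r" and v: "\<And>k. (\<lambda>n. pmf (\<mu> (r n)) k) \<longlonglongrightarrow> v k"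
    using pointwise_convergent_subseq[of "\<lambda>n. pmf (\<mu> n)"] by (auto simp: pmf_le_1)
  have H: "rel_entropy (\<mu> (r n)) \<nu> \<le> ereal (c + 1)" for n
  proof -
    have "c + 1 / real (Suc (r n)) \<le> c + 1" by simp
    with \<mu>(2)[of "r n"] show ?thesis
      by (metis ereal_less_eq(3) less_imp_le order_trans)
  qed
  have mean: "(\<lambda>k. v k *\<^sub>R slot_statistic \<kappa> k) sums y"
    using \<mu>(1) LIMSEQ_subseq_LIMSEQ[OF lim r]
    by (intro entropy_limit_moment[OF pos mom H v, where C = 3 and x = "\<lambda>n. x (r n)"])
      (auto simp: comp_def norm_slot_statistic_le)
  have mass: "(\<lambda>k. v k *\<^sub>R (1::real)) sums 1"
    by (rule entropy_limit_moment[OF pos mom H v, where C = 1 and x = "\<lambda>_. 1"])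
      (auto simp: pmf_sums_1)
  have v0: "v k \<ge> 0" for k
    using v[of k] by (rule LIMSEQ_le_const) auto
  define \<mu>' where "\<mu>' = embed_pmf v"
  have \<mu>': "pmf \<mu>' k = v k" for k
    unfolding \<mu>'_def
  proof (rule pmf_embed_pmf)
    show "(\<integral>\<^sup>+ x. ennreal (v x) \<partial>count_space UNIV) = 1"
      using suminf_ennreal_eq[OF v0 mass[simplified]] by (simp add: nn_integral_count_space_nat)
  qed (rule v0)
  have "rel_entropy \<mu>' \<nu> \<le> ereal c"
    unfolding rel_entropy_le_iff[OF pos] \<mu>'
  proof
    fix m
    have 1: "(\<lambda>n. \<Sum>k<m. entropy_term (pmf (\<mu> (r n)) k) (pmf \<nu> k)) \<longlonglongrightarrow> (\<Sum>k<m. entropy_term (v k) (pmf \<nu> k))"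
      by (intro tendsto_sum tendsto_entropy_term v v0 pos) auto
    have 2: "(\<lambda>n. c + 1 / real (Suc (r n))) \<longlonglongrightarrow> c + 0"
      using LIMSEQ_subseq_LIMSEQ[OF LIMSEQ_inverse_real_of_nat r]
      by (intro tendsto_intros) (simp add: comp_def inverse_eq_divide)
    have "(\<Sum>k<m. entropy_term (pmf (\<mu> (r n)) k) (pmf \<nu> k)) \<le> c + 1 / real (Suc (r n))" for n
      using \<mu>(2)[of "r n"] rel_entropy_le_iff[OF pos] by (meson less_imp_le)
    with LIMSEQ_le[OF 1 2] show "(\<Sum>k<m. entropy_term (v k) (pmf \<nu> k)) \<le> c" by auto
  qed
  moreover have "(\<lambda>k. pmf \<mu>' k *\<^sub>R slot_statistic \<kappa> k) sums y" using mean \<mu>' by simp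
  ultimately have "rate_L b p \<kappa> y \<le> ereal c"
    unfolding rate_L_def \<nu>_def by (meson INF_lower2 mem_Collect_eq)
  then show "y \<in> {x. rate_L b p \<kappa> x \<le> ereal c}" by simp
qed

section \<open>Near-optimal laws with finite support\<close>

text \<open>The truncation in \<open>finite_support_approximation\<close> draws on mass at 0. A small admixture of a law on
  \<open>{0, m}\<close> with the same mean supplies it; by convexity it changes the entropy only slightly.\<close>

lemma entropy_perturb_zero_mass:
  assumes pos: "\<And>k. pmf \<nu> k > 0"
    and x: "(\<lambda>k. pmf \<mu> k *\<^sub>R slot_statistic \<kappa> k) sums x"
    and H: "rel_entropy \<mu> \<nu> < ereal c" and \<epsilon>: "\<epsilon> > 0"
  shows "\<exists>u x'. (\<forall>k. u k \<ge> 0) \<and> u 0 > 0 \<and> u sums 1 \<and> (\<lambda>k. u k * real k) sums fst x \<and>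
    (\<lambda>k. u k *\<^sub>R slot_statistic \<kappa> k) sums x' \<and> dist x' x < \<epsilon> \<and>
    summable (\<lambda>k. entropy_term (u k) (pmf \<nu> k)) \<and> (\<Sum>k. entropy_term (u k) (pmf \<nu> k)) < c"
proof -
  define a where "a = fst x"
  have mean: "(\<lambda>k. pmf \<mu> k * real k) sums a"
    using bounded_linear.sums[OF bounded_linear_fst x] by (simp add: a_def slot_statistic_def)
  have a: "a \<ge> 0" by (rule sums_le[OF _ sums_zero mean]) simp
  define m where "m = nat \<lfloor>a\<rfloor> + 1"
  have m: "a < real m" "m > 0" using a unfolding m_def by linarith+
  \<comment> \<open>a law on two points with mean \<open>a\<close> that charges 0, since \<open>m > a\<close>\<close>
  define w where "w = (\<lambda>k::nat. if k = 0 then 1 - a / m else if k = m then a / m else 0)"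
  have w: "w k \<ge> 0" for k using a m by (auto simp: w_def field_simps)
  have w0: "w 0 > 0" using m by (simp add: w_def)
  have w_fin: "(\<lambda>k. w k *\<^sub>R g k) sums (\<Sum>k\<in>{0,m}. w k *\<^sub>R g k)" for g :: "nat \<Rightarrow> 'b::real_normed_vector"
    by (rule sums_finite) (auto simp: w_def)
  have w1: "w sums 1" using w_fin[of "\<lambda>_. 1::real"] m by (simp add: w_def)
  have wa: "(\<lambda>k. w k * real k) sums a" using w_fin[of "real"] m by (simp add: w_def)
  define z where "z = (\<Sum>k\<in>{0,m}. w k *\<^sub>R slot_statistic \<kappa> k)"
  have wz: "(\<lambda>k. w k *\<^sub>R slot_statistic \<kappa> k) sums z" unfolding z_def by (rule w_fin)
  define h where "h = (\<lambda>k. entropy_term (pmf \<mu> k) (pmf \<nu> k))"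
  define h' where "h' = (\<lambda>k. entropy_term (w k) (pmf \<nu> k))"
  have h: "summable h" "suminf h < c" 
    using rel_entropy_less_ereal[OF pos H] by (simp_all add: h_def)
  have h': "summable h'"
  proof -
    have "eventually (\<lambda>k. h' k = pmf \<nu> k) sequentially"
      using eventually_gt_at_top[of m] by eventually_elim (simp add: h'_def w_def entropy_term_def)
    from summable_cong[OF this] show ?thesis using pmf_sums_1[of \<nu>] by (simp add: sums_iff)
  qed
  have "((\<lambda>t. (1 - t) * suminf h + t * suminf h') \<longlongrightarrow> (1 - 0) * suminf h + 0 * suminf h') (at_right 0)"
    by (intro tendsto_intros)
  then have "((\<lambda>t. (1 - t) * suminf h + t * suminf h') \<longlongrightarrow> suminf h) (at_right 0)" by simp
  from order_tendstoD(2)[OF this h(2)]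
  have 1: "eventually (\<lambda>t. (1 - t) * suminf h + t * suminf h' < c) (at_right 0)" .
  have "((\<lambda>t. t * norm (z - x)) \<longlongrightarrow> 0 * norm (z - x)) (at_right 0)" by (intro tendsto_intros)
  then have "((\<lambda>t. t * norm (z - x)) \<longlongrightarrow> 0) (at_right 0)" by simp
  from order_tendstoD(2)[OF this \<epsilon>]
  have 2: "eventually (\<lambda>t. t * norm (z - x) < \<epsilon>) (at_right 0)" .
  have 3: "eventually (\<lambda>t::real. t \<in> {0<..<1}) (at_right 0)"
    by (rule eventually_at_right_real) simp
  from eventually_happens'[OF _ eventually_conj[OF 1 eventually_conj[OF 2 3]]]
  obtain t where t: "(1 - t) * suminf h + t * suminf h' < c" "t * norm (z - x) < \<epsilon>" "0 < t" "t < 1"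
    by (auto simp: trivial_limit_at_right_real)
  define u where "u k = (1 - t) * pmf \<mu> k + t * w k" for k
  have u: "u k \<ge> 0" for k using w t by (simp add: u_def)
  have le: "entropy_term (u k) (pmf \<nu> k) \<le> (1 - t) * h k + t * h' k" for k
    unfolding u_def h_def h'_def using t w pos by (intro entropy_term_convex) auto
  have s: "summable (\<lambda>k. (1 - t) * h k + t * h' k)"
    using h h' by (intro summable_add summable_mult)
  have s': "summable (\<lambda>k. entropy_term (u k) (pmf \<nu> k))"
    using le entropy_term_nonneg[OF u pos] by (intro summable_comparison_test'[OF s, of 0]) auto
  show ?thesis
  proof (intro exI conjI allI)
    show "u k \<ge> 0" for k by (rule u)
    show "summable (\<lambda>k. entropy_term (u k) (pmf \<nu> k))" by (rule s')
    show "u 0 > 0" using w0 t by (simp add: u_def add_nonneg_pos)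
    have "(\<lambda>k. (1 - t) * pmf \<mu> k + t * w k) sums ((1 - t) * 1 + t * 1)"
      by (intro sums_add sums_mult pmf_sums_1 w1)
    then show "u sums 1" by (simp add: u_def[abs_def])
    have "(\<lambda>k. (1 - t) * (pmf \<mu> k * real k) + t * (w k * real k)) sums ((1 - t) * a + t * a)"
      by (intro sums_add sums_mult mean wa)
    then show "(\<lambda>k. u k * real k) sums fst x" by (simp add: u_def a_def algebra_simps)
    have "(\<lambda>k. (1 - t) *\<^sub>R (pmf \<mu> k *\<^sub>R slot_statistic \<kappa> k) + t *\<^sub>R (w k *\<^sub>R slot_statistic \<kappa> k))
      sums ((1 - t) *\<^sub>R x + t *\<^sub>R z)"
      by (intro sums_add sums_scaleR_right x wz)
    then show "(\<lambda>k. u k *\<^sub>R slot_statistic \<kappa> k) sums (x + t *\<^sub>R (z - x))"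
      by (simp add: u_def algebra_simps)
    show "dist (x + t *\<^sub>R (z - x)) x < \<epsilon>" using t by (simp add: dist_norm)
    have "(\<Sum>k. entropy_term (u k) (pmf \<nu> k)) \<le> (\<Sum>k. (1 - t) * h k + t * h' k)"
      by (rule suminf_le[OF le s' s])
    also have "\<dots> = (1 - t) * suminf h + t * suminf h'"
      using h h' by (simp add: suminf_add[symmetric] suminf_mult[symmetric] summable_mult)
    finally show "(\<Sum>k. entropy_term (u k) (pmf \<nu> k)) < c" using t by simp
  qed
qed

lemma sum_atMost_split_two:
  fixes h :: "nat \<Rightarrow> 'a::comm_monoid_add"
  assumes "K \<ge> 1"
  shows "sum h {..K} = h 0 + h 1 + sum h {2..K}"
proof -
  have "{..K} = {0, 1} \<union> {2..K}" using assms by force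
  then have "sum h {..K} = sum h {0, 1} + sum h {2..K}"
    by (simp only:) (subst sum.union_disjoint, auto)
  then show ?thesis by simp
qed

lemma sum_change_two:
  fixes f g :: "nat \<Rightarrow> 'a::ab_group_add"
  assumes "K \<ge> 1" "\<And>k. 2 \<le> k \<Longrightarrow> k \<le> K \<Longrightarrow> f k = g k"
  shows "(\<Sum>k\<le>K. f k) = (\<Sum>k\<le>K. g k) + (f 0 - g 0) + (f 1 - g 1)"
proof -
  have "sum f {2..K} = sum g {2..K}" using assms(2) by (intro sum.cong) auto
  then show ?thesis by (simp add: sum_atMost_split_two[OF assms(1)])
qed

text \<open>Truncation at \<open>K\<close> without a change of mean: if the removed tail has mass \<open>\<sigma>\<close> and first moment \<open>\<tau>\<close>, then
  mass \<open>\<tau>\<close> is added at 1, and the total mass is restored at 0, where \<open>\<tau> - \<sigma>\<close> must be taken away. This is possible for large \<open>K\<close>,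
  because the mass at 0 is positive while \<open>\<sigma>\<close> and \<open>\<tau>\<close> tend to 0. The exact mean matters for points on the
  boundary \<open>a = b\<close>.\<close>

lemma finite_support_approximation:
  assumes pos: "\<And>k. pmf \<nu> k > 0"
    and x: "(\<lambda>k. pmf \<mu> k *\<^sub>R slot_statistic \<kappa> k) sums x"
    and H: "rel_entropy \<mu> \<nu> < ereal c" and \<epsilon>: "\<epsilon> > 0"
  shows "\<exists>K v. K \<ge> 1 \<and> (\<forall>k. v k \<ge> 0) \<and> v 0 > 0 \<and> (\<Sum>k\<le>K. v k) = 1 \<and>
    (\<Sum>k\<le>K. v k * real k) = fst x \<and> dist (\<Sum>k\<le>K. v k *\<^sub>R slot_statistic \<kappa> k) x < \<epsilon> \<and>
    (\<Sum>k\<le>K. v k * ln (v k / pmf \<nu> k)) < c"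
proof -
  let ?f = "slot_statistic \<kappa>"
  define a where "a = fst x"
  obtain u x' where u: "\<And>k. u k \<ge> 0" "u 0 > 0" "u sums 1" "(\<lambda>k. u k * real k) sums a"
    "(\<lambda>k. u k *\<^sub>R ?f k) sums x'" "dist x' x < \<epsilon>"
    "summable (\<lambda>k. entropy_term (u k) (pmf \<nu> k))" "(\<Sum>k. entropy_term (u k) (pmf \<nu> k)) < c"
    using entropy_perturb_zero_mass[OF pos x H \<epsilon>, folded a_def] by blast
  define \<sigma> where "\<sigma> K = 1 - (\<Sum>k\<le>K. u k)" for K
  define \<tau> where "\<tau> K = a - (\<Sum>k\<le>K. u k * real k)" for K
  have \<sigma>: "\<sigma> \<longlonglongrightarrow> 0"
    using tendsto_diff[OF tendsto_const[of 1] u(3)[unfolded sums_def_le]] by (simp add: \<sigma>_def[abs_def])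
  have \<tau>: "\<tau> \<longlonglongrightarrow> 0"
    using tendsto_diff[OF tendsto_const[of a] u(4)[unfolded sums_def_le]] by (simp add: \<tau>_def[abs_def])
  have \<tau>0: "\<tau> K \<ge> 0" for K
    using sum_le_suminf[of "\<lambda>k. u k * real k" "{..K}"] u by (simp add: \<tau>_def sums_iff)
  define v where "v K k = (if k = 0 then u 0 - \<tau> K + \<sigma> K else if k = 1 then u 1 + \<tau> K
    else if k \<le> K then u k else 0)" for K k
  have v0: "(\<lambda>K. v K 0) \<longlonglongrightarrow> u 0"
    using tendsto_add[OF tendsto_diff[OF tendsto_const[of "u 0"] \<tau>] \<sigma>] by (simp add: v_def)
  have v1: "(\<lambda>K. v K 1) \<longlonglongrightarrow> u 1"
    using tendsto_add[OF tendsto_const[of "u 1"] \<tau>] by (simp add: v_def)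
  define q where "q k = u k * ln (u k / pmf \<nu> k)" for k
  have "(\<lambda>k. entropy_term (u k) (pmf \<nu> k) + u k - pmf \<nu> k) sums
    ((\<Sum>k. entropy_term (u k) (pmf \<nu> k)) + 1 - 1)"
    using u by (intro sums_add sums_diff pmf_sums_1) (auto intro: summable_sums)
  then have q: "q sums (\<Sum>k. entropy_term (u k) (pmf \<nu> k))"
    by (simp add: q_def[abs_def] entropy_term_def)

  have q0: "(\<lambda>K. v K 0 * ln (v K 0 / pmf \<nu> 0)) \<longlonglongrightarrow> u 0 * ln (u 0 / pmf \<nu> 0)"
    using u(2) pos[of 0] by (intro tendsto_intros v0) auto
  have q1: "(\<lambda>K. v K 1 * ln (v K 1 / pmf \<nu> 1)) \<longlonglongrightarrow> u 1 * ln (u 1 / pmf \<nu> 1)"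
    using u(1) pos \<tau>0 by (intro tendsto_x_ln_x_div v1) (auto simp: v_def)
  have "(\<lambda>K. (\<Sum>k\<le>K. q k) + (v K 0 * ln (v K 0 / pmf \<nu> 0) - q 0) + (v K 1 * ln (v K 1 / pmf \<nu> 1) - q 1))
    \<longlonglongrightarrow> (\<Sum>k. entropy_term (u k) (pmf \<nu> k)) + (u 0 * ln (u 0 / pmf \<nu> 0) - q 0) + (u 1 * ln (u 1 / pmf \<nu> 1) - q 1)"
    by (intro tendsto_add tendsto_diff tendsto_const q0 q1 q[unfolded sums_def_le])
  then have "(\<lambda>K. (\<Sum>k\<le>K. q k) + (v K 0 * ln (v K 0 / pmf \<nu> 0) - q 0) + (v K 1 * ln (v K 1 / pmf \<nu> 1) - q 1))
    \<longlonglongrightarrow> (\<Sum>k. entropy_term (u k) (pmf \<nu> k))" by (simp add: q_def)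
  from order_tendstoD(2)[OF this u(8)]
  have e1: "eventually (\<lambda>K. (\<Sum>k\<le>K. q k) + (v K 0 * ln (v K 0 / pmf \<nu> 0) - q 0) + (v K 1 * ln (v K 1 / pmf \<nu> 1) - q 1) < c) sequentially" .
  have "(\<lambda>K. (\<Sum>k\<le>K. u k *\<^sub>R ?f k) + (v K 0 *\<^sub>R ?f 0 - u 0 *\<^sub>R ?f 0) + (v K 1 *\<^sub>R ?f 1 - u 1 *\<^sub>R ?f 1))
    \<longlonglongrightarrow> x' + (u 0 *\<^sub>R ?f 0 - u 0 *\<^sub>R ?f 0) + (u 1 *\<^sub>R ?f 1 - u 1 *\<^sub>R ?f 1)"
    by (intro tendsto_intros u(5)[unfolded sums_def_le] v0 v1)
  from tendsto_dist[OF this tendsto_const[of x]]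
  have "(\<lambda>K. dist ((\<Sum>k\<le>K. u k *\<^sub>R ?f k) + (v K 0 *\<^sub>R ?f 0 - u 0 *\<^sub>R ?f 0) + (v K 1 *\<^sub>R ?f 1 - u 1 *\<^sub>R ?f 1)) x)
    \<longlonglongrightarrow> dist x' x" by simp
  from order_tendstoD(2)[OF this u(6)]
  have e2: "eventually (\<lambda>K. dist ((\<Sum>k\<le>K. u k *\<^sub>R ?f k) + (v K 0 *\<^sub>R ?f 0 - u 0 *\<^sub>R ?f 0) +
    (v K 1 *\<^sub>R ?f 1 - u 1 *\<^sub>R ?f 1)) x < \<epsilon>) sequentially" .
  from eventually_happens'[OF _ eventually_conj[OF eventually_ge_at_top[of 1] eventually_conj[OF
    order_tendstoD(1)[OF v0 u(2)] eventually_conj[OF e1 e2]]]]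
  obtain K where K: "K \<ge> 1" "v K 0 > 0"
    "(\<Sum>k\<le>K. q k) + (v K 0 * ln (v K 0 / pmf \<nu> 0) - q 0) + (v K 1 * ln (v K 1 / pmf \<nu> 1) - q 1) < c"
    "dist ((\<Sum>k\<le>K. u k *\<^sub>R ?f k) + (v K 0 *\<^sub>R ?f 0 - u 0 *\<^sub>R ?f 0) + (v K 1 *\<^sub>R ?f 1 - u 1 *\<^sub>R ?f 1)) x < \<epsilon>"
    by auto
  show ?thesis
  proof (rule exI[of _ K], rule exI[of _ "v K"], intro conjI allI)
    show "K \<ge> 1" "v K 0 > 0" by fact+
    show "v K k \<ge> 0" for k using K(2) u(1) \<tau>0 by (cases "k = 0") (auto simp: v_def)
    show "(\<Sum>k\<le>K. v K k) = 1"
      by (subst sum_change_two[OF K(1), where g = u]) (auto simp: v_def \<sigma>_def)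
    have "(\<Sum>k\<le>K. v K k * real k) = a"
      by (subst sum_change_two[OF K(1), where g = "\<lambda>k. u k * real k"]) (auto simp: v_def \<tau>_def)
    then show "(\<Sum>k\<le>K. v K k * real k) = fst x" by (simp add: a_def)
    show "dist (\<Sum>k\<le>K. v K k *\<^sub>R ?f k) x < \<epsilon>"
      using K(4) by (subst sum_change_two[OF K(1), where g = "\<lambda>k. u k *\<^sub>R ?f k"]) (auto simp: v_def)
    show "(\<Sum>k\<le>K. v K k * ln (v K k / pmf \<nu> k)) < c"
      using K(3) by (subst sum_change_two[OF K(1), where g = q]) (auto simp: v_def q_def)
  qed
qed

section \<open>Probabilities of type classes\<close>

text \<open>A weak form of Stirling's formula, here and in the next lemma; polynomial factors do not matter on the
  exponential scale.\<close>

lemma ln_fact_ge: "real n * ln (real n) - real n \<le> ln (fact n)"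
proof (induction n)
  case (Suc n)
  have "real n * (ln (real (Suc n)) - ln (real n)) \<le> 1"
  proof (cases "n = 0")
    case False
    then have "ln (1 + 1 / real n) \<le> 1 / real n" by (intro ln_add_one_self_le_self) auto
    moreover have "1 + 1 / real n = real (Suc n) / real n" using False by (simp add: field_simps)
    ultimately have "ln (real (Suc n)) - ln (real n) \<le> 1 / real n"
      using False by (simp add: ln_div)
    from mult_left_mono[OF this, of "real n"] show ?thesis using False by simp
  qed simp
  moreover have "ln (fact (Suc n)) = ln (real (Suc n)) + ln (fact n)"
    by (simp add: ln_mult del: of_nat_Suc)
  ultimately show ?case using Suc by (simp add: algebra_simps)
qed simp

lemma ln_fact_le: "ln (fact n) \<le> real (n + 1) * ln (real (n + 1)) - real n"
proof (induction n)
  case (Suc n)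
  define x where "x = real n + 1"
  have x: "x > 0" by (simp add: x_def)
  have "ln (x / (x + 1)) \<le> x / (x + 1) - 1" using x by (intro ln_le_minus_one) simp
  also have "\<dots> = - 1 / (x + 1)" using x by (simp add: field_simps)
  finally have "ln x - ln (x + 1) \<le> - 1 / (x + 1)" using x by (simp add: ln_div)
  then have "(x + 1) * (ln x - ln (x + 1)) \<le> (x + 1) * (- 1 / (x + 1))"
    using x by (intro mult_left_mono) auto
  also have "(x + 1) * (- 1 / (x + 1)) = -1" using x by simp
  finally have "(x + 1) * (ln x - ln (x + 1)) \<le> -1" .
  moreover have "ln (fact (Suc n)) = ln x + ln (fact n)"
    by (simp add: ln_mult x_def add.commute)
  ultimately show ?case using Suc by (simp add: algebra_simps x_def)
qed simp

lemma succ_ln_succ_gap: "real (A + 1) * ln (real (A + 1)) - real A * ln (real A) \<le> 1 + ln (real (A + 1))"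
proof (cases "A = 0")
  case False
  have "ln (1 + 1 / real A) \<le> 1 / real A" by (intro ln_add_one_self_le_self) auto
  moreover have "1 + 1 / real A = real (A + 1) / real A" using False by (simp add: field_simps)
  ultimately have "ln (real (A + 1)) - ln (real A) \<le> 1 / real A"
    using False by (simp add: ln_div)
  from mult_left_mono[OF this, of "real A"] False
  show ?thesis by (simp add: algebra_simps)
qed simp

lemma prod_mset_pos:
  fixes f :: "'a \<Rightarrow> real"
  assumes "\<And>k. k \<in># m \<Longrightarrow> f k > 0"
  shows "(\<Prod>k\<in>#m. f k) > 0"
  using assms by (induction m) auto

text \<open>The multinomial coefficient of a multiset: the size of the type class.\<close>

definition arrangements :: "'a multiset \<Rightarrow> real" where
  "arrangements m = real (card (permutations_of_multiset m))"

lemma arrangements_eq: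
  "arrangements m = fact (size m) / (\<Prod>k\<in>set_mset m. fact (count m k))"
  unfolding arrangements_def
  using card_permutations_of_multiset[of m]
  by (simp add: real_of_nat_div of_nat_prod)

lemma arrangements_pos: "arrangements m > 0"
  by (simp add: arrangements_eq prod_pos)

text \<open>The set \<open>S\<close> may be larger than the support, as the extra terms vanish; the lower estimate uses a set that
  does not depend on \<open>m\<close>.\<close>

lemma ln_arrangements:
  assumes "\<And>k. k \<in># m \<Longrightarrow> \<nu> k > 0" "finite S" "set_mset m \<subseteq> S"
  shows "ln (arrangements m * (\<Prod>k\<in>#m. \<nu> k)) =
    ln (fact (size m)) - (\<Sum>k\<in>S. ln (fact (count m k))) + (\<Sum>k\<in>S. real (count m k) * ln (\<nu> k))"
proof -
  have 1: "(\<Prod>k\<in>#m. \<nu> k) = (\<Prod>k\<in>set_mset m. \<nu> k ^ count m k)"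
    by (rule image_prod_mset_multiplicity)
  have nz: "\<nu> k \<noteq> 0" if "k \<in># m" for k using assms(1)[OF that] by simp
  have p: "(\<Prod>k\<in>set_mset m. \<nu> k ^ count m k) > 0" using assms(1) by (intro prod_pos) auto
  have "ln (\<Prod>k\<in>set_mset m. \<nu> k ^ count m k) = (\<Sum>k\<in>set_mset m. real (count m k) * ln (\<nu> k))"
    using assms(1) by (subst ln_prod) (auto simp: ln_realpow nz intro!: sum.cong)
  also have "\<dots> = (\<Sum>k\<in>S. real (count m k) * ln (\<nu> k))"
    using assms by (intro sum.mono_neutral_left) (auto simp: not_in_iff)
  finally have 2: "ln (\<Prod>k\<in>set_mset m. \<nu> k ^ count m k) = (\<Sum>k\<in>S. real (count m k) * ln (\<nu> k))" .
  have "ln (\<Prod>k\<in>set_mset m. fact (count m k)) = (\<Sum>k\<in>set_mset m. ln (fact (count m k) :: real))"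
    by (subst ln_prod) auto
  also have "\<dots> = (\<Sum>k\<in>S. ln (fact (count m k)))"
    using assms by (intro sum.mono_neutral_left) (auto simp: not_in_iff)
  finally have 3: "ln (\<Prod>k\<in>set_mset m. fact (count m k) :: real) = (\<Sum>k\<in>S. ln (fact (count m k)))" .
  have "ln (arrangements m) = ln (fact (size m)) - (\<Sum>k\<in>S. ln (fact (count m k)))"
    unfolding arrangements_eq by (subst ln_div) (auto simp: 3 intro!: prod_pos)
  then show ?thesis
    using arrangements_pos[of m] p unfolding 1 by (subst ln_mult) (auto simp: 2 nz)
qed

lemma size_eq_sum_count:
  assumes "finite S" "set_mset m \<subseteq> S"
  shows "(\<Sum>k\<in>S. count m k) = size m"
  unfolding size_multiset_overloaded_eq
  using assms by (intro sum.mono_neutral_right) (auto simp: not_in_iff)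

lemma rel_entropy_pmf_of_multiset:
  assumes "m \<noteq> {#}" "\<And>k. pmf \<nu> k > 0"
  shows "rel_entropy (pmf_of_multiset m) \<nu> =
    ereal (\<Sum>k\<in>set_mset m. real (count m k) / real (size m) *
      ln (real (count m k) / real (size m) / pmf \<nu> k))"
proof -
  let ?t = "\<lambda>k. real (count m k) / real (size m) * ln (real (count m k) / real (size m) / pmf \<nu> k)"
  have "rel_entropy (pmf_of_multiset m) \<nu> = (\<Sum>k. ereal (?t k))"
    unfolding rel_entropy_def using assms
    by (intro suminf_cong) (auto simp: less_imp_neq[THEN not_sym])
  also have "\<dots> = (\<Sum>k\<in>set_mset m. ereal (?t k))"
    by (intro suminf_finite) (auto simp: not_in_iff)
  finally show ?thesis by simp
qed

text \<open>Let \<open>L\<^sub>k\<close> be the count of \<open>k\<close> in \<open>m\<close>. Stirling's formula bounds \<open>N! / (\<Prod> L\<^sub>k!)\<close> by a polynomial times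
  \<open>\<Prod> (N / L\<^sub>k) ^ L\<^sub>k\<close>, so the probability of the type class is at most a polynomial times
  \<open>\<Prod> (\<nu>\<^sub>k N / L\<^sub>k) ^ L\<^sub>k\<close>, the exponential of \<open>- N\<close> times the relative entropy.\<close>

lemma type_class_upper:
  assumes m: "m \<noteq> {#}" and pos: "\<And>k. pmf \<nu> k > 0"
    and c: "ereal c \<le> rel_entropy (pmf_of_multiset m) \<nu>"
  shows "arrangements m * (\<Prod>k\<in>#m. pmf \<nu> k) \<le> exp 1 * real (size m + 1) * exp (- real (size m) * c)"
proof -
  define N where "N = size m"
  have N: "N > 0" using m by (simp add: N_def nonempty_has_size)
  let ?S = "set_mset m"
  have cs: "(\<Sum>k\<in>?S. real (count m k)) = real N"
    using size_eq_sum_count[of ?S m] by (simp add: N_def flip: of_nat_sum)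
  have ent: "real N * (\<Sum>k\<in>?S. real (count m k) / real N * ln (real (count m k) / real N / pmf \<nu> k)) =
    (\<Sum>k\<in>?S. real (count m k) * ln (real (count m k))) - real N * ln N - (\<Sum>k\<in>?S. real (count m k) * ln (pmf \<nu> k))"
    (is "?L = _")
  proof -
    have "?L = (\<Sum>k\<in>?S. real (count m k) * ln (real (count m k)) - real (count m k) * ln N - real (count m k) * ln (pmf \<nu> k))"
      unfolding sum_distrib_left
    proof (rule sum.cong[OF refl])
      fix k assume "k \<in># m"
      then have "ln (real (count m k) / real N / pmf \<nu> k) = ln (real (count m k)) - ln N - ln (pmf \<nu> k)"
        using N pos[of k] by (simp add: ln_div ln_mult)
      then show "real N * (real (count m k) / real N * ln (real (count m k) / real N / pmf \<nu> k)) =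
        real (count m k) * ln (real (count m k)) - real (count m k) * ln N - real (count m k) * ln (pmf \<nu> k)"
        using N by (simp add: right_diff_distrib)
    qed
    then show ?thesis by (simp add: sum_subtractf cs flip: sum_distrib_right)
  qed
  have "c \<le> (\<Sum>k\<in>?S. real (count m k) / real N * ln (real (count m k) / real N / pmf \<nu> k))"
    using c rel_entropy_pmf_of_multiset[OF m pos] by (simp add: N_def)
  from mult_left_mono[OF this, of "real N"] ent
  have c': "real N * c \<le> (\<Sum>k\<in>?S. real (count m k) * ln (real (count m k))) - real N * ln N - (\<Sum>k\<in>?S. real (count m k) * ln (pmf \<nu> k))"
    by simp
  have "(\<Sum>k\<in>?S. real (count m k) * ln (real (count m k)) - real (count m k)) \<le> (\<Sum>k\<in>?S. ln (fact (count m k)))"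
    by (intro sum_mono ln_fact_ge)
  then have f: "(\<Sum>k\<in>?S. real (count m k) * ln (real (count m k))) - real N \<le> (\<Sum>k\<in>?S. ln (fact (count m k)))"
    by (simp add: sum_subtractf cs)
  have "ln (arrangements m * (\<Prod>k\<in>#m. pmf \<nu> k)) \<le>
     (real (N + 1) * ln (real (N + 1)) - real N) - ((\<Sum>k\<in>?S. real (count m k) * ln (real (count m k))) - real N)
     + (\<Sum>k\<in>?S. real (count m k) * ln (pmf \<nu> k))"
    using ln_arrangements[of m "pmf \<nu>" ?S] pos f ln_fact_le[of N] by (simp add: N_def)
  also have "\<dots> \<le> 1 + ln (real (N + 1)) - real N * c"
    using c' succ_ln_succ_gap[of N] by (simp only: algebra_simps)
  also have "\<dots> = ln (exp 1 * real (N + 1) * exp (- real N * c))"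
    by (simp add: ln_mult)
  finally show ?thesis
    by (subst (asm) ln_le_cancel_iff)
      (auto simp: N_def intro!: mult_pos_pos arrangements_pos prod_mset_pos pos)
qed

text \<open>On a fixed finite alphabet the reverse Stirling estimate loses only a factor of order \<open>N ^ (K + 1)\<close>, and the
  entropy of the type converges to that of the limit by continuity of \<open>x ln x\<close>, also at 0.\<close>

lemma type_class_lower_limit:
  fixes v :: "nat \<Rightarrow> real" and m :: "nat \<Rightarrow> nat multiset"
  assumes pos: "\<And>k. pmf \<nu> k > 0"
    and m: "eventually (\<lambda>N. size (m N) = N \<and> set_mset (m N) \<subseteq> {..K}) sequentially"
    and lim: "\<And>k. k \<le> K \<Longrightarrow> (\<lambda>N. real (count (m N) k) / real N) \<longlonglongrightarrow> v k"
    and v: "\<And>k. v k \<ge> 0"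
    and c: "(\<Sum>k\<le>K. v k * ln (v k / pmf \<nu> k)) < c"
  shows "eventually (\<lambda>N. arrangements (m N) * (\<Prod>k\<in>#m N. pmf \<nu> k) \<ge> exp (- real N * c)) sequentially"
proof -
  \<comment> \<open>the shift by \<open>1 / N\<close> comes from \<open>n + 1\<close> in place of \<open>n\<close> in the upper bound for the factorials\<close>
  define y where "y N k = real (count (m N) k) / real N + 1 / real N" for N k
  have y: "(\<lambda>N. y N k) \<longlonglongrightarrow> v k" if "k \<le> K" for k
  proof -
    have "(\<lambda>N. real (count (m N) k) / real N + 1 / real N) \<longlonglongrightarrow> v k + 0"
      by (intro tendsto_add lim that lim_1_over_n)
    then show ?thesis by (simp add: y_def)
  qed
  define B where "B N = (\<Sum>k\<le>K. y N k * ln (y N k)) + real (K + 1) * (ln (real N) / real N)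
      - (\<Sum>k\<le>K. real (count (m N) k) / real N * ln (pmf \<nu> k))" for N
  have lnN: "(\<lambda>N. ln (real N) / real N) \<longlonglongrightarrow> 0" by real_asymp
  have "B \<longlonglongrightarrow> (\<Sum>k\<le>K. v k * ln (v k)) + real (K + 1) * 0 - (\<Sum>k\<le>K. v k * ln (pmf \<nu> k))"
    unfolding B_def
    by (intro tendsto_add tendsto_diff tendsto_mult tendsto_const tendsto_sum lnN lim tendsto_x_ln_x y v)
      (auto simp: y_def)
  also have "(\<Sum>k\<le>K. v k * ln (v k)) + real (K + 1) * 0 - (\<Sum>k\<le>K. v k * ln (pmf \<nu> k)) =
      (\<Sum>k\<le>K. v k * ln (v k / pmf \<nu> k))"
  proof -
    have "v k * ln (v k / pmf \<nu> k) = v k * ln (v k) - v k * ln (pmf \<nu> k)" for k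
      using v[of k] pos[of k] by (cases "v k = 0") (auto simp: ln_div algebra_simps)
    then show ?thesis by (simp add: sum_subtractf)
  qed
  finally have "eventually (\<lambda>N. B N < c) sequentially" using c by (rule order_tendstoD(2))
  then show ?thesis
    using m eventually_gt_at_top[of 0]
  proof eventually_elim
    case (elim N)
    let ?c = "\<lambda>k. count (m N) k"
    have N: "N > 0" "size (m N) = N" "set_mset (m N) \<subseteq> {..K}" using elim by auto
    have cs: "(\<Sum>k\<le>K. real (?c k)) = real N"
      using size_eq_sum_count[of "{..K}" "m N"] N by (simp flip: of_nat_sum)
    have yN: "real N * y N k = real (?c k) + 1" "y N k > 0" for k
      using N by (auto simp: y_def field_simps add_nonneg_pos)
    have "(\<Sum>k\<le>K. ln (fact (?c k))) \<le> (\<Sum>k\<le>K. (real (?c k) + 1) * ln (real (?c k) + 1) - real (?c k))"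
      using ln_fact_le by (intro sum_mono) (simp add: add.commute)
    also have "\<dots> = (\<Sum>k\<le>K. real N * (y N k * ln (y N k)) + ln (real N) * (real (?c k) + 1)) - real N"
    proof -
      have "(real (?c k) + 1) * ln (real (?c k) + 1) = real N * (y N k * ln (y N k)) + ln (real N) * (real (?c k) + 1)" for k
      proof -
        have "ln (real (?c k) + 1) = ln (real N) + ln (y N k)"
          using N yN(2)[of k] by (simp flip: yN(1) add: ln_mult)
        then have "(real (?c k) + 1) * ln (real (?c k) + 1) = (real N * y N k) * ln (y N k) + ln (real N) * (real (?c k) + 1)"
          by (simp add: yN(1) algebra_simps)
        then show ?thesis by (simp add: mult.assoc)
      qed
      then show ?thesis by (simp add: sum_subtractf cs)
    qed
    also have "\<dots> = real N * (\<Sum>k\<le>K. y N k * ln (y N k)) + ln (real N) * (real N + real (K + 1)) - real N"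
      by (simp add: sum.distrib cs flip: sum_distrib_left)
    finally have f: "(\<Sum>k\<le>K. ln (fact (?c k))) \<le> real N * (\<Sum>k\<le>K. y N k * ln (y N k)) + ln (real N) * (real N + real (K + 1)) - real N" .
    have "real N * B N = real N * (\<Sum>k\<le>K. y N k * ln (y N k)) + real (K + 1) * ln (real N)
      - (\<Sum>k\<le>K. real (?c k) * ln (pmf \<nu> k))"
    proof -
      have "real N * (real (K + 1) * (ln (real N) / real N)) = real (K + 1) * ln (real N)"
        using N by simp
      moreover have "real N * (\<Sum>k\<le>K. real (?c k) / real N * ln (pmf \<nu> k)) = (\<Sum>k\<le>K. real (?c k) * ln (pmf \<nu> k))"
        unfolding sum_distrib_left using N by (intro sum.cong) auto
      ultimately show ?thesis unfolding B_def by (simp only: right_diff_distrib distrib_left)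
    qed
    then have "- (real N * B N) \<le> ln (arrangements (m N) * (\<Prod>k\<in>#m N. pmf \<nu> k))"
      using f ln_fact_ge[of N] ln_arrangements[of "m N" "pmf \<nu>" "{..K}"] pos N
      by (simp add: algebra_simps)
    moreover have "- real N * c \<le> - (real N * B N)"
      using elim N by simp
    ultimately have "- real N * c \<le> ln (arrangements (m N) * (\<Prod>k\<in>#m N. pmf \<nu> k))" by linarith
    then show ?case
      by (subst (asm) ln_ge_iff)
        (auto intro!: mult_pos_pos arrangements_pos prod_mset_pos pos)
  qed
qed

section \<open>Counting and constructing profiles\<close>

lemma floor_mult_over_tendsto:
  fixes c :: real
  assumes c: "c \<ge> 0"
  shows "(\<lambda>N. real (nat \<lfloor>c * real N\<rfloor>) / real N) \<longlonglongrightarrow> c"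
proof (rule tendsto_sandwich)
  show "(\<lambda>N. c - 1 / real N) \<longlonglongrightarrow> c" using tendsto_diff[OF tendsto_const[of c] lim_1_over_n] by simp
  show "(\<lambda>N. c) \<longlonglongrightarrow> c" by simp
  show "eventually (\<lambda>N. c - 1 / real N \<le> real (nat \<lfloor>c * real N\<rfloor>) / real N) sequentially"
    using eventually_gt_at_top[of 0]
  proof eventually_elim
    case (elim N)
    have "c * real N - 1 \<le> real (nat \<lfloor>c * real N\<rfloor>)" by linarith
    then have "(c * real N - 1) / real N \<le> real (nat \<lfloor>c * real N\<rfloor>) / real N"
      by (intro divide_right_mono) auto
    then show ?case using elim by (simp add: diff_divide_distrib)
  qed
  show "eventually (\<lambda>N. real (nat \<lfloor>c * real N\<rfloor>) / real N \<le> c) sequentially"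
    using eventually_gt_at_top[of 0]
  proof eventually_elim
    case (elim N)
    have "real (nat \<lfloor>c * real N\<rfloor>) \<le> c * real N" using c by simp
    then show ?case using elim by (simp add: field_simps)
  qed
qed

lemma sum_mset_eq_sum_count:
  "sum_mset (m :: nat multiset) = (\<Sum>k\<in>set_mset m. k * count m k)"
proof (induction m)
  case (add k m)
  have "(\<Sum>j\<in>set_mset (add_mset k m). j * count (add_mset k m) j) =
    (\<Sum>j\<in>insert k (set_mset m). j * count m j + (if j = k then k else 0))"
    by (intro sum.cong) auto
  also have "\<dots> = (\<Sum>j\<in>insert k (set_mset m). j * count m j) + k"
    by (simp add: sum.distrib)
  also have "(\<Sum>j\<in>insert k (set_mset m). j * count m j) = (\<Sum>j\<in>set_mset m. j * count m j)"
    by (intro sum.mono_neutral_right) (auto simp: not_in_iff)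
  finally show ?case using add by simp
qed simp

text \<open>A profile with sum at most \<open>B\<close> is a partition of an integer up to \<open>B\<close>, padded by zeros. The generating
  function of partitions, \<open>\<Prod> 1 / (1 - x ^ k)\<close>, is at most \<open>exp (1 / (1 - x)\<^sup>2)\<close>, and each partition contributes at
  least \<open>x ^ B\<close> to it. Since \<open>x\<close> may be arbitrarily close to 1, the number grows subexponentially in \<open>B\<close>.\<close>

lemma card_profiles_le:
  fixes x :: real and N B :: nat
  assumes x: "0 < x" "x < 1"
  defines "T \<equiv> {m :: nat multiset. size m = N \<and> sum_mset m \<le> B}"
  shows "finite T" and "real (card T) \<le> exp (1 / (1 - x)\<^sup>2) / x ^ B"
proof -
  define \<phi> where "\<phi> m = restrict (count m) {1..B}" for m :: "nat multiset"
  define R where "R = PiE {1..B} (\<lambda>_. {..B})"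
  have elem: "k \<le> B" if "m \<in> T" "k \<in># m" for m k
    using that sum_mset.remove[OF that(2)] by (auto simp: T_def)
  have sub: "set_mset m \<subseteq> {0..B}" if "m \<in> T" for m using elem[OF that] by auto
  have sum_T: "sum_mset m = (\<Sum>k\<in>{1..B}. k * count m k)" if "m \<in> T" for m
  proof -
    have "sum_mset m = (\<Sum>k\<in>set_mset m. k * count m k)"
      by (rule sum_mset_eq_sum_count)
    also have "\<dots> = (\<Sum>k\<in>{0..B}. k * count m k)"
      using sub[OF that] by (intro sum.mono_neutral_left) (auto simp: not_in_iff)
    also have "\<dots> = (\<Sum>k\<in>{1..B}. k * count m k)"
      by (intro sum.mono_neutral_right) auto
    finally show ?thesis .
  qed
  have size_T: "count m 0 + (\<Sum>k\<in>{1..B}. count m k) = N" if "m \<in> T" for m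
  proof -
    have "N = (\<Sum>k\<in>set_mset m. count m k)" using that by (simp add: T_def size_multiset_overloaded_eq)
    also have "\<dots> = (\<Sum>k\<in>{0..B}. count m k)"
      using sub[OF that] by (intro sum.mono_neutral_left) (auto simp: not_in_iff)
    also have "\<dots> = count m 0 + (\<Sum>k\<in>{1..B}. count m k)"
      by (simp add: sum.atLeast_Suc_atMost)
    finally show ?thesis by simp
  qed
  \<comment> \<open>the number of zeros is determined by the size \<open>N\<close>\<close>
  have inj: "inj_on \<phi> T"
  proof (rule inj_onI)
    fix m m' assume T: "m \<in> T" "m' \<in> T" and eq: "\<phi> m = \<phi> m'"
    have c: "count m k = count m' k" if "k \<in> {1..B}" for k
      using fun_cong[OF eq, of k] that by (simp add: \<phi>_def)
    then have "(\<Sum>k\<in>{1..B}. count m k) = (\<Sum>k\<in>{1..B}. count m' k)" by (intro sum.cong) auto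
    then have c0: "count m 0 = count m' 0" using size_T[OF T(1)] size_T[OF T(2)] by linarith
    show "m = m'"
    proof (rule multiset_eqI)
      fix k
      consider "k = 0" | "k \<in> {1..B}" | "k > B" by fastforce
      then show "count m k = count m' k"
      proof cases
        case 3
        then have "k \<notin># m" "k \<notin># m'" using elem T by (meson not_le)+
        then show ?thesis by (simp add: not_in_iff)
      qed (use c c0 in auto)
    qed
  qed
  have ran: "\<phi> ` T \<subseteq> R"
  proof
    fix L assume "L \<in> \<phi> ` T"
    then obtain m where m: "m \<in> T" "L = \<phi> m" by auto
    have "count m k \<le> B" if k: "k \<in> {1..B}" for k
    proof -
      have "count m k \<le> k * count m k" using k by simp
      also have "\<dots> \<le> (\<Sum>k\<in>{1..B}. k * count m k)" using k by (intro member_le_sum) auto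
      also have "\<dots> \<le> B" using m(1) sum_T[OF m(1)] by (simp add: T_def)
      finally show ?thesis .
    qed
    then show "L \<in> R" by (auto simp: m R_def \<phi>_def)
  qed
  have finR: "finite R" by (auto simp: R_def intro: finite_PiE)
  then show "finite T" using ran inj by (meson finite_imageD finite_subset)
  have "real (card T) * x ^ B = (\<Sum>m\<in>T. x ^ B)" by simp
  also have "\<dots> \<le> (\<Sum>m\<in>T. \<Prod>k\<in>{1..B}. (x ^ k) ^ \<phi> m k)"
  proof (rule sum_mono)
    fix m assume m: "m \<in> T"
    have "(\<Prod>k\<in>{1..B}. (x ^ k) ^ \<phi> m k) = x ^ (\<Sum>k\<in>{1..B}. k * count m k)"
      unfolding power_sum by (intro prod.cong) (auto simp: \<phi>_def power_mult)
    also have "\<dots> = x ^ sum_mset m" by (simp add: sum_T[OF m])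
    also have "x ^ sum_mset m \<ge> x ^ B" using m x by (intro power_decreasing) (auto simp: T_def)
    finally show "x ^ B \<le> (\<Prod>k\<in>{1..B}. (x ^ k) ^ \<phi> m k)" .
  qed
  also have "\<dots> = (\<Sum>L\<in>\<phi> ` T. \<Prod>k\<in>{1..B}. (x ^ k) ^ L k)"
    by (simp add: sum.reindex[OF inj])
  also have "\<dots> \<le> (\<Sum>L\<in>R. \<Prod>k\<in>{1..B}. (x ^ k) ^ L k)"
    using x by (intro sum_mono2[OF finR ran]) (auto intro!: prod_nonneg)
  also have "\<dots> = (\<Prod>k\<in>{1..B}. \<Sum>j\<in>{..B}. (x ^ k) ^ j)"
    unfolding R_def by (rule prod_sum_PiE[symmetric]) auto
  also have "\<dots> \<le> (\<Prod>k\<in>{1..B}. exp (x ^ k / (1 - x)))"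
  proof (rule prod_mono, intro conjI)
    fix k assume k: "k \<in> {1..B}"
    show "0 \<le> (\<Sum>j\<in>{..B}. (x ^ k) ^ j)" using x by (intro sum_nonneg) auto
    define z where "z = x ^ k"
    have z: "0 < z" "z < 1" "z \<le> x"
      using x k power_decreasing[of 1 k x] by (auto simp: z_def power_less_one_iff)
    have "(\<Sum>j\<in>{..B}. z ^ j) \<le> (\<Sum>j. z ^ j)"
      using z by (intro sum_le_suminf summable_geometric) auto
    also have "\<dots> = 1 / (1 - z)" using z by (intro suminf_geometric) auto
    also have "\<dots> = 1 + z / (1 - z)" using z by (simp add: field_simps)
    also have "\<dots> \<le> exp (z / (1 - z))" by (rule exp_ge_add_one_self)
    also have "\<dots> \<le> exp (z / (1 - x))" using z x by (simp add: frac_le)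
    finally show "(\<Sum>j\<in>{..B}. (x ^ k) ^ j) \<le> exp (x ^ k / (1 - x))" by (simp add: z_def)
  qed
  also have "\<dots> = exp ((\<Sum>k\<in>{1..B}. x ^ k) / (1 - x))"
    by (simp add: exp_sum sum_divide_distrib)
  also have "\<dots> \<le> exp (1 / (1 - x)\<^sup>2)"
  proof -
    have "(\<Sum>k\<in>{1..B}. x ^ k) \<le> (\<Sum>k. x ^ k)"
      using x by (intro sum_le_suminf summable_geometric) auto
    also have "\<dots> = 1 / (1 - x)" using x by (intro suminf_geometric) auto
    finally have "(\<Sum>k\<in>{1..B}. x ^ k) / (1 - x) \<le> 1 / (1 - x) / (1 - x)"
      using x by (intro divide_right_mono) auto
    then show ?thesis by (simp add: power2_eq_square)
  qed
  finally show "real (card T) \<le> exp (1 / (1 - x)\<^sup>2) / x ^ B"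
    using x by (simp add: pos_le_divide_eq)
qed

lemma multiset_with_counts:
  fixes L :: "nat \<Rightarrow> nat" and K :: nat
  defines "m \<equiv> (\<Sum>k\<le>K. replicate_mset (L k) k)"
  shows "count m k = (if k \<le> K then L k else 0)" "set_mset m \<subseteq> {..K}"
    "size m = (\<Sum>k\<le>K. L k)" "sum_mset m = (\<Sum>k\<le>K. k * L k)"
proof -
  show c: "count m k = (if k \<le> K then L k else 0)" for k
    unfolding m_def by (simp add: count_sum if_distrib)
  show "set_mset m \<subseteq> {..K}"
    using c by (auto simp: set_mset_def split: if_splits)
  show "size m = (\<Sum>k\<le>K. L k)" unfolding m_def by (simp add: size_multiset_sum)
  show "sum_mset m = (\<Sum>k\<le>K. k * L k)"
    unfolding m_def by (induction K) (auto simp: mult.commute)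
qed

text \<open>The counts from 2 on are rounded down, the count of 1 is chosen so that the sum is exactly
  \<open>\<lfloor>a N\<rfloor>\<close>, and the count of 0 so that the size is \<open>N\<close>. The latter needs room, provided by \<open>v 0 > 0\<close>.\<close>

lemma integer_rounding:
  fixes v :: "nat \<Rightarrow> real"
  assumes K: "K \<ge> 1" and v: "\<And>k. v k \<ge> 0" "v 0 > 0" "(\<Sum>k\<le>K. v k) = 1" "(\<Sum>k\<le>K. v k * real k) = a"
  shows "\<exists>m :: nat \<Rightarrow> nat multiset.
    eventually (\<lambda>N. size (m N) = N \<and> set_mset (m N) \<subseteq> {..K} \<and> sum_mset (m N) = nat \<lfloor>a * real N\<rfloor>) sequentially \<and>
    (\<forall>k\<le>K. (\<lambda>N. real (count (m N) k) / real N) \<longlonglongrightarrow> v k)"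
proof -
  have a: "a \<ge> 0" using v(1) by (simp add: v(4)[symmetric] sum_nonneg)
  define F where "F N k = nat \<lfloor>v k * real N\<rfloor>" for N k
  define L1 where "L1 N = nat \<lfloor>a * real N\<rfloor> - (\<Sum>k\<in>{2..K}. k * F N k)" for N
  define L0 where "L0 N = N - (L1 N + (\<Sum>k\<in>{2..K}. F N k))" for N
  define L where "L N k = (if k = 0 then L0 N else if k = 1 then L1 N else F N k)" for N k
  define m where "m N = (\<Sum>k\<le>K. replicate_mset (L N k) k)" for N
  note split = sum_atMost_split_two[OF K]
  have F: "(\<lambda>N. real (F N k) / real N) \<longlonglongrightarrow> v k" for k
    unfolding F_def by (rule floor_mult_over_tendsto[OF v(1)])
  \<comment> \<open>so the count of 1 is not cut off at 0: the rounded counts use at most \<open>a N\<close>, hence at most \<open>\<lfloor>a N\<rfloor>\<close>, attempts\<close>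
  have le: "(\<Sum>k\<in>{2..K}. k * F N k) \<le> nat \<lfloor>a * real N\<rfloor>" for N
  proof -
    have "real (\<Sum>k\<in>{2..K}. k * F N k) \<le> (\<Sum>k\<in>{2..K}. v k * real k * real N)"
      unfolding of_nat_sum
    proof (rule sum_mono)
      fix k
      have "real (F N k) \<le> v k * real N" using v(1) by (simp add: F_def)
      then have "real k * real (F N k) \<le> real k * (v k * real N)" by (intro mult_left_mono) auto
      then show "real (k * F N k) \<le> v k * real k * real N" by (simp add: mult_ac)
    qed
    also have "\<dots> = (\<Sum>k\<in>{2..K}. v k * real k) * real N" by (simp add: sum_distrib_right)
    also have "\<dots> \<le> a * real N"
      using v(1)[of 1] split[of "\<lambda>k. v k * real k"] v(4) by (intro mult_right_mono) auto
    finally show ?thesis by linarith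
  qed
  have L1: "(\<lambda>N. real (L1 N) / real N) \<longlonglongrightarrow> v 1"
  proof -
    have "(\<lambda>N. real (nat \<lfloor>a * real N\<rfloor>) / real N - (\<Sum>k\<in>{2..K}. real k * (real (F N k) / real N)))
      \<longlonglongrightarrow> a - (\<Sum>k\<in>{2..K}. real k * v k)"
      by (intro tendsto_intros F floor_mult_over_tendsto a)
    also have "a - (\<Sum>k\<in>{2..K}. real k * v k) = v 1"
      using split[of "\<lambda>k. v k * real k"] v(4) by (simp add: mult.commute)
    also have "(\<lambda>N. real (nat \<lfloor>a * real N\<rfloor>) / real N - (\<Sum>k\<in>{2..K}. real k * (real (F N k) / real N)))
      = (\<lambda>N. real (L1 N) / real N)"
      unfolding L1_def of_nat_diff[OF le] by (simp add: diff_divide_distrib sum_divide_distrib)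
    finally show ?thesis .
  qed
  have "(\<lambda>N. real (L1 N) / real N + (\<Sum>k\<in>{2..K}. real (F N k) / real N))
      \<longlonglongrightarrow> v 1 + (\<Sum>k\<in>{2..K}. v k)"
    by (intro tendsto_intros F L1)
  also have "v 1 + (\<Sum>k\<in>{2..K}. v k) = 1 - v 0"
    using split[of v] v(3) by simp
  finally have rest: "(\<lambda>N. real (L1 N + (\<Sum>k\<in>{2..K}. F N k)) / real N) \<longlonglongrightarrow> 1 - v 0"
    by (simp add: add_divide_distrib sum_divide_distrib)
  have ev: "eventually (\<lambda>N. L1 N + (\<Sum>k\<in>{2..K}. F N k) \<le> N \<and> N > 0) sequentially"
    using order_tendstoD(2)[OF rest, of 1, simplified, OF v(2)] eventually_gt_at_top[of 0]
  proof eventually_elim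
    case (elim N)
    then have "real (L1 N + (\<Sum>k\<in>{2..K}. F N k)) < real N" using v(2) by (simp add: field_simps)
    then show ?case using elim by linarith
  qed
  have L0: "(\<lambda>N. real (L0 N) / real N) \<longlonglongrightarrow> v 0"
  proof -
    have "(\<lambda>N. 1 - real (L1 N + (\<Sum>k\<in>{2..K}. F N k)) / real N) \<longlonglongrightarrow> 1 - (1 - v 0)"
      by (intro tendsto_intros rest)
    moreover have "eventually (\<lambda>N. 1 - real (L1 N + (\<Sum>k\<in>{2..K}. F N k)) / real N = real (L0 N) / real N) sequentially"
      using ev by eventually_elim (simp add: L0_def of_nat_diff diff_divide_distrib)
    ultimately show ?thesis using Lim_transform_eventually by fastforce
  qed
  show ?thesis
  proof (rule exI[of _ m], intro conjI allI impI)
    show "eventually (\<lambda>N. size (m N) = N \<and> set_mset (m N) \<subseteq> {..K} \<and> sum_mset (m N) = nat \<lfloor>a * real N\<rfloor>) sequentially"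
      using ev
    proof eventually_elim
      case (elim N)
      have s: "(\<Sum>k\<in>{2..K}. L N k) = (\<Sum>k\<in>{2..K}. F N k)" "(\<Sum>k\<in>{2..K}. k * L N k) = (\<Sum>k\<in>{2..K}. k * F N k)"
        by (auto simp: L_def intro!: sum.cong)
      have "size (m N) = N"
        unfolding m_def multiset_with_counts split s using elim by (simp add: L_def L0_def)
      moreover have "sum_mset (m N) = nat \<lfloor>a * real N\<rfloor>"
      proof -
        have "sum_mset (m N) = (\<Sum>k\<le>K. k * L N k)" unfolding m_def by (rule multiset_with_counts(4))
        then show ?thesis unfolding split s using le[of N] by (simp add: L_def L1_def)
      qed
      ultimately show ?case unfolding m_def using multiset_with_counts(2) by blast
    qed
    show "(\<lambda>N. real (count (m N) k) / real N) \<longlonglongrightarrow> v k" if "k \<le> K" for k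
      unfolding m_def multiset_with_counts using that L0 L1 F
      by (cases "k = 0"; cases "k = 1") (simp_all add: L_def)
  qed
qed

section \<open>The law of the profile\<close>

definition slot_counts :: "nat \<Rightarrow> attempts \<Rightarrow> nat list" where
  "slot_counts N \<omega> = map (attempts_in_slot \<omega>) [0..<N]"

definition profile :: "nat \<Rightarrow> attempts \<Rightarrow> nat multiset" where
  "profile N \<omega> = mset (slot_counts N \<omega>)"

definition num_participants :: "real \<Rightarrow> nat \<Rightarrow> nat" where
  "num_participants b N = nat \<lfloor>b * real N\<rfloor>"

lemma participants_eq: "participants b N = {..<num_participants b N}"
  by (simp add: participants_def num_participants_def)

text \<open>Double counting of a set of attempts along the slots.\<close>

lemma card_eq_sum_slots:
  assumes "\<omega> \<subseteq> I \<times> {..<N}" "finite I"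
  shows "card \<omega> = (\<Sum>t<N. attempts_in_slot \<omega> t)"
proof -
  have fin: "finite {i. (i, t) \<in> \<omega>}" for t
    using assms by (intro finite_subset[OF _ assms(2)]) auto
  have "\<omega> = prod.swap ` (SIGMA t:{..<N}. {i. (i, t) \<in> \<omega>})"
    using assms by force
  then have "card \<omega> = card (SIGMA t:{..<N}. {i. (i, t) \<in> \<omega>})"
    by (metis card_image inj_on_subset inj_swap subset_UNIV)
  also have "\<dots> = (\<Sum>t<N. card {i. (i, t) \<in> \<omega>})"
    using fin by (intro card_SigmaI) auto
  finally show ?thesis by (simp add: attempts_in_slot_def)
qed

lemma scaled_triple_eq:
  assumes "\<omega> \<subseteq> I \<times> {..<N}" "finite I"
  shows "scaled_triple \<kappa> N \<omega> = (1 / real N) *\<^sub>R (\<Sum>k\<in>#profile N \<omega>. slot_statistic \<kappa> k)"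
proof -
  let ?n = "attempts_in_slot \<omega>"
  let ?\<omega>' = "{(i, t) \<in> \<omega>. ?n t \<le> \<kappa>}"
  have "card ?\<omega>' = (\<Sum>t<N. attempts_in_slot ?\<omega>' t)"
    using assms by (intro card_eq_sum_slots[of _ I]) auto
  also have "\<dots> = (\<Sum>t<N. if ?n t \<le> \<kappa> then ?n t else 0)"
    by (intro sum.cong refl) (auto simp: attempts_in_slot_def)
  finally have S: "real (num_successful_attempts \<kappa> \<omega>) = (\<Sum>t<N. real (?n t) * indicator {..\<kappa>} (?n t))"
    unfolding num_successful_attempts_def of_nat_sum
    by (simp add: indicator_def of_bool_def cong: if_cong) (auto intro!: sum.cong)
  have A: "real (num_attempts \<omega>) = (\<Sum>t<N. real (?n t))"
    unfolding num_attempts_def card_eq_sum_slots[OF assms] by simp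
  have R: "real (num_successful_slots \<kappa> N \<omega>) = (\<Sum>t<N. indicator {..\<kappa>} (?n t))"
    unfolding num_successful_slots_def
    by (simp add: indicator_def sum.If_cases Int_def conj_commute of_bool_def)
  have "(\<Sum>k\<in>#profile N \<omega>. slot_statistic \<kappa> k) = (\<Sum>t<N. slot_statistic \<kappa> (?n t))"
    unfolding profile_def slot_counts_def
    by (simp add: sum_unfold_sum_mset image_mset.compositionality comp_def atLeast0LessThan)
  also have "\<dots> = (real (num_attempts \<omega>), real (num_successful_attempts \<kappa> \<omega>), real (num_successful_slots \<kappa> N \<omega>))"
    unfolding slot_statistic_def A S R by (simp add: sum_prod)
  finally show ?thesis by (simp add: scaled_triple_def)
qed

text \<open>Both access rules give equal probability to all possible outcomes with the same slot counts, so only the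
  number of these outcomes matters.\<close>

lemma prob_slot_counts:
  fixes P :: "attempts pmf"
  assumes E: "finite E" "set_pmf P \<inter> {\<omega>. slot_counts N \<omega> = xs} \<subseteq> E" "E \<subseteq> {\<omega>. slot_counts N \<omega> = xs}"
    and w: "\<And>\<omega>. \<omega> \<in> E \<Longrightarrow> pmf P \<omega> = w"
  shows "measure_pmf.prob P {\<omega>. slot_counts N \<omega> = xs} = real (card E) * w"
proof -
  have "measure_pmf.prob P {\<omega>. slot_counts N \<omega> = xs} = measure_pmf.prob P E"
    using E by (intro measure_prob_cong_0) (auto simp: set_pmf_iff)
  also have "\<dots> = (\<Sum>\<omega>\<in>E. pmf P \<omega>)" by (rule measure_measure_pmf_finite[OF E(1)])
  finally show ?thesis using w by simp
qed

lemma pmf_profile: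
  fixes P :: "attempts pmf"
  assumes "\<And>xs. mset xs = m \<Longrightarrow> measure_pmf.prob P {\<omega>. slot_counts N \<omega> = xs} = w"
  shows "pmf (map_pmf (profile N) P) m = arrangements m * w"
proof -
  have "pmf (map_pmf (profile N) P) m = measure_pmf.prob P (\<Union>xs\<in>permutations_of_multiset m. {\<omega>. slot_counts N \<omega> = xs})"
    unfolding pmf_map by (intro arg_cong2[of _ _ _ _ measure] refl)
      (auto simp: profile_def permutations_of_multiset_def)
  also have "\<dots> = (\<Sum>xs\<in>permutations_of_multiset m. measure_pmf.prob P {\<omega>. slot_counts N \<omega> = xs})"
    by (intro measure_pmf.finite_measure_finite_Union) (auto simp: disjoint_family_on_def)
  also have "\<dots> = (\<Sum>xs\<in>permutations_of_multiset m. w)"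
    using assms by (intro sum.cong refl) (auto simp: permutations_of_multiset_def)
  finally show ?thesis by (simp add: arrangements_def)
qed

lemma slot_counts_eq_iff:
  "length xs = N \<Longrightarrow> slot_counts N \<omega> = xs \<longleftrightarrow> (\<forall>t<N. attempts_in_slot \<omega> t = xs ! t)"
  by (auto simp: slot_counts_def list_eq_iff_nth_eq)

lemma sum_attempts_in_slot: "slot_counts N \<omega> = xs \<Longrightarrow> (\<Sum>t<N. attempts_in_slot \<omega> t) = sum_mset (mset xs)"
  by (auto simp: slot_counts_def sum_mset_sum_list sum_list_sum_nth atLeast0LessThan)

lemma prod_nth_eq_prod_mset:
  "length xs = N \<Longrightarrow> (\<Prod>t<N. f (xs ! t)) = (\<Prod>k\<in>#mset xs. f k)"
proof -
  assume N: "length xs = N"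
  have "(\<Prod>k\<in>#mset xs. f k) = prod_list (map f xs)"
    by (metis mset_map prod_mset_prod_list)
  also have "\<dots> = (\<Prod>t<N. f (xs ! t))"
    using N by (simp add: prod.list_conv_set_nth atLeast0LessThan)
  finally show ?thesis by simp
qed

text \<open>An arbitrary set of attempts is an independent choice, for each slot, of the participants that use it.\<close>

lemma card_attempt_sets:
  assumes I: "finite I" "card I = M" and xs: "length xs = N"
  shows "card {\<omega>. \<omega> \<subseteq> I \<times> {..<N} \<and> slot_counts N \<omega> = xs} = (\<Prod>k\<in>#mset xs. M choose k)"
proof -
  let ?E = "{\<omega>. \<omega> \<subseteq> I \<times> {..<N} \<and> slot_counts N \<omega> = xs}"
  let ?R = "PiE {..<N} (\<lambda>t. {S. S \<subseteq> I \<and> card S = xs ! t})"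
  define \<phi> where "\<phi> \<omega> = (\<lambda>t\<in>{..<N}. {i. (i, t) \<in> \<omega>})" for \<omega> :: "(nat \<times> nat) set"
  define \<psi> where "\<psi> g = {(i, t). t < N \<and> i \<in> g t}" for g :: "nat \<Rightarrow> nat set"
  have "bij_betw \<phi> ?E ?R"
  proof (rule bij_betw_byWitness[where f' = \<psi>])
    show "\<forall>\<omega>\<in>?E. \<psi> (\<phi> \<omega>) = \<omega>" by (auto simp: \<phi>_def \<psi>_def)
    show "\<forall>g\<in>?R. \<phi> (\<psi> g) = g"
      by (auto simp: \<phi>_def \<psi>_def fun_eq_iff PiE_def extensional_def)
    show "\<phi> ` ?E \<subseteq> ?R"
      by (auto simp: \<phi>_def slot_counts_eq_iff[OF xs] attempts_in_slot_def)
    show "\<psi> ` ?R \<subseteq> ?E"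
    proof
      fix \<omega> assume "\<omega> \<in> \<psi> ` ?R"
      then obtain g where g: "g \<in> ?R" "\<omega> = \<psi> g" by auto
      have "{i. (i, t) \<in> \<psi> g} = g t" if "t < N" for t using that by (auto simp: \<psi>_def)
      then have "slot_counts N \<omega> = xs"
        using g by (auto simp: slot_counts_eq_iff[OF xs] attempts_in_slot_def PiE_iff)
      moreover have "\<omega> \<subseteq> I \<times> {..<N}" using g by (auto simp: \<psi>_def PiE_iff)
      ultimately show "\<omega> \<in> ?E" by simp
    qed
  qed
  then have "card ?E = card ?R" by (rule bij_betw_same_card)
  also have "\<dots> = (\<Prod>t<N. M choose (xs ! t))"
    using I by (simp add: card_PiE n_subsets)
  also have "\<dots> = (\<Prod>k\<in>#mset xs. M choose k)"
    by (rule prod_nth_eq_prod_mset[OF xs])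
  finally show ?thesis .
qed

lemma pmf_local_attempts:
  assumes q: "0 \<le> p / real N" "p / real N \<le> 1" and \<omega>: "\<omega> \<subseteq> participants b N \<times> {..<N}"
  shows "pmf (local_attempts b p N) \<omega> =
    (p / real N) ^ card \<omega> * (1 - p / real N) ^ (num_participants b N * N - card \<omega>)"
proof -
  let ?A = "participants b N \<times> {..<N}"
  let ?P = "Pi_pmf ?A False (\<lambda>_. bernoulli_pmf (p / real N))"
  have fin: "finite ?A" by (simp add: participants_def)
  have "pmf (local_attempts b p N) \<omega> = measure_pmf.prob ?P {X. {it \<in> ?A. X it} = \<omega>}"
    unfolding local_attempts_def pmf_map by (simp add: vimage_def)
  also have "\<dots> = measure_pmf.prob ?P {\<lambda>x. x \<in> \<omega>}"
  proof (rule measure_prob_cong_0)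
    fix X assume X: "X \<in> {X. {it \<in> ?A. X it} = \<omega>} - {\<lambda>x. x \<in> \<omega>}"
    show "pmf ?P X = 0"
    proof (rule ccontr)
      assume "pmf ?P X \<noteq> 0"
      then have "\<forall>x. x \<notin> ?A \<longrightarrow> \<not> X x" by (auto simp: pmf_Pi[OF fin] split: if_splits)
      then have "X = (\<lambda>x. x \<in> \<omega>)" using X by (auto simp: fun_eq_iff)
      then show False using X by simp
    qed
  qed (use \<omega> in auto)
  also have "\<dots> = pmf ?P (\<lambda>x. x \<in> \<omega>)" by (simp add: measure_pmf_single)
  also have "\<dots> = (\<Prod>x\<in>?A. pmf (bernoulli_pmf (p / real N)) (x \<in> \<omega>))"
    using \<omega> by (subst pmf_Pi[OF fin]) auto
  also have "\<dots> = (\<Prod>x\<in>?A. if x \<in> \<omega> then p / real N else 1 - p / real N)"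
    using q by (intro prod.cong refl) auto
  also have "\<dots> = (p / real N) ^ card \<omega> * (1 - p / real N) ^ card (?A - \<omega>)"
    using fin \<omega> by (simp add: prod.If_cases Int_absorb1 Diff_eq)
  also have "card (?A - \<omega>) = num_participants b N * N - card \<omega>"
    using \<omega> fin by (simp add: card_Diff_subset finite_subset[OF \<omega>] card_cartesian_product participants_eq)
  finally show ?thesis .
qed

lemma set_local_attempts: "set_pmf (local_attempts b p N) \<subseteq> Pow (participants b N \<times> {..<N})"
  by (auto simp: local_attempts_def)

lemma pmf_profile_local:
  assumes q: "0 \<le> p / real N" "p / real N \<le> 1" and m: "size m = N"
  shows "pmf (map_pmf (profile N) (local_attempts b p N)) m = arrangements m *
    (real (\<Prod>k\<in>#m. num_participants b N choose k) *
     ((p / real N) ^ sum_mset m * (1 - p / real N) ^ (num_participants b N * N - sum_mset m)))"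
proof (rule pmf_profile)
  fix xs assume xs: "mset xs = m"
  then have len: "length xs = N" using m by (metis size_mset)
  let ?E = "{\<omega>. \<omega> \<subseteq> participants b N \<times> {..<N} \<and> slot_counts N \<omega> = xs}"
  have fin: "finite (participants b N)" by (simp add: participants_def)
  have "measure_pmf.prob (local_attempts b p N) {\<omega>. slot_counts N \<omega> = xs} = real (card ?E) *
     ((p / real N) ^ sum_mset m * (1 - p / real N) ^ (num_participants b N * N - sum_mset m))"
  proof (rule prob_slot_counts)
    show "finite ?E" using fin by (intro finite_subset[of ?E "Pow (participants b N \<times> {..<N})"]) auto
    show "set_pmf (local_attempts b p N) \<inter> {\<omega>. slot_counts N \<omega> = xs} \<subseteq> ?E"
      using set_local_attempts[of b p N] by blast
    fix \<omega> assume \<omega>: "\<omega> \<in> ?E"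
    then have "card \<omega> = sum_mset m"
      using card_eq_sum_slots[of \<omega> "participants b N" N] fin sum_attempts_in_slot xs by auto
    then show "pmf (local_attempts b p N) \<omega> = 
      (p / real N) ^ sum_mset m * (1 - p / real N) ^ (num_participants b N * N - sum_mset m)"
      using pmf_local_attempts[OF q] \<omega> by simp
  qed auto
  also have "card ?E = (\<Prod>k\<in>#m. num_participants b N choose k)"
    using card_attempt_sets[OF fin refl len] by (simp add: xs participants_eq)
  finally show "measure_pmf.prob (local_attempts b p N) {\<omega>. slot_counts N \<omega> = xs} =
    real (\<Prod>k\<in>#m. num_participants b N choose k) *
     ((p / real N) ^ sum_mset m * (1 - p / real N) ^ (num_participants b N * N - sum_mset m))" .
qed

lemma count_mset_eq_card: "count (mset xs) x = card {i. i < length xs \<and> xs ! i = x}"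
  by (simp add: count_mset count_list_eq_length_filter length_filter_conv_card eq_commute)

text \<open>A single-valued set of attempts assigns to every participant a slot or nothing. As a word over
  \<open>nat option\<close> of length \<open>M\<close> it has prescribed letter counts, so the number is a multinomial coefficient.\<close>

lemma card_assignments:
  assumes n: "length n = N"
  shows "real (card {\<omega>. \<omega> \<subseteq> {..<M} \<times> {..<N} \<and> single_valued \<omega> \<and> slot_counts N \<omega> = n}) =
    (if sum_mset (mset n) \<le> M then fact M / (fact (M - sum_mset (mset n)) * (\<Prod>k\<in>#mset n. fact k)) else 0)"
    (is "real (card ?E) = _")
proof -
  define A where "A = sum_mset (mset n)"
  have A: "A = (\<Sum>t<N. n ! t)"
    using n by (simp add: A_def sum_mset_sum_list sum_list_sum_nth atLeast0LessThan)
  define \<phi> where "\<phi> xs = {(i, t). i < M \<and> xs ! i = Some t}" for xs :: "nat option list"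
  define X where "X = {xs. length xs = M \<and> set xs \<subseteq> insert None (Some ` {..<N}) \<and>
    (\<forall>t<N. count (mset xs) (Some t) = n ! t)}"
  have sl: "attempts_in_slot (\<phi> xs) t = count (mset xs) (Some t)" if "length xs = M" for xs t
    using that by (simp add: attempts_in_slot_def \<phi>_def count_mset_eq_card)
  have "bij_betw \<phi> X ?E"
  proof (rule bij_betwI')
    fix xs ys assume xy: "xs \<in> X" "ys \<in> X"
    show "\<phi> xs = \<phi> ys \<longleftrightarrow> xs = ys"
    proof
      assume eq: "\<phi> xs = \<phi> ys"
      have "xs ! i = ys ! i" if "i < M" for i
      proof -
        have *: "xs ! i = Some t \<longleftrightarrow> ys ! i = Some t" for t
          using eq that by (auto simp: \<phi>_def set_eq_iff)
        show ?thesis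
        proof (cases "xs ! i")
          case None
          then show ?thesis using * by (cases "ys ! i") auto
        next
          case (Some t)
          then show ?thesis using *[of t] by simp
        qed
      qed
      then show "xs = ys" using xy by (intro nth_equalityI) (auto simp: X_def)
    qed simp
  next
    fix xs assume "xs \<in> X"
    then have xs: "length xs = M" "set xs \<subseteq> insert None (Some ` {..<N})" "\<forall>t<N. count (mset xs) (Some t) = n ! t"
      by (auto simp: X_def)
    have "t < N" if "i < M" "xs ! i = Some t" for i t
      using xs(2) nth_mem[of i xs] that xs(1) by auto
    then have "\<phi> xs \<subseteq> {..<M} \<times> {..<N}" by (auto simp: \<phi>_def)
    moreover have "single_valued (\<phi> xs)" by (auto simp: \<phi>_def single_valued_def)
    ultimately show "\<phi> xs \<in> ?E" using xs sl[of xs] by (simp add: slot_counts_eq_iff[OF n])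
  next
    fix \<omega> assume \<omega>: "\<omega> \<in> ?E"
    define xs where "xs = map (\<lambda>i. if \<exists>t. (i, t) \<in> \<omega> then Some (THE t. (i, t) \<in> \<omega>) else None) [0..<M]"
    have the: "(THE t. (i, t) \<in> \<omega>) = t" if "(i, t) \<in> \<omega>" for i t
      using \<omega> that by (intro the_equality) (auto simp: single_valued_def)
    have nth: "xs ! i = Some t \<longleftrightarrow> (i, t) \<in> \<omega>" if "i < M" for i t
      using that the by (auto simp: xs_def)
    have len: "length xs = M" by (simp add: xs_def)
    have \<phi>: "\<phi> xs = \<omega>" using nth \<omega> by (auto simp: \<phi>_def)
    have "set xs \<subseteq> insert None (Some ` {..<N})"
      using \<omega> the by (auto simp: xs_def)
    moreover have "\<forall>t<N. count (mset xs) (Some t) = n ! t"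
      using sl[OF len] \<omega> by (simp add: \<phi> slot_counts_eq_iff[OF n])
    ultimately show "\<exists>xs\<in>X. \<omega> = \<phi> xs" using \<phi> len by (auto simp: X_def)
  qed
  then have card: "card ?E = card X" by (rule bij_betw_same_card[symmetric])
  let ?S = "insert None (Some ` {..<N})"
  have total_count: "count (mset xs) None + (\<Sum>t<N. count (mset xs) (Some t)) = length xs"
    if "set xs \<subseteq> ?S" for xs :: "nat option list"
  proof -
    have "length xs = (\<Sum>k\<in>set xs. count (mset xs) k)"
      unfolding size_mset[symmetric] size_multiset_overloaded_eq by (simp only: set_mset_mset)
    also have "\<dots> = (\<Sum>k\<in>?S. count (mset xs) k)"
      using that by (intro sum.mono_neutral_left) (auto simp: not_in_iff[symmetric] simp del: count_mset)
    also have "\<dots> = count (mset xs) None + (\<Sum>k\<in>Some ` {..<N}. count (mset xs) k)"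
      by (subst sum.insert) auto
    finally show ?thesis by (simp add: sum.reindex)
  qed
  show ?thesis
  proof (cases "A \<le> M")
    case False
    have "X = {}"
    proof (rule ccontr)
      assume "X \<noteq> {}"
      then obtain xs where "xs \<in> X" by auto
      with total_count[of xs] have "A \<le> M" by (auto simp: X_def A)
      with False show False by simp
    qed
    then show ?thesis using False by (simp add: card flip: A_def)
  next
    case True
    define mm where "mm = replicate_mset (M - A) None + (\<Sum>t<N. replicate_mset (n ! t) (Some t))"
    have c: "count mm None = M - A" "\<And>t. count mm (Some t) = (if t < N then n ! t else 0)"
      by (simp_all add: mm_def count_sum if_distrib cong: if_cong)
    have sub: "set_mset mm \<subseteq> ?S"
    proof
      fix y assume "y \<in># mm"
      then have "count mm y \<noteq> 0" by simp
      then show "y \<in> ?S" by (cases y) (use c(2) in \<open>auto split: if_splits simp del: count_eq_zero_iff\<close>)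
    qed
    have size: "size mm = M" using True by (simp add: mm_def size_multiset_sum A)
    have "X = permutations_of_multiset mm"
    proof (intro set_eqI iffI)
      fix xs assume "xs \<in> permutations_of_multiset mm"
      then have xs: "mset xs = mm" by (simp add: permutations_of_multiset_def)
      then have "length xs = M" "set xs \<subseteq> ?S" using size sub by (metis size_mset, metis set_mset_mset)
      then show "xs \<in> X" using c xs by (simp add: X_def)
    next
      fix xs assume "xs \<in> X"
      then have xs: "length xs = M" "set xs \<subseteq> ?S" "\<forall>t<N. count (mset xs) (Some t) = n ! t"
        by (auto simp: X_def)
      have None: "count (mset xs) None = M - A"
        using total_count[OF xs(2)] xs by (simp add: A)
      have "mset xs = mm"
      proof (rule multiset_eqI)
        fix y
        show "count (mset xs) y = count mm y"
        proof (cases y)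
          case (Some t)
          have "Some t \<notin># mset xs" if "\<not> t < N" using xs(2) that by auto
          then show ?thesis using Some c(2)[of t] xs(3) by (cases "t < N") (auto simp: not_in_iff simp del: count_mset)
        qed (use None c in simp)
      qed
      then show "xs \<in> permutations_of_multiset mm" by (simp add: permutations_of_multiset_def)
    qed
    then have "real (card X) = arrangements mm" by (simp add: arrangements_def)
    also have "\<dots> = fact M / (\<Prod>k\<in>set_mset mm. fact (count mm k))"
      by (simp add: arrangements_eq size)
    also have "(\<Prod>k\<in>set_mset mm. fact (count mm k) :: real) = (\<Prod>k\<in>?S. fact (count mm k))"
      using sub by (intro prod.mono_neutral_left) (auto simp: not_in_iff)
    also have "\<dots> = fact (M - A) * (\<Prod>k\<in>Some ` {..<N}. fact (count mm k))"
      by (subst prod.insert) (auto simp: c)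
    also have "(\<Prod>k\<in>Some ` {..<N}. fact (count mm k) :: real) = (\<Prod>t<N. fact (n ! t))"
      by (simp add: prod.reindex c)
    also have "\<dots> = (\<Prod>k\<in>#mset n. fact k)" by (rule prod_nth_eq_prod_mset[OF n])
    finally show ?thesis using True by (simp add: card flip: A_def)
  qed
qed

text \<open>An outcome determines both the set of active participants, as its domain, and their slots, so only
  one choice in each of the two stages contributes.\<close>

lemma pmf_global_attempts:
  assumes p: "0 \<le> p" "p \<le> 1" and N: "N > 0" and \<omega>: "\<omega> \<subseteq> participants b N \<times> {..<N}" "single_valued \<omega>"
  shows "pmf (global_attempts b p N) \<omega> =
    p ^ card \<omega> * (1 - p) ^ (num_participants b N - card \<omega>) / real N ^ card \<omega>"
proof -
  let ?I = "participants b N"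
  let ?D = "Domain \<omega>"
  let ?P = "Pi_pmf ?I False (\<lambda>_. bernoulli_pmf p)"
  define K where "K d = map_pmf (\<lambda>\<sigma>. {(i, \<sigma> i) | i. i \<in> ?I \<and> d i})
         (Pi_pmf {i \<in> ?I. d i} 0 (\<lambda>_. pmf_of_set {..<N}))" for d :: "nat \<Rightarrow> bool"
  define d0 where "d0 = (\<lambda>i. i \<in> ?D)"
  define \<sigma>0 where "\<sigma>0 = (\<lambda>i. if i \<in> ?D then THE t. (i, t) \<in> \<omega> else 0)"
  have fin: "finite ?I" by (simp add: participants_def)
  have D: "?D \<subseteq> ?I" using \<omega> by auto
  have finD: "finite ?D" using D fin by (rule finite_subset)
  have the: "(THE t. (i, t) \<in> \<omega>) = t" if "(i, t) \<in> \<omega>" for i t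
    using \<omega> that by (intro the_equality) (auto simp: single_valued_def)
  have \<omega>_eq: "\<omega> = (\<lambda>i. (i, \<sigma>0 i)) ` ?D"
    using the by (force simp: \<sigma>0_def)
  have card: "card \<omega> = card ?D"
    by (subst \<omega>_eq) (rule card_image, auto simp: inj_on_def)
  have "pmf (global_attempts b p N) \<omega> = measure_pmf.expectation ?P (\<lambda>d. pmf (K d) \<omega>)"
    by (simp add: global_attempts_def pmf_bind K_def)
  also have "\<dots> = (\<Sum>d\<in>{d0}. pmf (K d) \<omega> * pmf ?P d)"
  proof (rule integral_measure_pmf_real)
    fix d assume d: "d \<in> set_pmf ?P" and K: "pmf (K d) \<omega> \<noteq> 0"
    have "\<omega> \<in> set_pmf (K d)" using K by (simp add: set_pmf_iff)
    then have "?D = {i \<in> ?I. d i}" by (auto simp: K_def Domain_iff)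
    moreover have "\<not> d i" if "i \<notin> ?I" for i
      using d that set_Pi_pmf_subset[OF fin, of False "\<lambda>_. bernoulli_pmf p"] by blast
    ultimately show "d \<in> {d0}" by (auto simp: d0_def fun_eq_iff)
  qed simp
  also have "\<dots> = pmf (K d0) \<omega> * pmf ?P d0" by simp
  also have "pmf ?P d0 = (\<Prod>i\<in>?I. if i \<in> ?D then p else 1 - p)"
    using D p by (subst pmf_Pi[OF fin]) (auto simp: d0_def intro!: prod.cong)
  also have "\<dots> = p ^ card ?D * (1 - p) ^ card (?I - ?D)"
    using fin D by (simp add: prod.If_cases Int_absorb1 Diff_eq)
  also have "card (?I - ?D) = num_participants b N - card ?D"
    using D finD by (simp add: card_Diff_subset participants_eq)
  also have "pmf (K d0) \<omega> = (1 / real N) ^ card ?D"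
  proof -
    have I: "{i \<in> ?I. d0 i} = ?D" using D by (auto simp: d0_def)
    let ?Q = "Pi_pmf ?D 0 (\<lambda>_. pmf_of_set {..<N})"
    have "pmf (K d0) \<omega> = measure_pmf.prob ?Q {\<sigma>. {(i, \<sigma> i) | i. i \<in> ?I \<and> d0 i} = \<omega>}"
      unfolding K_def pmf_map I by (simp add: vimage_def)
    also have "{\<sigma>. {(i, \<sigma> i) | i. i \<in> ?I \<and> d0 i} = \<omega>} = {\<sigma>. \<forall>i\<in>?D. \<sigma> i = \<sigma>0 i}"
    proof (intro set_eqI iffI; unfold mem_Collect_eq)
      fix \<sigma> assume eq: "{(i, \<sigma> i) | i. i \<in> ?I \<and> d0 i} = \<omega>"
      show "\<forall>i\<in>?D. \<sigma> i = \<sigma>0 i"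
      proof
        fix i assume i: "i \<in> ?D"
        then obtain t where t: "(i, t) \<in> \<omega>" by auto
        then have "(i, t) \<in> {(i, \<sigma> i) | i. i \<in> ?I \<and> d0 i}" using eq by simp
        then have "t = \<sigma> i" by auto
        then show "\<sigma> i = \<sigma>0 i" using i the[OF t] by (simp add: \<sigma>0_def)
      qed
    next
      fix \<sigma> assume \<sigma>: "\<forall>i\<in>?D. \<sigma> i = \<sigma>0 i"
      have "{(i, \<sigma> i) | i. i \<in> ?I \<and> d0 i} = (\<lambda>i. (i, \<sigma> i)) ` ?D" unfolding I[symmetric] by auto
      also have "\<dots> = (\<lambda>i. (i, \<sigma>0 i)) ` ?D" using \<sigma> by (intro image_cong) auto
      finally show "{(i, \<sigma> i) | i. i \<in> ?I \<and> d0 i} = \<omega>" using \<omega>_eq by simp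
    qed
    also have "measure_pmf.prob ?Q {\<sigma>. \<forall>i\<in>?D. \<sigma> i = \<sigma>0 i} = measure_pmf.prob ?Q {\<sigma>0}"
    proof (rule measure_prob_cong_0)
      fix \<sigma> assume \<sigma>: "\<sigma> \<in> {\<sigma>. \<forall>i\<in>?D. \<sigma> i = \<sigma>0 i} - {\<sigma>0}"
      show "pmf ?Q \<sigma> = 0"
      proof (rule ccontr)
        assume "pmf ?Q \<sigma> \<noteq> 0"
        then have "\<forall>i. i \<notin> ?D \<longrightarrow> \<sigma> i = 0" by (auto simp: pmf_Pi[OF finD] split: if_splits)
        with \<sigma> have "\<sigma> = \<sigma>0" by (auto simp: fun_eq_iff \<sigma>0_def)
        with \<sigma> show False by simp
      qed
    qed auto
    also have "\<dots> = pmf ?Q \<sigma>0" by (simp add: measure_pmf_single)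
    also have "\<dots> = (\<Prod>i\<in>?D. pmf (pmf_of_set {..<N}) (\<sigma>0 i))"
      by (subst pmf_Pi[OF finD]) (auto simp: \<sigma>0_def)
    also have "\<dots> = (\<Prod>i\<in>?D. 1 / real N)"
    proof (rule prod.cong[OF refl])
      fix i assume "i \<in> ?D"
      then have "\<sigma>0 i < N" using \<omega>_eq \<omega>(1) by blast
      then show "pmf (pmf_of_set {..<N}) (\<sigma>0 i) = 1 / real N"
        using N by (subst pmf_of_set) auto
    qed
    finally show ?thesis by simp
  qed
  finally show ?thesis by (simp add: card power_divide)
qed

lemma set_global_attempts:
  assumes "N > 0"
  shows "set_pmf (global_attempts b p N) \<subseteq> {\<omega>. \<omega> \<subseteq> participants b N \<times> {..<N} \<and> single_valued \<omega>}"
proof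
  fix \<omega> assume "\<omega> \<in> set_pmf (global_attempts b p N)"
  then obtain d \<sigma> where \<sigma>: "\<omega> = {(i, \<sigma> i) | i. i \<in> participants b N \<and> d i}"
    "\<sigma> \<in> set_pmf (Pi_pmf {i \<in> participants b N. d i} 0 (\<lambda>_. pmf_of_set {..<N}))"
    by (auto simp: global_attempts_def)
  have "\<sigma> i < N" if "i \<in> participants b N" "d i" for i
  proof -
    have "\<sigma> \<in> PiE_dflt {i \<in> participants b N. d i} 0 (set_pmf \<circ> (\<lambda>_. pmf_of_set {..<N}))"
      by (rule subsetD[OF set_Pi_pmf_subset' \<sigma>(2)]) (simp add: participants_def)
    moreover have "set_pmf (pmf_of_set {..<N}) = {..<N}" using assms by (intro set_pmf_of_set) auto
    ultimately show ?thesis using that by (auto simp: PiE_dflt_def)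
  qed
  then show "\<omega> \<in> {\<omega>. \<omega> \<subseteq> participants b N \<times> {..<N} \<and> single_valued \<omega>}"
    by (auto simp: \<sigma>(1) single_valued_def)
qed

lemma pmf_profile_global:
  fixes b p :: real and N :: nat
  assumes p: "0 \<le> p" "p \<le> 1" and N: "N > 0" and m: "size m = N"
  defines "M \<equiv> num_participants b N" and "A \<equiv> sum_mset m"
  shows "pmf (map_pmf (profile N) (global_attempts b p N)) m = arrangements m *
    ((if A \<le> M then fact M / (fact (M - A) * (\<Prod>k\<in>#m. fact k)) else 0) *
     (p ^ A * (1 - p) ^ (M - A) / real N ^ A))"
proof (rule pmf_profile)
  fix xs assume xs: "mset xs = m"
  then have len: "length xs = N" using m by (metis size_mset)
  let ?E = "{\<omega>. \<omega> \<subseteq> participants b N \<times> {..<N} \<and> single_valued \<omega> \<and> slot_counts N \<omega> = xs}"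
  have fin: "finite (participants b N)" by (simp add: participants_def)
  have "measure_pmf.prob (global_attempts b p N) {\<omega>. slot_counts N \<omega> = xs} = real (card ?E) *
     (p ^ A * (1 - p) ^ (M - A) / real N ^ A)"
  proof (rule prob_slot_counts)
    show "finite ?E" using fin by (intro finite_subset[of ?E "Pow (participants b N \<times> {..<N})"]) auto
    show "set_pmf (global_attempts b p N) \<inter> {\<omega>. slot_counts N \<omega> = xs} \<subseteq> ?E"
      using set_global_attempts[OF N, of b p] by blast
    fix \<omega> assume \<omega>: "\<omega> \<in> ?E"
    then have "card \<omega> = A"
      using card_eq_sum_slots[of \<omega> "participants b N" N] fin sum_attempts_in_slot xs by (auto simp: A_def)
    then show "pmf (global_attempts b p N) \<omega> = p ^ A * (1 - p) ^ (M - A) / real N ^ A"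
      using pmf_global_attempts[OF p N] \<omega> by (simp add: M_def)
  qed auto
  then show "measure_pmf.prob (global_attempts b p N) {\<omega>. slot_counts N \<omega> = xs} =
    (if A \<le> M then fact M / (fact (M - A) * (\<Prod>k\<in>#m. fact k)) else 0) *
     (p ^ A * (1 - p) ^ (M - A) / real N ^ A)"
    using card_assignments[OF len, of M] by (simp add: xs participants_eq A_def M_def)
qed

section \<open>Comparison with independent Poisson slots\<close>

lemma prod_poisson:
  assumes "\<beta> > 0"
  shows "(\<Prod>k\<in>#m. pmf (poisson_pmf \<beta>) k) =
    \<beta> ^ sum_mset m / (\<Prod>k\<in>#m. fact k) * exp (- \<beta> * real (size m))"
proof (induction m)
  case (add k m)
  have "exp (- \<beta> * real (size (add_mset k m))) = exp (- \<beta>) * exp (- \<beta> * real (size m))"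
    unfolding exp_add[symmetric] by (simp add: algebra_simps)
  then show ?case
    using assms add by (simp add: power_add)
qed simp

lemma num_participants_le: "b \<ge> 0 \<Longrightarrow> real (num_participants b N) \<le> b * real N"
  by (simp add: num_participants_def)

lemma num_participants_gt: "real (num_participants b N) > b * real N - 1"
  unfolding num_participants_def by linarith

lemma num_participants_over_tendsto:
  "b \<ge> 0 \<Longrightarrow> (\<lambda>N. real (num_participants b N) / real N) \<longlonglongrightarrow> b"
  unfolding num_participants_def by (rule floor_mult_over_tendsto)

text \<open>The profile carries all that the triple depends on, so the large deviations are studied for its law.\<close>

definition profile_pmf :: "access_rule \<Rightarrow> real \<Rightarrow> real \<Rightarrow> nat \<Rightarrow> nat multiset pmf" where
  "profile_pmf D b p N = map_pmf (profile N) (access_pmf D b p N)"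

abbreviation (input) poisson_weight :: "real \<Rightarrow> nat multiset \<Rightarrow> real" where
  "poisson_weight \<beta> m \<equiv> arrangements m * (\<Prod>k\<in>#m. pmf (poisson_pmf \<beta>) k)"

lemma poisson_weight_pos: "\<beta> > 0 \<Longrightarrow> poisson_weight \<beta> m > 0"
  by (intro mult_pos_pos arrangements_pos prod_mset_pos) auto

text \<open>A rearrangement stated for rewriting in products where simplification would cancel \<open>p / N\<close> against \<open>N\<close>.\<close>

lemma power_mult_div_split: "(x * y) ^ n / F * z = x ^ n / F * (y ^ n * z)" for x y F z :: real
  by (simp add: power_mult_distrib)

lemma prod_mset_choose_le:
  "real (\<Prod>k\<in>#m. M choose k) \<le> real M ^ sum_mset m / (\<Prod>k\<in>#m. fact k)"
proof (induction m)
  case (add k m)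
  have "real ((M choose k) * fact k) \<le> real (M ^ k)"
    using binomial_fact_pow[of M k] by (simp only: of_nat_le_iff)
  then have "real (M choose k) \<le> real M ^ k / fact k" by (simp add: pos_le_divide_eq)
  then have "real (M choose k) * real (\<Prod>k\<in>#m. M choose k) \<le>
     real M ^ k / fact k * (real M ^ sum_mset m / (\<Prod>k\<in>#m. fact k))"
    using add by (intro mult_mono) auto
  then show ?case by (simp add: power_add)
qed simp

text \<open>Each of the \<open>k \<le> K\<close> factors of the falling factorial \<open>M (M - 1) \<dots>\<close> is at least \<open>M - K\<close>.\<close>

lemma prod_mset_choose_ge:
  assumes "set_mset m \<subseteq> {..K}" "K \<le> M"
  shows "real (\<Prod>k\<in>#m. M choose k) \<ge> real (M - K) ^ sum_mset m / (\<Prod>k\<in>#m. fact k)"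
  using assms(1)
proof (induction m)
  case (add k m)
  then have k: "k \<le> K" by simp
  have "real (M - K) ^ k = (\<Prod>i<k. real (M - K))" by simp
  also have "\<dots> \<le> (\<Prod>i<k. real M - real i)"
    using k assms(2) by (intro prod_mono) auto
  also have "\<dots> = real (M choose k) * fact k"
    by (simp add: binomial_gbinomial gbinomial_prod_rev atLeast0LessThan)
  finally have "real (M - K) ^ k / fact k \<le> real (M choose k)" by (simp add: field_simps)
  moreover have "real (M - K) ^ sum_mset m / (\<Prod>k\<in>#m. fact k) \<le> real (\<Prod>k\<in>#m. M choose k)"
    using add by simp
  moreover have "0 < (\<Prod>k\<in>#m. fact k :: real)" by (intro prod_mset_pos) auto
  ultimately have "real (M - K) ^ k / fact k * (real (M - K) ^ sum_mset m / (\<Prod>k\<in>#m. fact k)) \<le>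
      real (M choose k) * real (\<Prod>k\<in>#m. M choose k)"
    by (intro mult_mono) (auto intro: less_imp_le)
  then show ?case by (simp add: power_add)
qed simp

text \<open>The binomial weights of a slot are dominated by Poisson weights up to the normalization, and the
  normalization \<open>(1 - p / N) ^ (M N - A)\<close> exceeds \<open>exp (- b p N)\<close> by at most a constant factor as long as there
  are at most \<open>b N\<close> attempts.\<close>

lemma local_profile_upper:
  assumes b: "b > 0" and p: "p > 0" and N: "N > 0" "p \<le> real N"
    and m: "size m = N" "real (sum_mset m) \<le> b * real N"
  shows "pmf (profile_pmf Local b p N) m \<le> exp (p + p * b) * poisson_weight (b * p) m"
proof -
  let ?M = "num_participants b N" and ?A = "sum_mset m" and ?q = "p / real N"
  let ?F = "\<Prod>k\<in>#m. fact k :: real"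
  have F: "?F > 0" by (intro prod_mset_pos) auto
  have q: "0 \<le> ?q" "?q \<le> 1" using p N by auto
  define j where "j = ?M * N - ?A"
  have "(1 - ?q) ^ j \<le> exp (- ?q) ^ j"
    using q exp_ge_add_one_self[of "- ?q"] by (intro power_mono) auto
  also have "\<dots> = exp (- (?q * real j))" by (simp add: mult.commute flip: exp_of_nat_mult)
  also have "\<dots> \<le> exp (p + p * b - p * (b * real N))"
  proof -
    have "real j \<ge> real (?M * N) - real ?A" unfolding j_def by linarith
    then have "real j \<ge> real ?M * real N - real ?A" by (simp only: of_nat_mult)
    then have "real j \<ge> (b * real N - 1) * real N - b * real N"
      using num_participants_gt[of b N] m(2) mult_right_mono[of "b * real N - 1" "real ?M" "real N"] by simp
    then have "?q * real j \<ge> ?q * ((b * real N - 1) * real N - b * real N)"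
      using q by (intro mult_left_mono)
    also have "?q * ((b * real N - 1) * real N - b * real N) = p * (b * real N) - p - p * b"
      using N by (simp add: field_simps)
    finally show ?thesis by simp
  qed
  finally have e: "(1 - ?q) ^ j \<le> exp (p + p * b - p * (b * real N))" .
  have "pmf (profile_pmf Local b p N) m =
    arrangements m * (real (\<Prod>k\<in>#m. ?M choose k) * (?q ^ ?A * (1 - ?q) ^ j))"
    using pmf_profile_local[OF q m(1), of b] by (simp add: profile_pmf_def j_def)
  also have "\<dots> \<le> arrangements m * (real ?M ^ ?A / ?F * (?q ^ ?A * exp (p + p * b - p * (b * real N))))"
    using q e F prod_mset_choose_le[of ?M m] arrangements_pos[of m]
    by (intro mult_left_mono mult_mono) (auto intro: less_imp_le)
  also have "\<dots> \<le> arrangements m * ((b * real N) ^ ?A / ?F * (?q ^ ?A * exp (p + p * b - p * (b * real N))))"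
    using q F num_participants_le[of b N] b arrangements_pos[of m]
    by (intro mult_left_mono mult_right_mono divide_right_mono power_mono) (auto intro: less_imp_le)
  also have "\<dots> = arrangements m * (((b * real N) * ?q) ^ ?A / ?F * exp (p + p * b - p * (b * real N)))"
    by (simp only: power_mult_div_split)
  also have "(b * real N) * ?q = b * p" using N by simp
  also have "exp (p + p * b - p * (b * real N)) = exp (p + p * b) * exp (- (b * p) * real (size m))"
    unfolding m(1) exp_add[symmetric] by (rule arg_cong[of _ _ exp]) (simp add: algebra_simps)
  finally have "pmf (profile_pmf Local b p N) m \<le>
    arrangements m * ((b * p) ^ ?A / ?F * (exp (p + p * b) * exp (- (b * p) * real (size m))))" .
  also have "\<dots> = exp (p + p * b) * poisson_weight (b * p) m"
    unfolding prod_poisson[OF mult_pos_pos[OF b p]] by (simp only: divide_inverse mult_ac)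
  finally show ?thesis .
qed

text \<open>If at most \<open>K\<close> attempts share a slot, the binomial weights exceed the Poisson weights times
  \<open>u ^ A\<close> with \<open>u = (M - K) / (b N)\<close>, which is not exponentially small because \<open>u\<close> tends to 1 and \<open>A \<le> b N\<close>.\<close>

lemma local_profile_lower:
  fixes m :: "nat \<Rightarrow> nat multiset"
  assumes b: "b > 0" and p: "p > 0" and \<delta>: "\<delta> > 0"
    and m: "eventually (\<lambda>N. size (m N) = N \<and> set_mset (m N) \<subseteq> {..K} \<and> real (sum_mset (m N)) \<le> b * real N) sequentially"
  shows "eventually (\<lambda>N. pmf (profile_pmf Local b p N) (m N) \<ge>
    exp (- real N * \<delta>) * poisson_weight (b * p) (m N)) sequentially"
proof -
  let ?M = "num_participants b"
  define u where "u N = real (?M N - K) / (b * real N)" for N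
  have M: "(\<lambda>N. real (?M N) / real N) \<longlonglongrightarrow> b" using b by (intro num_participants_over_tendsto) auto
  have ev_M: "eventually (\<lambda>N. ?M N > K) sequentially"
  proof -
    have "eventually (\<lambda>N. b * real N - 1 \<ge> real K) sequentially" using b by real_asymp
    then show ?thesis
    proof eventually_elim
      case (elim N)
      then show ?case using num_participants_gt[of b N] by linarith
    qed
  qed
  have u: "u \<longlonglongrightarrow> 1"
  proof -
    have "(\<lambda>N. real (?M N) / real N / b - real K * (1 / real N) / b) \<longlonglongrightarrow> b / b - real K * 0 / b"
      using b by (intro tendsto_intros M lim_1_over_n) auto
    then have "(\<lambda>N. real (?M N) / real N / b - real K * (1 / real N) / b) \<longlonglongrightarrow> 1" using b by simp
    moreover have "eventually (\<lambda>N. real (?M N) / real N / b - real K * (1 / real N) / b = u N) sequentially"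
      using ev_M by eventually_elim (simp add: u_def of_nat_diff diff_divide_distrib mult.commute)
    ultimately show ?thesis using Lim_transform_eventually by fast
  qed
  have "(\<lambda>N. real N * ln (1 - p / real N)) \<longlonglongrightarrow> - p" using p by real_asymp
  then have "(\<lambda>N. b * p + b * ln (u N) + b * (real N * ln (1 - p / real N))) \<longlonglongrightarrow> b * p + b * ln 1 + b * (- p)"
    by (intro tendsto_intros u) auto
  then have "eventually (\<lambda>N. b * p + b * ln (u N) + b * (real N * ln (1 - p / real N)) > - \<delta>) sequentially"
    using \<delta> by (intro order_tendstoD(1)) auto
  moreover have "eventually (\<lambda>N. p < real N) sequentially" by real_asymp
  ultimately show ?thesis
    using m ev_M eventually_gt_at_top[of 0]
  proof eventually_elim
    case (elim N)
    let ?A = "sum_mset (m N)" and ?q = "p / real N"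
    let ?F = "\<Prod>k\<in>#m N. fact k :: real"
    have F: "?F > 0" by (intro prod_mset_pos) auto
    have q: "0 \<le> ?q" "?q < 1" "real N \<noteq> p" using p elim by auto
    have A: "real ?A \<le> b * real N" using elim by simp
    have uN: "0 < u N" "u N \<le> 1"
      using elim b num_participants_le[of b N] by (auto simp: u_def divide_le_eq_1)
    define j where "j = ?M N * N - ?A"
    have jle: "real j \<le> b * real N * real N"
    proof -
      have "real j \<le> real (?M N * N)" unfolding j_def of_nat_le_iff by (rule diff_le_self)
      also have "\<dots> \<le> b * real N * real N" using num_participants_le[of b N] b by (simp add: mult_right_mono)
      finally show ?thesis .
    qed
    have "- real N * \<delta> \<le> real N * (b * p + b * ln (u N) + b * (real N * ln (1 - ?q)))"
      using mult_left_mono[of "-\<delta>" "b * p + b * ln (u N) + b * (real N * ln (1 - ?q))" "real N"] elim by simp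
    also have "\<dots> = b * p * real N + (b * real N) * ln (u N) + (b * real N * real N) * ln (1 - ?q)"
      by (simp add: algebra_simps)
    also have "\<dots> \<le> b * p * real N + real ?A * ln (u N) + real j * ln (1 - ?q)"
      using A jle uN q by (intro add_mono mult_right_mono_neg order_refl) auto
    also have "\<dots> = ln (exp (b * p * real N) * (u N ^ ?A * (1 - ?q) ^ j))"
      using uN q by (simp add: ln_mult ln_realpow)
    finally have "exp (- real N * \<delta>) \<le> exp (b * p * real N) * (u N ^ ?A * (1 - ?q) ^ j)"
      using uN q by (subst (asm) ln_ge_iff) (auto intro!: mult_pos_pos)
    then have "exp (- real N * \<delta>) * poisson_weight (b * p) (m N) \<le>
      (exp (b * p * real N) * (u N ^ ?A * (1 - ?q) ^ j)) * poisson_weight (b * p) (m N)"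
      using poisson_weight_pos[of "b * p" "m N"] b p by (intro mult_right_mono) auto
    also have "\<dots> = arrangements (m N) * ((b * p * u N) ^ ?A / ?F * (1 - ?q) ^ j)"
      using b p elim by (subst prod_poisson) (auto simp: power_mult_distrib mult_ac exp_minus field_simps)
    also have "b * p * u N = real (?M N - K) * ?q" using b elim by (simp add: u_def)
    also have "arrangements (m N) * ((real (?M N - K) * ?q) ^ ?A / ?F * (1 - ?q) ^ j) =
      arrangements (m N) * (real (?M N - K) ^ ?A / ?F * (?q ^ ?A * (1 - ?q) ^ j))"
      by (simp only: power_mult_div_split)
    also have "\<dots> \<le> arrangements (m N) * (real (\<Prod>k\<in>#m N. ?M N choose k) * (?q ^ ?A * (1 - ?q) ^ j))"
      using q elim arrangements_pos[of "m N"] prod_mset_choose_ge[of "m N" K "?M N"]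
      by (intro mult_left_mono mult_right_mono) (auto intro: less_imp_le)
    also have "\<dots> = pmf (profile_pmf Local b p N) (m N)"
      using pmf_profile_local[of p N "m N" b] q elim by (simp add: profile_pmf_def j_def)
    finally show ?case .
  qed
qed

text \<open>The difference of the rate functions for the two rules, as a real number. At \<open>a = b\<close> the first summand
  is 0, which is the intended value also for \<open>p = 1\<close>; for \<open>p = 1\<close> and \<open>a \<noteq> b\<close>, where the
  rate is infinite, the value carries no meaning.\<close>

definition global_cost :: "real \<Rightarrow> real \<Rightarrow> real \<Rightarrow> real" where
  "global_cost b p a = (b - a) * ln ((1 - a / b) / (1 - p)) + a - b * p"

text \<open>The likelihood ratio of the global rule to independent Poisson slots. It depends on the outcome only
  through the number \<open>A\<close> of attempts.\<close>

definition global_ratio :: "real \<Rightarrow> real \<Rightarrow> nat \<Rightarrow> nat \<Rightarrow> real" where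
  "global_ratio b p N A = exp (b * p * real N) * (fact (num_participants b N) / fact (num_participants b N - A)
     / (b * real N) ^ A * (1 - p) ^ (num_participants b N - A))"

lemma pmf_global_ratio:
  assumes b: "b > 0" and p: "0 < p" "p \<le> 1" and N: "N > 0" and m: "size m = N"
  shows "pmf (profile_pmf Global b p N) m =
    (if sum_mset m \<le> num_participants b N then global_ratio b p N (sum_mset m) * poisson_weight (b * p) m else 0)"
proof -
  let ?M = "num_participants b N" and ?A = "sum_mset m" and ?F = "\<Prod>k\<in>#m. fact k :: real"
  have F: "?F > 0" by (intro prod_mset_pos) auto
  have pmf: "pmf (profile_pmf Global b p N) m = arrangements m *
    ((if ?A \<le> ?M then fact ?M / (fact (?M - ?A) * ?F) else 0) * (p ^ ?A * (1 - p) ^ (?M - ?A) / real N ^ ?A))"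
    using pmf_profile_global[of p N m b] p N m by (simp add: profile_pmf_def)
  have "global_ratio b p N ?A * poisson_weight (b * p) m =
    arrangements m * (fact ?M / (fact (?M - ?A) * ?F) * (p ^ ?A * (1 - p) ^ (?M - ?A) / real N ^ ?A)) *
    (exp (b * p * real N) * exp (- (b * p) * real N))"
    using b p F N by (subst prod_poisson) (simp_all add: m global_ratio_def power_mult_distrib mult_ac)
  also have "exp (b * p * real N) * exp (- (b * p) * real N) = 1" by (simp flip: exp_add)
  finally show ?thesis by (simp add: pmf)
qed

lemma ln_global_ratio:
  assumes b: "b > 0" and N: "N > 0" and A: "A \<le> num_participants b N"
    and p: "p < 1 \<or> A = num_participants b N"
  shows "global_ratio b p N A > 0"
   "ln (global_ratio b p N A) = b * p * real N + ln (fact (num_participants b N)) - ln (fact (num_participants b N - A))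
     - real A * ln (b * real N) + (real (num_participants b N) - real A) * ln (1 - p)"
proof -
  have pos: "(1 - p) ^ (num_participants b N - A) > 0" using p by auto
  have l: "ln ((1 - p) ^ (num_participants b N - A)) = (real (num_participants b N) - real A) * ln (1 - p)"
    using p A by (auto simp: ln_realpow of_nat_diff)
  show "global_ratio b p N A > 0" using b N pos by (simp add: global_ratio_def)
  show "ln (global_ratio b p N A) = b * p * real N + ln (fact (num_participants b N)) - ln (fact (num_participants b N - A))
     - real A * ln (b * real N) + (real (num_participants b N) - real A) * ln (1 - p)"
  proof -
    define w where "w = (1 - p) ^ (num_participants b N - A)"
    define h where "h = (b * real N) ^ A"
    have w: "w > 0" using pos by (simp add: w_def)
    have h: "h > 0" using b N by (simp add: h_def)
    have "ln (global_ratio b p N A) = ln (exp (b * p * real N) * (fact (num_participants b N) / fact (num_participants b N - A) / h * w))"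
      by (simp add: global_ratio_def w_def h_def)
    also have "\<dots> = b * p * real N + (ln (fact (num_participants b N)) - ln (fact (num_participants b N - A)) - ln h + ln w)"
      using w h by (simp add: ln_mult ln_div)
    also have "ln h = real A * ln (b * real N)"
      using b N unfolding h_def by (subst ln_realpow) auto
    finally show ?thesis using l by (simp add: w_def)
  qed
qed

text \<open>Instead of Stirling's formula for \<open>M! / (M - A)!\<close>, which would be imprecise for \<open>A\<close> near \<open>M\<close>, the proof
  writes this quotient as \<open>(M choose A) A!\<close> and bounds the binomial coefficient by one term of
  \<open>(x + (1 - x)) ^ M = 1\<close> with \<open>x = A / (b N)\<close>. The bound is then uniform in \<open>A\<close>.\<close>

lemma global_ratio_upper:
  assumes b: "b > 0" and p: "0 < p" "p < 1" and N: "N > 0" and A: "A \<le> num_participants b N"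
  shows "global_ratio b p N A \<le> exp (1 - ln (1 - p)) * (b * real N + 1) * exp (- real N * global_cost b p (real A / real N))"
proof -
  let ?M = "num_participants b N"
  define x where "x = real A / (b * real N)"
  have AM: "real A \<le> b * real N" using A num_participants_le[of b N] b by linarith
  have bN: "b * real N > 0" using b N by simp
  have x: "0 \<le> x" "x \<le> 1" using AM bN by (auto simp: x_def)
  have gap: "ln (fact A) - real A * ln (real A) + real A \<le> 1 + ln (real A + 1)"
    using ln_fact_le[of A] succ_ln_succ_gap[of A] by (simp add: add.commute)
  have ch: "ln (fact ?M) - ln (fact (?M - A)) = ln (real (?M choose A)) + ln (fact A)"
  proof -
    have "fact ?M = real (?M choose A) * fact A * fact (?M - A)"
    proof -
      have "real (fact A * fact (?M - A) * (?M choose A)) = real (fact ?M)"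
        by (simp only: binomial_fact_lemma[OF A])
      then show ?thesis by (simp add: mult_ac)
    qed
    then show ?thesis using A by (simp add: ln_mult)
  qed
  have main: "ln (global_ratio b p N A) + real N * global_cost b p (real A / real N) \<le> 1 - ln (1 - p) + ln (real A + 1)"
  proof (cases "x = 1")
    case True
    then have Ab: "real A = b * real N" using bN by (simp add: x_def)
    have MA: "?M = A" using Ab A num_participants_le[of b N] b by simp
    have "ln (global_ratio b p N A) = b * p * real N + ln (fact A) - real A * ln (real A)"
      using ln_global_ratio(2)[OF b N A] p unfolding MA by (simp add: Ab)
    moreover have "real N * global_cost b p (real A / real N) = real A - b * p * real N"
    proof -
      have "real A / real N = b" using Ab N by simp
      then show ?thesis using Ab by (simp add: global_cost_def algebra_simps)
    qed
    moreover have "ln (1 - p) \<le> 0" using p by simp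
    ultimately show ?thesis using gap by linarith
  next
    case False
    then have x1: "x < 1" using x by simp
    define \<Lambda> where "\<Lambda> = ln ((1 - x) / (1 - p))"
    have \<Lambda>: "\<Lambda> = ln (1 - x) - ln (1 - p)" using x1 p by (simp add: \<Lambda>_def ln_div)
    have Nc: "real N * global_cost b p (real A / real N) = (b * real N - real A) * \<Lambda> + real A - b * p * real N"
    proof -
      have xx: "real A / real N / b = x" by (simp add: x_def mult.commute)
      have c: "real N * (b - real A / real N) = b * real N - real A" using N by (simp add: field_simps)
      have "real N * global_cost b p (real A / real N) =
        real N * (b - real A / real N) * \<Lambda> + real N * (real A / real N) - real N * (b * p)"
        unfolding global_cost_def xx \<Lambda>_def[symmetric] by (simp only: distrib_left right_diff_distrib left_diff_distrib mult.assoc)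
      moreover have "real N * (real A / real N) = real A" "real N * (b * p) = b * p * real N" using N by simp_all
      ultimately show ?thesis unfolding c by (simp only:)
    qed
    have binom: "ln (real (?M choose A)) + real A * ln x + (real ?M - real A) * ln (1 - x) \<le> 0"
    proof (cases "A = 0")
      case True
      then show ?thesis by (simp add: x_def)
    next
      case False
      then have x0: "x > 0" using bN by (simp add: x_def)
      have "real (?M choose A) * x ^ A * (1 - x) ^ (?M - A) \<le> (\<Sum>k\<le>?M. real (?M choose k) * x ^ k * (1 - x) ^ (?M - k))"
        using x A by (intro member_le_sum) auto
      also have "\<dots> = (x + (1 - x)) ^ ?M" by (rule binomial_ring[symmetric])
      finally have "real (?M choose A) * x ^ A * (1 - x) ^ (?M - A) \<le> 1" by simp
      moreover have "real (?M choose A) * x ^ A * (1 - x) ^ (?M - A) > 0" using x0 x1 A by simp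
      ultimately have "ln (real (?M choose A) * x ^ A * (1 - x) ^ (?M - A)) \<le> 0" by simp
      then show ?thesis using x0 x1 A by (simp add: ln_mult ln_realpow of_nat_diff)
    qed
    have Ax: "real A * ln x + real A * ln (b * real N) = real A * ln (real A)"
      using bN b N by (cases "A = 0") (simp_all add: x_def ln_div algebra_simps)
    have "ln (global_ratio b p N A) \<le> b * p * real N - (real ?M - real A) * \<Lambda> + (ln (fact A) - real A * ln (real A))"
    proof -
      have "(real ?M - real A) * \<Lambda> = (real ?M - real A) * ln (1 - x) - (real ?M - real A) * ln (1 - p)"
        by (simp add: \<Lambda> right_diff_distrib)
      then show ?thesis
        using ln_global_ratio(2)[OF b N A disjI1[OF p(2)]] ch binom Ax by linarith
    qed
    also have "\<dots> \<le> b * p * real N - (real ?M - real A) * \<Lambda> + (1 + ln (real A + 1) - real A)"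
      using gap by simp
    finally have "ln (global_ratio b p N A) + real N * global_cost b p (real A / real N) \<le>
       1 + ln (real A + 1) + (b * real N - real ?M) * \<Lambda>"
      unfolding Nc by (simp add: algebra_simps)
    also have "(b * real N - real ?M) * \<Lambda> \<le> (b * real N - real ?M) * (- ln (1 - p))"
      using num_participants_le[of b N] b x x1 by (intro mult_left_mono) (auto simp: \<Lambda>)
    also have "\<dots> \<le> 1 * (- ln (1 - p))"
      using num_participants_gt[of b N] p by (intro mult_right_mono) auto
    finally show ?thesis by simp
  qed
  have "ln (global_ratio b p N A) \<le> (1 - ln (1 - p)) + ln (real A + 1) - real N * global_cost b p (real A / real N)"
    using main by simp
  also have "\<dots> \<le> (1 - ln (1 - p)) + ln (b * real N + 1) - real N * global_cost b p (real A / real N)"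
    using AM bN by simp
  finally have "exp (ln (global_ratio b p N A)) \<le> exp ((1 - ln (1 - p)) + ln (b * real N + 1) - real N * global_cost b p (real A / real N))"
    by simp
  also have "\<dots> = exp (1 - ln (1 - p)) * (b * real N + 1) * exp (- real N * global_cost b p (real A / real N))"
    using bN by (simp add: exp_add exp_diff exp_minus field_simps)
  finally show ?thesis using ln_global_ratio(1)[OF b N A] p by simp
qed

text \<open>For \<open>p = 1\<close> all participants are active. The number of attempts is then \<open>M\<close>, which may be smaller than
  \<open>b N\<close>, but by less than one.\<close>

lemma global_ratio_upper_full:
  assumes b: "b > 0" and N: "N > 0"
  shows "global_ratio b 1 N (num_participants b N) \<le> exp 2 * (b * real N + 1)"
proof -
  let ?M = "num_participants b N"
  have AM: "real ?M \<le> b * real N" using num_participants_le[of b N] b by linarith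
  have bN: "b * real N > 0" using b N by simp
  have gap: "ln (fact ?M) - real ?M * ln (real ?M) + real ?M \<le> 1 + ln (real ?M + 1)"
    using ln_fact_le[of ?M] succ_ln_succ_gap[of ?M] by (simp add: add.commute)
  have "real ?M * ln (real ?M) \<le> real ?M * ln (b * real N)"
    using AM bN by (cases "?M = 0") (auto intro!: mult_left_mono)
  then have "ln (global_ratio b 1 N ?M) \<le> b * real N - real ?M + 1 + ln (real ?M + 1)"
    using ln_global_ratio(2)[OF b N order_refl, of 1] gap by simp
  also have "\<dots> \<le> 2 + ln (b * real N + 1)"
  proof -
    have "ln (real ?M + 1) \<le> ln (b * real N + 1)" using AM bN by simp
    then show ?thesis using num_participants_gt[of b N] by simp
  qed
  finally have "exp (ln (global_ratio b 1 N ?M)) \<le> exp (2 + ln (b * real N + 1))" by simp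
  then show ?thesis using ln_global_ratio(1)[OF b N order_refl, of 1] bN by (simp add: exp_add)
qed

text \<open>For \<open>p = 1\<close> the assumption \<open>a = b\<close> gives \<open>\<lfloor>a N\<rfloor> = M\<close>, so that no factor \<open>(1 - p)\<close> occurs.\<close>

lemma global_ratio_lower:
  assumes b: "b > 0" and p: "0 < p" "p \<le> 1" and a: "0 \<le> a" "a \<le> b" and pa: "p < 1 \<or> a = b" and \<delta>: "\<delta> > 0"
  shows "eventually (\<lambda>N. nat \<lfloor>a * real N\<rfloor> \<le> num_participants b N \<and>
    global_ratio b p N (nat \<lfloor>a * real N\<rfloor>) \<ge> exp (- real N * (global_cost b p a + \<delta>))) sequentially"
proof -
  define A where "A N = nat \<lfloor>a * real N\<rfloor>" for N
  let ?M = "num_participants b"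
  define x where "x N = real (?M N) / real N" for N
  define y where "y N = real (A N) / real N" for N
  \<comment> \<open>\<open>N d = M - A + 1\<close> is the number that occurs in the upper bound for \<open>(M - A)!\<close>\<close>
  define d where "d N = x N - y N + 1 / real N" for N
  have le: "A N \<le> ?M N" for N
    unfolding A_def num_participants_def using a b by (intro nat_mono floor_mono mult_right_mono) auto
  have x: "x \<longlonglongrightarrow> b" unfolding x_def using b by (intro num_participants_over_tendsto) auto
  have y: "y \<longlonglongrightarrow> a" unfolding y_def A_def using a by (intro floor_mult_over_tendsto)
  have "d \<longlonglongrightarrow> b - a + 0" unfolding d_def by (intro tendsto_intros x y lim_1_over_n)
  then have d: "d \<longlonglongrightarrow> b - a" by simp
  have d0: "d N \<ge> 0" for N
    unfolding d_def x_def y_def using le[of N] by (simp add: divide_right_mono)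
  define E where "E N = b * p + x N * ln (x N) - x N - d N * ln (d N) + (x N - y N) - y N * ln b +
     (x N - y N) * ln (1 - p) - ln (real N) / real N" for N
  have lnN: "(\<lambda>N. ln (real N) / real N) \<longlonglongrightarrow> 0" by real_asymp
  have "E \<longlonglongrightarrow> b * p + b * ln b - b - (b - a) * ln (b - a) + (b - a) - a * ln b + (b - a) * ln (1 - p) - 0"
    unfolding E_def
    by (intro tendsto_add tendsto_diff tendsto_mult tendsto_const lnN x y d tendsto_x_ln_x d0)
      (use a b in \<open>auto simp: x_def\<close>)
  also have "b * p + b * ln b - b - (b - a) * ln (b - a) + (b - a) - a * ln b + (b - a) * ln (1 - p) - 0 = - global_cost b p a"
  proof (cases "a = b")
    case False
    then have ab: "a < b" "p < 1" using a pa by auto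
    have "1 - a / b = (b - a) / b" using b by (simp add: field_simps)
    then have "ln ((1 - a / b) / (1 - p)) = ln (b - a) - ln b - ln (1 - p)" using ab b by (simp add: ln_div ln_mult)
    then show ?thesis unfolding global_cost_def by (simp only:) (simp add: algebra_simps)
  qed (simp add: global_cost_def)
  finally have "eventually (\<lambda>N. E N > - global_cost b p a - \<delta>) sequentially"
    using \<delta> by (intro order_tendstoD(1)) auto
  moreover have "eventually (\<lambda>N. x N > 0) sequentially" using x b by (rule order_tendstoD(1))
  ultimately show ?thesis
    using eventually_gt_at_top[of 0]
  proof eventually_elim
    case (elim N)
    have pN: "p < 1 \<or> A N = ?M N" using pa by (auto simp: A_def num_participants_def)
    have xy: "real (?M N) = real N * x N" "real (A N) = real N * y N" "real (?M N - A N + 1) = real N * d N"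
      using elim le[of N] by (auto simp: x_def y_def d_def of_nat_diff field_simps)
    have dp: "d N > 0" using xy(3) elim by (metis of_nat_0_less_iff zero_less_mult_pos add_gr_0 zero_less_one)
    have 1: "ln (fact (?M N)) \<ge> real N * (x N * ln (x N)) + real N * x N * ln (real N) - real N * x N"
      using ln_fact_ge[of "?M N"] elim by (simp add: xy(1) ln_mult algebra_simps)
    have "ln (fact (?M N - A N)) \<le> real N * d N * ln (real N * d N) - real (?M N - A N)"
      using ln_fact_le[of "?M N - A N"] by (simp only: xy(3))
    also have "\<dots> = real N * (d N * ln (d N)) + real N * d N * ln (real N) - (real N * x N - real N * y N)"
      using elim dp le[of N] by (simp add: ln_mult of_nat_diff xy(1,2) algebra_simps)
    finally have 2: "ln (fact (?M N - A N)) \<le> real N * (d N * ln (d N)) + real N * d N * ln (real N) - (real N * x N - real N * y N)" .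
    have 3: "ln (global_ratio b p N (A N)) = b * p * real N + ln (fact (?M N)) - ln (fact (?M N - A N))
     - real N * y N * (ln b + ln (real N)) + (real N * x N - real N * y N) * ln (1 - p)"
      using ln_global_ratio(2)[OF b _ le pN] elim b by (simp add: xy(1,2) ln_mult)
    have "real N * d N = real N * x N - real N * y N + 1" using elim by (simp add: d_def algebra_simps)
    then have 4: "real N * d N * ln (real N) = real N * x N * ln (real N) - real N * y N * ln (real N) + ln (real N)"
      by (simp only:) (simp add: algebra_simps)
    have "real N * E N = real N * (b * p) + real N * (x N * ln (x N)) - real N * x N - real N * (d N * ln (d N)) +
       (real N * x N - real N * y N) - real N * y N * ln b + (real N * x N - real N * y N) * ln (1 - p) - ln (real N)"
      using elim by (simp add: E_def algebra_simps)
    then have "real N * E N \<le> ln (global_ratio b p N (A N))"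
      using 1 2 3 4 by (simp add: algebra_simps)
    moreover have "- real N * (global_cost b p a + \<delta>) \<le> real N * E N"
      using mult_left_mono[of "- global_cost b p a - \<delta>" "E N" "real N"] elim by (simp add: algebra_simps)
    ultimately have "- real N * (global_cost b p a + \<delta>) \<le> ln (global_ratio b p N (A N))" by linarith
    then have "exp (- real N * (global_cost b p a + \<delta>)) \<le> global_ratio b p N (A N)"
      using ln_global_ratio(1)[OF b _ le pN] elim by (subst (asm) ln_ge_iff) auto
    then show ?case using le[of N] by (simp add: A_def)
  qed
qed

section \<open>Profiles and the rate function\<close>

text \<open>The scaled triple of an outcome, as a function of its profile (\<open>prob_scaled_triple\<close>).\<close>

definition profile_mean :: "nat \<Rightarrow> nat multiset \<Rightarrow> real \<times> real \<times> real" where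
  "profile_mean \<kappa> m = (1 / real (size m)) *\<^sub>R (\<Sum>k\<in>#m. slot_statistic \<kappa> k)"

lemma sum_mset_eq_sum_scaleR:
  fixes f :: "'b \<Rightarrow> 'a::real_vector"
  shows "(\<Sum>k\<in>#m. f k) = (\<Sum>k\<in>set_mset m. real (count m k) *\<^sub>R f k)"
proof (induction m)
  case (add k m)
  have "(\<Sum>j\<in>set_mset (add_mset k m). real (count (add_mset k m) j) *\<^sub>R f j) =
    (\<Sum>j\<in>insert k (set_mset m). real (count m j) *\<^sub>R f j + (if j = k then f k else 0))"
    by (intro sum.cong) (auto simp: algebra_simps)
  also have "\<dots> = (\<Sum>j\<in>insert k (set_mset m). real (count m j) *\<^sub>R f j) + f k"
    by (simp add: sum.distrib)
  also have "(\<Sum>j\<in>insert k (set_mset m). real (count m j) *\<^sub>R f j) = (\<Sum>j\<in>set_mset m. real (count m j) *\<^sub>R f j)"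
    by (intro sum.mono_neutral_right) (auto simp: not_in_iff)
  finally show ?case using add by simp
qed simp

lemma profile_mean_eq:
  assumes "finite S" "set_mset m \<subseteq> S"
  shows "profile_mean \<kappa> m = (\<Sum>k\<in>S. (real (count m k) / real (size m)) *\<^sub>R slot_statistic \<kappa> k)"
proof -
  have "profile_mean \<kappa> m = (\<Sum>k\<in>set_mset m. (real (count m k) / real (size m)) *\<^sub>R slot_statistic \<kappa> k)"
    unfolding profile_mean_def sum_mset_eq_sum_scaleR by (simp add: scaleR_sum_right)
  also have "\<dots> = (\<Sum>k\<in>S. (real (count m k) / real (size m)) *\<^sub>R slot_statistic \<kappa> k)"
    using assms by (intro sum.mono_neutral_left) (auto simp: not_in_iff)
  finally show ?thesis .
qed

text \<open>The empirical distribution of the profile competes in the infimum that defines the rate.\<close>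

lemma rate_L_profile_mean_le:
  assumes "m \<noteq> {#}"
  shows "rate_L b p \<kappa> (profile_mean \<kappa> m) \<le> rel_entropy (pmf_of_multiset m) (poisson_pmf (b * p))"
proof -
  have "(\<lambda>k. pmf (pmf_of_multiset m) k *\<^sub>R slot_statistic \<kappa> k) sums
    (\<Sum>k\<in>set_mset m. pmf (pmf_of_multiset m) k *\<^sub>R slot_statistic \<kappa> k)"
    using assms by (intro sums_finite) (auto simp: not_in_iff)
  also have "(\<Sum>k\<in>set_mset m. pmf (pmf_of_multiset m) k *\<^sub>R slot_statistic \<kappa> k) = profile_mean \<kappa> m"
    using assms by (simp add: profile_mean_eq[of "set_mset m"])
  finally show ?thesis unfolding rate_L_def by (intro INF_lower) simp
qed

lemma fst_profile_mean: "fst (profile_mean \<kappa> m) = real (sum_mset m) / real (size m)"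
proof -
  have "fst (\<Sum>k\<in>#m. slot_statistic \<kappa> k) = real (sum_mset m)"
    by (induction m) (auto simp: slot_statistic_def)
  then show ?thesis by (simp add: profile_mean_def)
qed

text \<open>There are at most as many successful attempts as attempts, and at most \<open>size m\<close> successful slots.\<close>

lemma profile_mean_in_box:
  assumes m: "size m > 0" "real (sum_mset m) \<le> b * real (size m)"
  shows "profile_mean \<kappa> m \<in> {0..b} \<times> {0..b} \<times> {0..1}"
proof -
  define x where "x = (\<Sum>k\<in>#m. slot_statistic \<kappa> k)"
  have "fst x = real (sum_mset m) \<and> 0 \<le> fst (snd x) \<and> fst (snd x) \<le> real (sum_mset m) \<and>
      0 \<le> snd (snd x) \<and> snd (snd x) \<le> real (size m)"
    unfolding x_def by (induction m) (auto simp: slot_statistic_def indicator_def)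
  moreover obtain a s r where "x = (a, s, r)" by (metis surj_pair)
  ultimately show ?thesis using m by (simp add: profile_mean_def flip: x_def) (auto simp: field_simps)
qed

lemma set_access_pmf:
  assumes "N > 0" "\<omega> \<in> set_pmf (access_pmf D b p N)"
  shows "\<omega> \<subseteq> participants b N \<times> {..<N}"
  using assms set_local_attempts[of b p N] set_global_attempts[of N b p] by (cases D) auto

lemma prob_scaled_triple:
  assumes N: "N > 0"
  shows "measure (measure_pmf (access_pmf D b p N)) {\<omega> \<in> space (measure_pmf (access_pmf D b p N)). scaled_triple \<kappa> N \<omega> \<in> F} =
    measure_pmf.prob (profile_pmf D b p N) {m. size m = N \<and> profile_mean \<kappa> m \<in> F}"
proof -
  have size: "size (profile N \<omega>) = N" for \<omega> by (simp add: profile_def slot_counts_def)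
  have eq: "scaled_triple \<kappa> N \<omega> = profile_mean \<kappa> (profile N \<omega>)" if "\<omega> \<in> set_pmf (access_pmf D b p N)" for \<omega>
    using scaled_triple_eq[OF set_access_pmf[OF N that]]
    by (simp add: participants_def profile_mean_def size)
  have "measure_pmf.prob (access_pmf D b p N) {\<omega>. scaled_triple \<kappa> N \<omega> \<in> F} =
    measure_pmf.prob (access_pmf D b p N) (profile N -` {m. size m = N \<and> profile_mean \<kappa> m \<in> F})"
  proof -
    have *: "pmf (access_pmf D b p N) \<omega> = 0" if "scaled_triple \<kappa> N \<omega> \<noteq> profile_mean \<kappa> (profile N \<omega>)" for \<omega>
      using eq[of \<omega>] that by (auto simp: set_pmf_iff)
    show ?thesis by (rule measure_prob_cong_0) (use size in \<open>auto intro!: *\<close>)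
  qed
  then show ?thesis by (simp add: profile_pmf_def measure_map_pmf)
qed

text \<open>Exponential bounds for all real rates below \<open>I\<close>, in place of logarithms of possibly vanishing
  probabilities.\<close>

lemma ldp_upperI:
  assumes "\<And>c. ereal c < I \<Longrightarrow> eventually (\<lambda>N. P N \<le> exp (- real N * c)) sequentially"
    and "\<And>N. P N \<ge> 0"
  shows "limsup (\<lambda>N. ereal (1 / real N) * ln_prob (P N)) \<le> - I"
proof (rule dense_ge)
  fix y :: ereal assume y: "- I < y"
  show "limsup (\<lambda>N. ereal (1 / real N) * ln_prob (P N)) \<le> y"
  proof (cases y)
    case (real r)
    then have "- ereal r < I" using y by (subst (asm) ereal_uminus_less_reorder) simp
    then have "ereal (- r) < I" by simp
    from assms(1)[OF this]
    have "eventually (\<lambda>N. ereal (1 / real N) * ln_prob (P N) \<le> ereal r) sequentially"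
      using eventually_gt_at_top[of 0]
    proof eventually_elim
      case (elim N)
      show ?case
      proof (cases "P N = 0")
        case False
        then have "P N > 0" using assms(2)[of N] by simp
        then have "ln (P N) \<le> ln (exp (real N * r))" using elim by (subst ln_le_cancel_iff) auto
        then have "ln (P N) \<le> real N * r" by simp
        then show ?thesis using False elim by (simp add: ln_prob_def field_simps)
      qed (use elim in \<open>simp add: ln_prob_def\<close>)
    qed
    then show ?thesis using real by (simp add: Limsup_bounded)
  qed (use y in auto)
qed

lemma ldp_lowerI:
  assumes "\<And>c. I < ereal c \<Longrightarrow> eventually (\<lambda>N. exp (- real N * c) \<le> P N) sequentially"
  shows "- I \<le> liminf (\<lambda>N. ereal (1 / real N) * ln_prob (P N))"
proof (rule dense_le)
  fix y :: ereal assume y: "y < - I"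
  show "y \<le> liminf (\<lambda>N. ereal (1 / real N) * ln_prob (P N))"
  proof (cases y)
    case (real r)
    then have "I < ereal (- r)" using y by (simp add: ereal_less_uminus_reorder)
    from assms(1)[OF this]
    have "eventually (\<lambda>N. ereal r \<le> ereal (1 / real N) * ln_prob (P N)) sequentially"
      using eventually_gt_at_top[of 0]
    proof eventually_elim
      case (elim N)
      then have "exp (real N * r) \<le> P N" by simp
      moreover from this have P: "P N > 0" by (meson exp_gt_zero less_le_trans)
      ultimately have "real N * r \<le> ln (P N)" by (simp add: ln_ge_iff)
      then show ?case using P elim by (simp add: ln_prob_def field_simps)
    qed
    then show ?thesis using real by (simp add: Liminf_bounded)
  qed (use y in auto)
qed

definition access_cost :: "access_rule \<Rightarrow> real \<Rightarrow> real \<Rightarrow> real \<Rightarrow> real" where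
  "access_cost D b p a = (case D of Local \<Rightarrow> 0 | Global \<Rightarrow> global_cost b p a)"

text \<open>Excludes exactly the points at which \<open>silent_cost\<close> is infinite.\<close>

definition admissible :: "access_rule \<Rightarrow> real \<Rightarrow> real \<Rightarrow> real \<Rightarrow> bool" where
  "admissible D b p a \<longleftrightarrow> (D = Global \<and> p = 1 \<longrightarrow> a = b)"

lemma rate_IB_eq:
  "rate_IB D b p \<kappa> x =
    (if admissible D b p (fst x) then rate_L b p \<kappa> x + ereal (access_cost D b p (fst x)) else \<infinity>)"
  by (cases D; cases x)
    (auto simp: admissible_def access_cost_def rate_G_def silent_cost_def global_cost_def add.assoc add_diff_eq
      simp flip: zero_ereal_def)

section \<open>The upper bound\<close>

text \<open>The comparison with Poisson slots costs \<open>e\<close>, the type class \<open>c - e\<close>.\<close>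

lemma profile_pmf_bound:
  assumes bp: "b * p > 0" and m: "size m = N" "N > 0" and C: "C \<ge> 0"
    and pmf: "pmf P m \<le> C * exp (- real N * e) * poisson_weight (b * p) m"
    and c: "ereal c < rate_L b p \<kappa> (profile_mean \<kappa> m) + ereal e"
  shows "pmf P m \<le> C * (exp 1 * (real N + 1)) * exp (- real N * c)"
proof -
  have m0: "m \<noteq> {#}" using m by auto
  have pos: "pmf (poisson_pmf (b * p)) k > 0" for k using bp by simp
  obtain h where h: "rel_entropy (pmf_of_multiset m) (poisson_pmf (b * p)) = ereal h"
    using rel_entropy_pmf_of_multiset[OF m0, of "poisson_pmf (b * p)"] pos by blast
  have "ereal c < ereal h + ereal e"
    using c rate_L_profile_mean_le[OF m0, of b p \<kappa>] unfolding h by (meson add_right_mono less_le_trans)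
  then have "ereal (c - e) \<le> rel_entropy (pmf_of_multiset m) (poisson_pmf (b * p))"
    unfolding h by simp
  from type_class_upper[OF m0 pos this]
  have w: "poisson_weight (b * p) m \<le> exp 1 * (real N + 1) * exp (- real N * (c - e))"
    by (simp add: m add.commute)
  have "pmf P m \<le> C * exp (- real N * e) * (exp 1 * (real N + 1) * exp (- real N * (c - e)))"
    using pmf mult_left_mono[OF w, of "C * exp (- real N * e)"] C by simp
  also have "\<dots> = C * (exp 1 * (real N + 1)) * (exp (- real N * e) * exp (- real N * (c - e)))"
    by (simp only: mult_ac)
  also have "exp (- real N * e) * exp (- real N * (c - e)) = exp (- real N * c)"
    by (simp add: algebra_simps flip: exp_add)
  finally show ?thesis .
qed

text \<open>For \<open>p = 1\<close> the attempts per slot are \<open>M / N\<close>, close to \<open>b\<close> but in general different from it, whereas the rate is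
  finite only at \<open>a = b\<close>. If \<open>rate_L > c\<close> on the part of \<open>F\<close> with \<open>a = b\<close>, then the compact set of points of \<open>F\<close> with
  \<open>rate_L \<le> c\<close> has a maximal first component below \<open>b\<close>, which \<open>M / N\<close> eventually exceeds.\<close>

lemma rate_L_near_full_participation:
  assumes bp: "b > 0" "p > 0" and F: "closed F" "F \<subseteq> {0..b} \<times> {0..b} \<times> {0..1}"
    and c: "\<And>x. x \<in> F \<Longrightarrow> fst x = b \<Longrightarrow> ereal c < rate_L b p \<kappa> x"
  shows "eventually (\<lambda>N. \<forall>x\<in>F. fst x = real (num_participants b N) / real N \<longrightarrow> ereal c < rate_L b p \<kappa> x) sequentially"
proof -
  define Q where "Q = F \<inter> {x. rate_L b p \<kappa> x \<le> ereal c}"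
  have "compact (({0..b} \<times> {0..b} \<times> {0..1}) :: (real \<times> real \<times> real) set)"
    by (intro compact_Times compact_Icc)
  moreover have "closed Q" unfolding Q_def using bp by (intro closed_Int F(1) rate_L_sublevel_closed) simp
  moreover have "Q = Q \<inter> ({0..b} \<times> {0..b} \<times> {0..1})" using F(2) by (auto simp: Q_def)
  ultimately have Q: "compact Q" by (metis closed_Int_compact)
  show ?thesis
  proof (cases "Q = {}")
    case True
    then have "\<forall>x\<in>F. ereal c < rate_L b p \<kappa> x" by (auto simp: Q_def not_le[symmetric])
    then show ?thesis by simp
  next
    case False
    have "continuous_on Q (fst :: real \<times> real \<times> real \<Rightarrow> real)" by (intro continuous_intros)
    from continuous_attains_sup[OF Q False this] obtain y where y: "y \<in> Q" "\<And>x. x \<in> Q \<Longrightarrow> fst x \<le> fst y" by auto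
    have "fst y \<noteq> b" using y(1) c[of y] by (auto simp: Q_def)
    moreover have "fst y \<le> b" using y(1) F(2) by (auto simp: Q_def)
    ultimately have "fst y < b" by simp
    with num_participants_over_tendsto[of b] bp
    have "eventually (\<lambda>N. fst y < real (num_participants b N) / real N) sequentially"
      by (intro order_tendstoD(1)) auto
    then show ?thesis
    proof eventually_elim
      case (elim N)
      then show ?case using y(2) by (force simp: Q_def not_le[symmetric])
    qed
  qed
qed

lemma profile_pmf_upper:
  assumes b: "b > 0" and p: "p > 0" and D: "D = Global \<longrightarrow> p \<le> 1"
    and F: "closed F" "F \<subseteq> {0..b} \<times> {0..b} \<times> {0..1}"
    and c: "\<And>x. x \<in> F \<Longrightarrow> ereal c < rate_IB D b p \<kappa> x"
  shows "\<exists>C0. eventually (\<lambda>N. \<forall>m. size m = N \<longrightarrow> profile_mean \<kappa> m \<in> F \<longrightarrow>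
    pmf (profile_pmf D b p N) m \<le> exp C0 * (b * real N + 1) * (real N + 1) * exp (- real N * c)) sequentially"
proof -
  have bp: "b * p > 0" using b p by simp
  have A_le: "real (sum_mset m) \<le> b * real N" if "size m = N" "N > 0" "profile_mean \<kappa> m \<in> F" for m N
  proof -
    have "fst (profile_mean \<kappa> m) \<le> b" using F(2) that by auto
    then show ?thesis using that by (simp add: fst_profile_mean pos_divide_le_eq)
  qed
  consider "D = Local" | "D = Global" "p < 1" | "D = Global" "p = 1" using D by (cases D) force+
  then show ?thesis
  proof cases
    case 1
    have "eventually (\<lambda>N. p < real N) sequentially" by real_asymp
    then have "eventually (\<lambda>N. \<forall>m. size m = N \<longrightarrow> profile_mean \<kappa> m \<in> F \<longrightarrow>
      pmf (profile_pmf D b p N) m \<le> exp (p + p * b + 1) * (b * real N + 1) * (real N + 1) * exp (- real N * c)) sequentially"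
      using eventually_gt_at_top[of 0]
    proof eventually_elim
      case (elim N)
      show ?case
      proof (intro allI impI)
        fix m assume m: "size m = N" "profile_mean \<kappa> m \<in> F"
        have "pmf (profile_pmf D b p N) m \<le> exp (p + p * b) * exp (- real N * 0) * poisson_weight (b * p) m"
          using local_profile_upper[OF b p _ _ m(1) A_le[OF m(1) _ m(2)]] elim by (simp add: 1)
        from profile_pmf_bound[OF bp m(1) _ _ this] c[OF m(2)] elim
        have "pmf (profile_pmf D b p N) m \<le> exp (p + p * b) * (exp 1 * (real N + 1)) * exp (- real N * c)"
          by (simp add: 1)
        also have "\<dots> = exp (p + p * b + 1) * 1 * (real N + 1) * exp (- real N * c)"
          by (simp only: exp_add mult_1_right mult_ac)
        also have "\<dots> \<le> exp (p + p * b + 1) * (b * real N + 1) * (real N + 1) * exp (- real N * c)"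
          using b by (intro mult_right_mono mult_left_mono) auto
        finally show "pmf (profile_pmf D b p N) m \<le> exp (p + p * b + 1) * (b * real N + 1) * (real N + 1) * exp (- real N * c)" .
      qed
    qed
    then show ?thesis by blast
  next
    case 2
    have "eventually (\<lambda>N. \<forall>m. size m = N \<longrightarrow> profile_mean \<kappa> m \<in> F \<longrightarrow>
      pmf (profile_pmf D b p N) m \<le> exp (1 - ln (1 - p) + 1) * (b * real N + 1) * (real N + 1) * exp (- real N * c)) sequentially"
      using eventually_gt_at_top[of 0]
    proof eventually_elim
      case (elim N)
      show ?case
      proof (intro allI impI)
        fix m assume m: "size m = N" "profile_mean \<kappa> m \<in> F"
        define C where "C = exp (1 - ln (1 - p)) * (b * real N + 1)"
        define e where "e = global_cost b p (real (sum_mset m) / real N)"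
        have C: "C \<ge> 0" using b by (simp add: C_def)
        have w: "poisson_weight (b * p) m > 0" using bp by (rule poisson_weight_pos)
        have "pmf (profile_pmf D b p N) m \<le> C * exp (- real N * e) * poisson_weight (b * p) m"
        proof (cases "sum_mset m \<le> num_participants b N")
          case True
          then have "pmf (profile_pmf D b p N) m = global_ratio b p N (sum_mset m) * poisson_weight (b * p) m"
            using pmf_global_ratio[OF b p _ _ m(1)] 2 elim by simp
          also have "\<dots> \<le> C * exp (- real N * e) * poisson_weight (b * p) m"
            using global_ratio_upper[OF b p _ _ True] 2 elim w unfolding C_def e_def by (intro mult_right_mono) auto
          finally show ?thesis .
        next
          case False
          then have "pmf (profile_pmf D b p N) m = 0"
            using pmf_global_ratio[OF b p _ _ m(1)] 2 elim by simp
          then show ?thesis using C w by simp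
        qed
        moreover have "ereal c < rate_L b p \<kappa> (profile_mean \<kappa> m) + ereal e"
          using c[OF m(2)] less_imp_neq[OF 2(2)] unfolding rate_IB_eq e_def
          by (simp add: 2(1) m(1) admissible_def access_cost_def fst_profile_mean)
        ultimately have "pmf (profile_pmf D b p N) m \<le> C * (exp 1 * (real N + 1)) * exp (- real N * c)"
          using profile_pmf_bound[OF bp m(1) _ C] elim by blast
        also have "\<dots> = exp (1 - ln (1 - p) + 1) * (b * real N + 1) * (real N + 1) * exp (- real N * c)"
          by (simp only: C_def exp_add mult_ac)
        finally show "pmf (profile_pmf D b p N) m \<le> exp (1 - ln (1 - p) + 1) * (b * real N + 1) * (real N + 1) * exp (- real N * c)" .
      qed
    qed
    then show ?thesis by blast
  next
    case 3
    have "eventually (\<lambda>N. \<forall>x\<in>F. fst x = real (num_participants b N) / real N \<longrightarrow> ereal c < rate_L b p \<kappa> x) sequentially"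
    proof (rule rate_L_near_full_participation[OF b p F])
      fix x assume "x \<in> F" "fst x = b"
      with c[of x] show "ereal c < rate_L b p \<kappa> x"
        unfolding rate_IB_eq using 3 by (simp add: admissible_def access_cost_def global_cost_def flip: zero_ereal_def)
    qed
    then have "eventually (\<lambda>N. \<forall>m. size m = N \<longrightarrow> profile_mean \<kappa> m \<in> F \<longrightarrow>
      pmf (profile_pmf D b p N) m \<le> exp (2 + 1) * (b * real N + 1) * (real N + 1) * exp (- real N * c)) sequentially"
      using eventually_gt_at_top[of 0]
    proof eventually_elim
      case (elim N)
      show ?case
      proof (intro allI impI)
        fix m assume m: "size m = N" "profile_mean \<kappa> m \<in> F"
        define C where "C = exp 2 * (b * real N + 1)"
        have C: "C \<ge> 0" using b by (simp add: C_def)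
        have w: "poisson_weight (b * p) m > 0" using bp by (rule poisson_weight_pos)
        have "pmf (profile_pmf D b p N) m \<le> C * (exp 1 * (real N + 1)) * exp (- real N * c)"
        proof (cases "sum_mset m = num_participants b N")
          case True
          then have "pmf (profile_pmf D b p N) m = global_ratio b p N (num_participants b N) * poisson_weight (b * p) m"
            using pmf_global_ratio[OF b p _ _ m(1)] 3 elim by simp
          also have "\<dots> \<le> C * exp (- real N * 0) * poisson_weight (b * p) m"
            using global_ratio_upper_full[OF b, of N] 3 elim w unfolding C_def by (intro mult_right_mono) auto
          finally have "pmf (profile_pmf D b p N) m \<le> C * exp (- real N * 0) * poisson_weight (b * p) m" .
          moreover have "ereal c < rate_L b p \<kappa> (profile_mean \<kappa> m) + ereal 0"
            using elim m True by (simp add: fst_profile_mean flip: zero_ereal_def)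
          ultimately show ?thesis using profile_pmf_bound[OF bp m(1) _ C] elim by blast
        next
          case False
          have "pmf (profile_pmf D b p N) m = 0"
          proof (cases "sum_mset m < num_participants b N")
            case True
            then have "global_ratio b p N (sum_mset m) = 0" using 3 by (simp add: global_ratio_def)
            then show ?thesis using pmf_global_ratio[OF b p _ _ m(1)] 3 elim True by simp
          next
            case False
            then show ?thesis using pmf_global_ratio[OF b p _ _ m(1)] 3 elim \<open>sum_mset m \<noteq> num_participants b N\<close> by simp
          qed
          then show ?thesis using C by simp
        qed
        also have "\<dots> = exp (2 + 1) * (b * real N + 1) * (real N + 1) * exp (- real N * c)"
          by (simp only: C_def exp_add mult_ac)
        finally show "pmf (profile_pmf D b p N) m \<le> exp (2 + 1) * (b * real N + 1) * (real N + 1) * exp (- real N * c)" .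
      qed
    qed
    then show ?thesis by blast
  qed
qed

text \<open>Union bound over the profiles with mean in \<open>F\<close>. The parameter \<open>x\<close> in the bound for their number is
  chosen such that this number is at most a constant times \<open>exp (\<eta> N)\<close>, where \<open>2 \<eta>\<close> is the distance of \<open>c\<close>
  to some larger number below the infimum.\<close>

lemma ldp_upper_bound:
  assumes b: "b > 0" and p: "p > 0" and D: "D = Global \<longrightarrow> p \<le> 1"
    and F: "closed F" "F \<subseteq> {0..b} \<times> {0..b} \<times> {0..1}"
    and c: "ereal c < (INF x\<in>F. rate_IB D b p \<kappa> x)"
  shows "eventually (\<lambda>N. measure_pmf.prob (profile_pmf D b p N) {m. size m = N \<and> profile_mean \<kappa> m \<in> F}
    \<le> exp (- real N * c)) sequentially"
proof -
  \<comment> \<open>the room between \<open>c\<close> and \<open>c1\<close> absorbs the number of profiles and the polynomial factors\<close>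
  obtain c1 where c1: "c < c1" "ereal c1 < (INF x\<in>F. rate_IB D b p \<kappa> x)"
    using c by (metis ereal_dense2 less_ereal.simps(1))
  have "ereal c1 < rate_IB D b p \<kappa> x" if "x \<in> F" for x
    using c1(2) INF_lower[OF that, of "rate_IB D b p \<kappa>"] by (rule less_le_trans)
  from profile_pmf_upper[OF b p D F this] obtain C0 where C0:
    "eventually (\<lambda>N. \<forall>m. size m = N \<longrightarrow> profile_mean \<kappa> m \<in> F \<longrightarrow>
      pmf (profile_pmf D b p N) m \<le> exp C0 * (b * real N + 1) * (real N + 1) * exp (- real N * c1)) sequentially"
    by blast
  define \<eta> where "\<eta> = (c1 - c) / 2"
  have \<eta>: "\<eta> > 0" using c1 by (simp add: \<eta>_def)
  \<comment> \<open>\<open>x ^ (b N) = exp (- \<eta> N)\<close>\<close>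
  define x where "x = exp (- \<eta> / b)"
  have x: "0 < x" "x < 1" using \<eta> b by (auto simp: x_def)
  define C1 where "C1 = exp (1 / (1 - x)\<^sup>2) * exp C0"
  have C1: "C1 > 0" by (simp add: C1_def)
  have "((\<lambda>N. C1 * (b * real N + 1) * (real N + 1) * exp (- real N * \<eta>)) \<longlongrightarrow> 0) sequentially"
    using \<eta> b C1 by real_asymp
  then have "eventually (\<lambda>N. C1 * (b * real N + 1) * (real N + 1) * exp (- real N * \<eta>) < 1) sequentially"
    by (rule order_tendstoD(2)) simp
  then show ?thesis
    using C0 eventually_gt_at_top[of 0]
  proof eventually_elim
    case (elim N)
    let ?M = "num_participants b N"
    let ?W = "{m. size m = N \<and> profile_mean \<kappa> m \<in> F}"
    let ?T = "{m. size m = N \<and> sum_mset m \<le> ?M}"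
    define B where "B = exp C0 * (b * real N + 1) * (real N + 1) * exp (- real N * c1)"
    have B: "B \<ge> 0" using b by (simp add: B_def)
    have sub: "?W \<subseteq> ?T"
    proof
      fix m assume m: "m \<in> ?W"
      then have "fst (profile_mean \<kappa> m) \<le> b" using F(2) by auto
      then have "real (sum_mset m) \<le> b * real N" using m elim by (simp add: fst_profile_mean pos_divide_le_eq)
      then have "sum_mset m \<le> ?M" unfolding num_participants_def by (simp add: le_nat_floor)
      then show "m \<in> ?T" using m by simp
    qed
    have fin: "finite ?T" using card_profiles_le(1)[OF x] .
    have finW: "finite ?W" using sub fin by (rule finite_subset)
    have xM: "x ^ ?M \<ge> exp (- \<eta> * real N)"
    proof -
      have "x ^ ?M = exp (- \<eta> / b * real ?M)" by (simp add: x_def mult.commute flip: exp_of_nat_mult)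
      moreover have "- \<eta> / b * real ?M \<ge> - \<eta> / b * (b * real N)"
        using \<eta> b num_participants_le[of b N] by (intro mult_left_mono_neg) auto
      ultimately show ?thesis using b by simp
    qed
    have cardT: "real (card ?T) \<le> exp (1 / (1 - x)\<^sup>2) * exp (\<eta> * real N)"
    proof -
      have "real (card ?T) \<le> exp (1 / (1 - x)\<^sup>2) / x ^ ?M" using card_profiles_le(2)[OF x] .
      also have "\<dots> \<le> exp (1 / (1 - x)\<^sup>2) / exp (- \<eta> * real N)"
        using xM x by (intro divide_left_mono) auto
      finally show ?thesis by (simp add: exp_minus divide_inverse)
    qed
    have "measure_pmf.prob (profile_pmf D b p N) ?W = (\<Sum>m\<in>?W. pmf (profile_pmf D b p N) m)"
      by (rule measure_measure_pmf_finite[OF finW])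
    also have "\<dots> \<le> (\<Sum>m\<in>?W. B)" using elim by (intro sum_mono) (auto simp: B_def)
    also have "\<dots> = real (card ?W) * B" by simp
    also have "\<dots> \<le> real (card ?T) * B"
      using card_mono[OF fin sub] B by (intro mult_right_mono) auto
    also have "\<dots> \<le> exp (1 / (1 - x)\<^sup>2) * exp (\<eta> * real N) * B"
      using cardT B by (intro mult_right_mono)
    also have "\<dots> = C1 * (b * real N + 1) * (real N + 1) * (exp (\<eta> * real N) * exp (- real N * c1))"
      by (simp only: B_def C1_def mult_ac)
    also have "exp (\<eta> * real N) * exp (- real N * c1) = exp (- real N * \<eta>) * exp (- real N * c)"
      unfolding exp_add[symmetric] by (rule arg_cong[of _ _ exp]) (simp add: \<eta>_def field_simps)
    also have "C1 * (b * real N + 1) * (real N + 1) * (exp (- real N * \<eta>) * exp (- real N * c)) =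
      (C1 * (b * real N + 1) * (real N + 1) * exp (- real N * \<eta>)) * exp (- real N * c)"
      by (simp only: mult.assoc)
    also have "\<dots> \<le> 1 * exp (- real N * c)" using elim by (intro mult_right_mono) auto
    finally show ?case by simp
  qed
qed

section \<open>The lower bound\<close>

lemma profile_pmf_lower:
  fixes m :: "nat \<Rightarrow> nat multiset"
  assumes b: "b > 0" and p: "p > 0" and D: "D = Global \<longrightarrow> p \<le> 1"
    and a: "0 \<le> a" "a \<le> b" "admissible D b p a" and \<delta>: "\<delta> > 0"
    and m: "eventually (\<lambda>N. size (m N) = N \<and> set_mset (m N) \<subseteq> {..K} \<and> sum_mset (m N) = nat \<lfloor>a * real N\<rfloor>) sequentially"
  shows "eventually (\<lambda>N. pmf (profile_pmf D b p N) (m N) \<ge>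
    exp (- real N * (access_cost D b p a + \<delta>)) * poisson_weight (b * p) (m N)) sequentially"
proof (cases D)
  case Local
  have "eventually (\<lambda>N. size (m N) = N \<and> set_mset (m N) \<subseteq> {..K} \<and> real (sum_mset (m N)) \<le> b * real N) sequentially"
    using m
  proof eventually_elim
    case (elim N)
    have "real (nat \<lfloor>a * real N\<rfloor>) \<le> a * real N" using a by simp
    also have "\<dots> \<le> b * real N" using a by (intro mult_right_mono) auto
    finally show ?case using elim by (simp only:)
  qed
  from local_profile_lower[OF b p \<delta> this] show ?thesis by (simp add: Local access_cost_def)
next
  case Global
  have pa: "p < 1 \<or> a = b" using a(3) Global D by (auto simp: admissible_def)
  from global_ratio_lower[OF b p D[rule_format, OF Global] a(1,2) pa \<delta>] m eventually_gt_at_top[of 0]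
  show ?thesis
  proof eventually_elim
    case (elim N)
    have "exp (- real N * (global_cost b p a + \<delta>)) * poisson_weight (b * p) (m N) \<le>
      global_ratio b p N (sum_mset (m N)) * poisson_weight (b * p) (m N)"
      using elim poisson_weight_pos[of "b * p" "m N"] b p by (intro mult_right_mono) auto
    also have "\<dots> = pmf (profile_pmf Global b p N) (m N)"
      using pmf_global_ratio[OF b p D[rule_format, OF Global], of N "m N"] elim by simp
    finally show ?case by (simp add: Global access_cost_def)
  qed
qed

text \<open>A single profile, obtained by rounding a finitely supported law that is nearly optimal for a nearly
  optimal point of \<open>G\<close>, has sufficient probability.\<close>

lemma ldp_lower_bound:
  assumes b: "b > 0" and p: "p > 0" and D: "D = Global \<longrightarrow> p \<le> 1"
    and G: "openin (top_of_set ({0..b} \<times> {0..b} \<times> {0..1})) G"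
    and c: "(INF x\<in>G. rate_IB D b p \<kappa> x) < ereal c"
  shows "eventually (\<lambda>N. exp (- real N * c) \<le>
    measure_pmf.prob (profile_pmf D b p N) {m. size m = N \<and> profile_mean \<kappa> m \<in> G}) sequentially"
proof -
  let ?X = "{0..b} \<times> {0..b} \<times> {0..1::real}"
  define \<nu> where "\<nu> = poisson_pmf (b * p)"
  have pos: "pmf \<nu> k > 0" for k using b p by (simp add: \<nu>_def)
  from c obtain x where xG: "x \<in> G" and x: "rate_IB D b p \<kappa> x < ereal c" by (auto simp: INF_less_iff)
  obtain U where U: "open U" "G = ?X \<inter> U" using G by (auto simp: openin_open)
  define a where "a = fst x"
  have a: "0 \<le> a" "a \<le> b" using xG U by (auto simp: a_def)
  define e where "e = access_cost D b p a"
  have adm: "admissible D b p a" using x unfolding rate_IB_eq a_def by (auto split: if_splits)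
  then have "rate_L b p \<kappa> x + ereal e < ereal c" using x unfolding rate_IB_eq a_def e_def by simp
  then have "rate_L b p \<kappa> x < ereal (c - e)" by (cases "rate_L b p \<kappa> x") auto
  then obtain c1 where c1: "rate_L b p \<kappa> x < ereal c1" "c1 < c - e"
    by (metis ereal_dense2 less_ereal.simps(1))
  then obtain \<mu> where \<mu>: "(\<lambda>k. pmf \<mu> k *\<^sub>R slot_statistic \<kappa> k) sums x" "rel_entropy \<mu> \<nu> < ereal c1"
    unfolding rate_L_def INF_less_iff \<nu>_def by blast
  obtain \<epsilon> where \<epsilon>: "\<epsilon> > 0" "ball x \<epsilon> \<subseteq> U" using U xG by (meson IntD2 openE)
  obtain K v where v: "K \<ge> 1" "\<forall>k. v k \<ge> 0" "v 0 > 0" "(\<Sum>k\<le>K. v k) = 1"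
    "(\<Sum>k\<le>K. v k * real k) = a" "dist (\<Sum>k\<le>K. v k *\<^sub>R slot_statistic \<kappa> k) x < \<epsilon>"
    "(\<Sum>k\<le>K. v k * ln (v k / pmf \<nu> k)) < c1"
    using finite_support_approximation[OF pos \<mu> \<epsilon>(1), folded a_def] by blast
  note v0 = v(2)[rule_format]
  obtain m where m:
    "eventually (\<lambda>N. size (m N) = N \<and> set_mset (m N) \<subseteq> {..K} \<and> sum_mset (m N) = nat \<lfloor>a * real N\<rfloor>) sequentially"
    and "\<forall>k\<le>K. (\<lambda>N. real (count (m N) k) / real N) \<longlonglongrightarrow> v k"
    using integer_rounding[OF v(1) v0 v(3-5)] by blast
  then have m_lim: "(\<lambda>N. real (count (m N) k) / real N) \<longlonglongrightarrow> v k" if "k \<le> K" for k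
    using that by blast
  \<comment> \<open>\<open>c\<close> is split into the entropy \<open>c1\<close>, the access cost \<open>e\<close> and the slack \<open>\<delta>\<close>\<close>
  define \<delta> where "\<delta> = c - e - c1"
  have \<delta>: "\<delta> > 0" using c1 by (simp add: \<delta>_def)
  have "eventually (\<lambda>N. size (m N) = N \<and> set_mset (m N) \<subseteq> {..K}) sequentially"
    using m by eventually_elim auto
  from type_class_lower_limit[OF pos this m_lim v0 v(7)]
  have ev_w: "eventually (\<lambda>N. exp (- real N * c1) \<le> poisson_weight (b * p) (m N)) sequentially"
    by (simp add: \<nu>_def)
  have ev_p: "eventually (\<lambda>N. pmf (profile_pmf D b p N) (m N) \<ge>
    exp (- real N * (e + \<delta>)) * poisson_weight (b * p) (m N)) sequentially"
    unfolding e_def by (rule profile_pmf_lower[OF b p D a adm \<delta> m])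
  have lim: "(\<lambda>N. \<Sum>k\<le>K. (real (count (m N) k) / real N) *\<^sub>R slot_statistic \<kappa> k) \<longlonglongrightarrow> (\<Sum>k\<le>K. v k *\<^sub>R slot_statistic \<kappa> k)"
    by (intro tendsto_intros m_lim) simp
  have "(\<Sum>k\<le>K. v k *\<^sub>R slot_statistic \<kappa> k) \<in> U"
    using v(6) \<epsilon>(2) by (auto simp: dist_commute)
  with lim have ev_U: "eventually (\<lambda>N. (\<Sum>k\<le>K. (real (count (m N) k) / real N) *\<^sub>R slot_statistic \<kappa> k) \<in> U) sequentially"
    by (rule topological_tendstoD[OF _ U(1)])
  from ev_w ev_p ev_U m eventually_gt_at_top[of 0] show ?thesis
  proof eventually_elim
    case (elim N)
    have "real (nat \<lfloor>a * real N\<rfloor>) \<le> a * real N" using a by simp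
    also have "\<dots> \<le> b * real N" using a by (intro mult_right_mono) auto
    finally have "real (sum_mset (m N)) \<le> b * real (size (m N))" using elim by (simp only:)
    then have "profile_mean \<kappa> (m N) \<in> ?X" using elim by (intro profile_mean_in_box) (simp_all only:)
    moreover have "profile_mean \<kappa> (m N) \<in> U"
      using elim profile_mean_eq[of "{..K}" "m N" \<kappa>] by simp
    ultimately have mG: "m N \<in> {m. size m = N \<and> profile_mean \<kappa> m \<in> G}" using elim U by simp
    have "exp (- real N * c) = exp (- real N * (e + \<delta>)) * exp (- real N * c1)"
      unfolding exp_add[symmetric] by (rule arg_cong[of _ _ exp]) (simp add: \<delta>_def algebra_simps)
    also have "\<dots> \<le> exp (- real N * (e + \<delta>)) * poisson_weight (b * p) (m N)"
      using elim by (intro mult_left_mono) auto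
    also have "\<dots> \<le> pmf (profile_pmf D b p N) (m N)" using elim by simp
    also have "\<dots> = measure_pmf.prob (profile_pmf D b p N) {m N}" by (simp add: measure_pmf_single)
    also have "\<dots> \<le> measure_pmf.prob (profile_pmf D b p N) {m. size m = N \<and> profile_mean \<kappa> m \<in> G}"
      using mG by (intro measure_pmf.finite_measure_mono) auto
    finally show ?case .
  qed
qed

section \<open>The rate function and the large-deviation principle\<close>

text \<open>A negative value would, by the lower bound for the whole box, make a probability exceed 1.\<close>

lemma rate_IB_nonneg:
  assumes b: "b > 0" and p: "p > 0" and D: "D = Global \<longrightarrow> p \<le> 1"
    and x: "x \<in> {0..b} \<times> {0..b} \<times> {0..1}"
  shows "0 \<le> rate_IB D b p \<kappa> x"
proof (rule ccontr)
  let ?X = "{0..b} \<times> {0..b} \<times> {0..1::real}"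
  assume "\<not> 0 \<le> rate_IB D b p \<kappa> x"
  then have "(INF x\<in>?X. rate_IB D b p \<kappa> x) < 0"
    using INF_lower[OF x, of "rate_IB D b p \<kappa>"] by (auto intro: le_less_trans)
  then obtain c where c: "(INF x\<in>?X. rate_IB D b p \<kappa> x) < ereal c" "c < 0"
    by (metis ereal_dense2 ereal_less(1) less_ereal.simps(1) zero_ereal_def)
  have "eventually (\<lambda>N. exp (- real N * c) \<le>
    measure_pmf.prob (profile_pmf D b p N) {m. size m = N \<and> profile_mean \<kappa> m \<in> ?X}) sequentially"
    by (rule ldp_lower_bound[OF b p D _ c(1)]) auto
  then have "eventually (\<lambda>N::nat. False) sequentially"
    using eventually_gt_at_top[of 0]
  proof eventually_elim
    case (elim N)
    have "exp (- real N * c) \<le> 1" using elim(1) measure_pmf.prob_le_1 by (rule order_trans)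
    moreover have "- real N * c > 0" using c(2) elim(2) by (simp add: mult_pos_neg)
    ultimately show False by simp
  qed
  then show False by simp
qed

text \<open>At \<open>a = b\<close> continuity rests on \<open>x ln x \<rightarrow> 0\<close> for \<open>x = 1 - a / b\<close>.\<close>

lemma continuous_on_global_cost:
  assumes "b > 0" "p < 1"
  shows "continuous_on {0..b} (global_cost b p)"
proof -
  have "continuous_on {0..b} (\<lambda>a. b * ((1 - a / b) * ln (1 - a / b)) - (b - a) * ln (1 - p) + a - b * p)"
    using assms
    by (intro continuous_intros continuous_on_compose2[OF continuous_on_x_ln_x, of _ "\<lambda>a. 1 - a / b"]) auto
  moreover have "b * ((1 - a / b) * ln (1 - a / b)) - (b - a) * ln (1 - p) + a - b * p = global_cost b p a"
    if "a \<in> {0..b}" for a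
  proof (cases "a = b")
    case False
    then have "1 - a / b > 0" using that assms by (simp add: field_simps)
    then have "ln ((1 - a / b) / (1 - p)) = ln (1 - a / b) - ln (1 - p)" using assms by (simp add: ln_div)
    moreover have "b * ((1 - a / b) * ln (1 - a / b)) = (b - a) * ln (1 - a / b)"
      using assms by (simp add: field_simps)
    ultimately show ?thesis by (simp add: global_cost_def right_diff_distrib)
  qed (simp add: global_cost_def)
  ultimately show ?thesis by (rule continuous_on_eq)
qed

text \<open>Lower semicontinuity is preserved by adding a continuous real function.\<close>

lemma closed_sublevel_add_continuous:
  fixes I :: "'a::metric_space \<Rightarrow> ereal" and g :: "'a \<Rightarrow> real"
  assumes I: "\<And>c. closed {x. I x \<le> ereal c}" and X: "closed X" and g: "continuous_on X g"
  shows "closed {x \<in> X. I x + ereal (g x) \<le> ereal c}"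
  unfolding closed_sequential_limits
proof (intro allI impI, elim conjE)
  fix x l assume xs: "\<forall>n. x n \<in> {x \<in> X. I x + ereal (g x) \<le> ereal c}" and lim: "x \<longlonglongrightarrow> l"
  have l: "l \<in> X" using X xs lim by (auto simp: closed_sequential_limits)
  have gl: "(\<lambda>n. g (x n)) \<longlonglongrightarrow> g l"
    using continuous_on_tendsto_compose[OF g lim l] xs by auto
  have le: "I l \<le> ereal (c - g l + d)" if d: "d > 0" for d
  proof -
    have "eventually (\<lambda>n. g (x n) > g l - d) sequentially"
      using gl d by (intro order_tendstoD(1)) auto
    then have "eventually (\<lambda>n. x n \<in> {x. I x \<le> ereal (c - g l + d)}) sequentially"
    proof eventually_elim
      case (elim n)
      have "I (x n) + ereal (g (x n)) \<le> ereal c" using xs by auto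
      then show ?case using elim by (cases "I (x n)") auto
    qed
    then have "l \<in> {x. I x \<le> ereal (c - g l + d)}"
      using I lim by (intro Lim_in_closed_set[of _ x sequentially]) auto
    then show ?thesis by simp
  qed
  then have "I l \<le> ereal (c - g l)"
    using le[of 1] by (cases "I l") (auto intro: field_le_epsilon)
  then show "l \<in> {x \<in> X. I x + ereal (g x) \<le> ereal c}" using l by (cases "I l") auto
qed

lemma closed_rate_IB_sublevel:
  assumes b: "b > 0" and p: "p > 0" and D: "D = Global \<longrightarrow> p \<le> 1"
  shows "closed {x \<in> {0..b} \<times> {0..b} \<times> {0..1}. rate_IB D b p \<kappa> x \<le> ereal c}"
proof -
  let ?X = "{0..b} \<times> {0..b} \<times> {0..1::real}"
  let ?Y = "{x \<in> ?X. admissible D b p (fst x)}"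
  have X: "closed ?X" by (intro closed_Times closed_atLeastAtMost)
  have Y: "closed ?Y"
  proof (cases "D = Global \<and> p = 1")
    case True
    have "closed (?X \<inter> {x. fst x = b})" by (intro closed_Int X closed_Collect_eq continuous_intros)
    also have "?X \<inter> {x. fst x = b} = ?Y" using True by (auto simp: admissible_def)
    finally show ?thesis .
  next
    case False
    then have "?Y = ?X" by (auto simp: admissible_def)
    then show ?thesis using X by simp
  qed
  have "continuous_on ?Y (\<lambda>x. access_cost D b p (fst x))"
  proof (cases D)
    case Local
    then show ?thesis by (simp add: access_cost_def)
  next
    case Global
    show ?thesis
    proof (cases "p = 1")
      case True
      have "continuous_on ?Y (\<lambda>x. 0 :: real)" by simp
      then show ?thesis
        by (rule continuous_on_eq) (auto simp: Global True admissible_def access_cost_def global_cost_def)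
    next
      case False
      then have "continuous_on {0..b} (global_cost b p)" using D[rule_format, OF Global] b by (intro continuous_on_global_cost) auto
      then have "continuous_on ?Y (\<lambda>x. global_cost b p (fst x))"
        by (rule continuous_on_compose2) (auto intro!: continuous_intros)
      then show ?thesis by (simp add: Global access_cost_def)
    qed
  qed
  from closed_sublevel_add_continuous[OF rate_L_sublevel_closed Y this, of b p \<kappa> c] b p
  have "closed {x \<in> ?Y. rate_L b p \<kappa> x + ereal (access_cost D b p (fst x)) \<le> ereal c}" by simp
  also have "{x \<in> ?Y. rate_L b p \<kappa> x + ereal (access_cost D b p (fst x)) \<le> ereal c} = {x \<in> ?X. rate_IB D b p \<kappa> x \<le> ereal c}"
    unfolding rate_IB_eq by auto
  finally show ?thesis .
qed

theorem theorem1p1: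
  fixes b p :: real and \<kappa> :: nat and D :: access_rule
  assumes "b > 0" and "p > 0" and "\<kappa> \<ge> 1"
    and "D = Global \<Longrightarrow> p \<le> 1"
  shows "large_deviation_principle ({0..b} \<times> {0..b} \<times> {0..1})
           (\<lambda>N. measure_pmf (access_pmf D b p N)) (scaled_triple \<kappa>) (rate_IB D b p \<kappa>)"
proof -
  have D: "D = Global \<longrightarrow> p \<le> 1" using assms(4) by blast
  let ?X = "{0..b} \<times> {0..b} \<times> {0..1::real}"
  let ?P = "\<lambda>A N. measure (measure_pmf (access_pmf D b p N))
    {\<omega> \<in> space (measure_pmf (access_pmf D b p N)). scaled_triple \<kappa> N \<omega> \<in> A}"
  have X: "closed ?X" by (intro closed_Times closed_atLeastAtMost)
  have P: "eventually (\<lambda>N. ?P A N = measure_pmf.prob (profile_pmf D b p N) {m. size m = N \<and> profile_mean \<kappa> m \<in> A}) sequentially" for A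
    using eventually_gt_at_top[of 0] by eventually_elim (rule prob_scaled_triple)
  show ?thesis
    unfolding large_deviation_principle_def rate_function_on_def
  proof (intro conjI ballI allI impI)
    show "0 \<le> rate_IB D b p \<kappa> x" if "x \<in> ?X" for x
      using rate_IB_nonneg[OF assms(1,2) D that] .
    show "closedin (top_of_set ?X) {x \<in> ?X. rate_IB D b p \<kappa> x \<le> ereal c}" for c
      by (rule closed_subset[OF _ closed_rate_IB_sublevel[OF assms(1,2) D]]) auto
  next
    fix F assume "closedin (top_of_set ?X) F"
    then have F: "closed F" "F \<subseteq> ?X"
      using X by (auto simp: closedin_closed_eq dest: closedin_subset)
    show "limsup (\<lambda>N. ereal (1 / real N) * ln_prob (?P F N)) \<le> - (INF x\<in>F. rate_IB D b p \<kappa> x)"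
    proof (rule ldp_upperI)
      fix c assume "ereal c < (INF x\<in>F. rate_IB D b p \<kappa> x)"
      from ldp_upper_bound[OF assms(1,2) D F this] P[of F]
      show "eventually (\<lambda>N. ?P F N \<le> exp (- real N * c)) sequentially"
        by eventually_elim (simp only:)
    qed simp
  next
    fix G assume G: "openin (top_of_set ?X) G"
    show "- (INF x\<in>G. rate_IB D b p \<kappa> x) \<le> liminf (\<lambda>N. ereal (1 / real N) * ln_prob (?P G N))"
    proof (rule ldp_lowerI)
      fix c assume "(INF x\<in>G. rate_IB D b p \<kappa> x) < ereal c"
      from ldp_lower_bound[OF assms(1,2) D G this] P[of G]
      show "eventually (\<lambda>N. exp (- real N * c) \<le> ?P G N) sequentially"
        by eventually_elim (simp only:)
    qed
  qed
qed

end
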